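(* Let $\mathbb{E}$ be a rearrangement invariant Banach function space over $(\mathbb{R}_+,dt)$ with Boyd indices $p_{\mathbb{E}},q_{\mathbb{E}}\in(1,\infty)$. Then $A^-_{p_{\mathbb{E}}}\subseteq M_{\mathbb{E}}$ and $A^+_{p_{\mathbb{E}}}\subseteq M^{\mathbb{E}}$. In particular, $A^-_{p_{\mathbb{E}}}\cap A^+_{p_{\mathbb{E}}}\subseteq C_{\mathbb{E}}$.
   Context: $\mathbb{R}_+=[0,\infty)$; $L^1_{loc}$ denotes functions locally integrable on $\mathbb{R}_+$; $\mathcal{M}$ denotes the complex measurable functions on $\mathbb{R}_+$. Rearrangement invariant Banach function spaces over $(\mathbb{R}_+,dt)$ are understood in the sense of Bennett–Sharpley (given by a rearrangement invariant Banach function norm $\|\cdot\|_{\mathbb{E}}$, with Fatou property). Operators: $Pf(t)=\frac1t\int_0^tf(s)\,ds$ (Hardy operator, maximal domain $L^1_{loc}$), $Qf(t)=\int_t^\infty f(s)\,\frac{ds}{s}$ (maximal domain: measurable $f$ with $f\chi_{(\tau,\infty)}\in L^1(t^{-1}dt)$ for every $\tau>0$). Boyd indices: with dilations $D_tf(s)=f(s/t)$ and $h_{\mathbb{E}}(t)=\|D_t\|_{\mathcal{L}(\mathbb{E})}$, $p_{\mathbb{E}}=\lim_{t\to\infty}\frac{\log t}{\log h_{\mathbb{E}}(t)}$ and $q_{\mathbb{E}}=\lim_{t\to0+}\frac{\log t}{\log h_{\mathbb{E}}(t)}$. Weights: a weight is a measurable function $w:(0,\infty)\to(0,\infty)$,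 always assumed locally integrable on $(0,\infty)$. Write $w(B)=\int_Bw\,dt$. For measurable $f$, $w_f(\lambda)=w(\{|f|>\lambda\})$ and $f^*_w(t)=\inf\{\lambda>0:w_f(\lambda)\le t\}$. $\mathbb{E}_w=\{f\in\mathcal{M}:\|f\|_{\mathbb{E}_w}:=\|f^*_w\|_{\mathbb{E}}<\infty\}$. Classes of weights: $M_{\mathbb{E}}$ (resp. $M^{\mathbb{E}}$) is the class of weights $w$ such that $\mathbb{E}_w\subseteq L^1_{loc}$ and $P$ is bounded on $\mathbb{E}_w$ (resp. $\mathbb{E}_w$ is contained in the maximal domain of $Q$ and $Q$ is bounded on $\mathbb{E}_w$). $C_{\mathbb{E}}=M_{\mathbb{E}}\cap M^{\mathbb{E}}$. For $p\in(1,\infty)$ and $p'=p/(p-1)$, a weight $w$ belongs to $A_p^-$ if $$\sup_{0\le a<b<c}\frac1{(c-a)^p}\Bigl(\int_b^cw\,dt\Bigr)\Bigl(\int_a^bw^{1-p'}\,dt\Bigr)^{p-1}<\infty,$$ and $A_p^+=\{w^{1-p}:w\in A^-_{p'}\}$. *)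

theory Defs
  imports "HOL-Analysis.Analysis"
begin

section \<open>Rearrangement invariant Banach function norms (Bennett--Sharpley)\<close>

text \<open>
  A function norm is a functional on the \<open>[0,\<infinity>]\<close>-valued measurable functions; its values on
  non-measurable functions are unconstrained and never used.
\<close>

locale banach_function_norm = sigma_finite_measure M
  for M :: "'a measure" +
  fixes \<rho> :: "('a \<Rightarrow> ennreal) \<Rightarrow> ennreal"
  assumes norm_eq_0_iff:
      "f \<in> borel_measurable M \<Longrightarrow> \<rho> f = 0 \<longleftrightarrow> (AE x in M. f x = 0)"
    and norm_scale:
      "f \<in> borel_measurable M \<Longrightarrow> 0 \<le> a \<Longrightarrow> \<rho> (\<lambda>x. ennreal a * f x) = ennreal a * \<rho> f"
    and norm_triangle:
      "f \<in> borel_measurable M \<Longrightarrow> g \<in> borel_measurable M \<Longrightarrow> \<rho> (\<lambda>x. f x + g x) \<le> \<rho> f + \<rho> g"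
    and norm_mono:
      "f \<in> borel_measurable M \<Longrightarrow> g \<in> borel_measurable M \<Longrightarrow> AE x in M. g x \<le> f x \<Longrightarrow> \<rho> g \<le> \<rho> f"
    and norm_Fatou:
      "(\<And>n::nat. F n \<in> borel_measurable M) \<Longrightarrow> f \<in> borel_measurable M \<Longrightarrow>
        AE x in M. incseq (\<lambda>n. F n x) \<and> f x = (SUP n. F n x) \<Longrightarrow> \<rho> f = (SUP n. \<rho> (F n))"
    and norm_indicator_finite:
      "A \<in> sets M \<Longrightarrow> emeasure M A < \<infinity> \<Longrightarrow> \<rho> (indicator A) < \<infinity>"
    and norm_local_integral:
      "A \<in> sets M \<Longrightarrow> emeasure M A < \<infinity> \<Longrightarrow>
        \<exists>C::real. 0 < C \<and> (\<forall>f\<in>borel_measurable M. (\<integral>\<^sup>+x\<in>A. f x \<partial>M) \<le> ennreal C * \<rho> f)"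

definition equimeasurable :: "'a measure \<Rightarrow> ('a \<Rightarrow> ennreal) \<Rightarrow> ('a \<Rightarrow> ennreal) \<Rightarrow> bool" where
  "equimeasurable M f g \<longleftrightarrow>
     (\<forall>r::real. 0 \<le> r \<longrightarrow> emeasure M {x \<in> space M. ennreal r < f x} = emeasure M {x \<in> space M. ennreal r < g x})"

locale ri_banach_function_norm = banach_function_norm M \<rho>
  for M :: "'a measure" and \<rho> :: "('a \<Rightarrow> ennreal) \<Rightarrow> ennreal" +
  assumes norm_rearrangement_invariant:
      "f \<in> borel_measurable M \<Longrightarrow> g \<in> borel_measurable M \<Longrightarrow>
        AE x in M. f x < \<infinity> \<Longrightarrow> AE x in M. g x < \<infinity> \<Longrightarrow> equimeasurable M f g \<Longrightarrow> \<rho> f = \<rho> g"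


section \<open>Function spaces over the half-line\<close>

text \<open>
  Functions on \<open>[0,\<infinity>)\<close> or \<open>(0,\<infinity>)\<close> are total functions on the reals whose values elsewhere are
  irrelevant. A space over \<open>[0,\<infinity>)\<close> is given by its function norm \<open>\<rho>\<close>.
\<close>

abbreviation half_line :: "real measure" where
  "half_line \<equiv> lebesgue_on {0..}"

abbreviation measurable_funs :: "(real \<Rightarrow> complex) set" where
  "measurable_funs \<equiv> borel_measurable half_line"

definition locally_integrable_on ::
    "real set \<Rightarrow> (real \<Rightarrow> 'b::{banach, second_countable_topology}) \<Rightarrow> bool" where
  "locally_integrable_on S f \<longleftrightarrow> (\<forall>K. compact K \<and> K \<subseteq> S \<longrightarrow> set_integrable lebesgue K f)"

definition L1_loc :: "(real \<Rightarrow> complex) set" where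
  "L1_loc = {f \<in> measurable_funs. locally_integrable_on {0..} f}"

definition space_norm :: "((real \<Rightarrow> ennreal) \<Rightarrow> ennreal) \<Rightarrow> (real \<Rightarrow> complex) \<Rightarrow> ennreal" where
  "space_norm \<rho> f = \<rho> (\<lambda>t. ennreal (norm (f t)))"


section \<open>Boyd indices\<close>

definition dilation :: "real \<Rightarrow> (real \<Rightarrow> complex) \<Rightarrow> real \<Rightarrow> complex" where
  "dilation t f s = f (s / t)"

definition dilation_norm :: "((real \<Rightarrow> ennreal) \<Rightarrow> ennreal) \<Rightarrow> real \<Rightarrow> ennreal" where
  "dilation_norm \<rho> t =
     (SUP f\<in>{f \<in> measurable_funs. space_norm \<rho> f \<le> 1}. space_norm \<rho> (dilation t f))"

text \<open>
  The two indices are limits in \<open>[1,\<infinity>]\<close>. The following relations say that the limit is the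
  finite number \<open>p\<close>, resp. \<open>q\<close>. Where \<open>dilation_norm \<rho> t = 1\<close> the quotient is \<open>0\<close> by the
  convention on division, so that an infinite index is never mistaken for a finite nonzero one.
\<close>

definition has_boyd_index_p :: "((real \<Rightarrow> ennreal) \<Rightarrow> ennreal) \<Rightarrow> real \<Rightarrow> bool" where
  "has_boyd_index_p \<rho> p \<longleftrightarrow> ((\<lambda>t. ln t / ln (enn2real (dilation_norm \<rho> t))) \<longlongrightarrow> p) at_top"

definition has_boyd_index_q :: "((real \<Rightarrow> ennreal) \<Rightarrow> ennreal) \<Rightarrow> real \<Rightarrow> bool" where
  "has_boyd_index_q \<rho> q \<longleftrightarrow> ((\<lambda>t. ln t / ln (enn2real (dilation_norm \<rho> t))) \<longlongrightarrow> q) (at_right 0)"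


section \<open>Weights and weighted spaces\<close>

definition weight :: "(real \<Rightarrow> real) \<Rightarrow> bool" where
  "weight w \<longleftrightarrow> w \<in> borel_measurable (lebesgue_on {0<..}) \<and> (\<forall>t>0. 0 < w t) \<and>
     locally_integrable_on {0<..} w"

definition weight_measure :: "(real \<Rightarrow> real) \<Rightarrow> real set \<Rightarrow> ennreal" where
  "weight_measure w B = (\<integral>\<^sup>+t\<in>B. ennreal (w t) \<partial>lebesgue)"

definition distribution_fun :: "(real \<Rightarrow> real) \<Rightarrow> (real \<Rightarrow> complex) \<Rightarrow> real \<Rightarrow> ennreal" where
  "distribution_fun w f r = weight_measure w {t. 0 < t \<and> r < norm (f t)}"

text \<open>The infimum is taken in \<open>[0,\<infinity>]\<close>, so that it is \<open>\<infinity>\<close> for the empty set.\<close>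

definition rearrangement :: "(real \<Rightarrow> real) \<Rightarrow> (real \<Rightarrow> complex) \<Rightarrow> real \<Rightarrow> ennreal" where
  "rearrangement w f t = Inf {ennreal r |r. 0 < r \<and> distribution_fun w f r \<le> ennreal t}"

definition weighted_norm ::
    "((real \<Rightarrow> ennreal) \<Rightarrow> ennreal) \<Rightarrow> (real \<Rightarrow> real) \<Rightarrow> (real \<Rightarrow> complex) \<Rightarrow> ennreal" where
  "weighted_norm \<rho> w f = \<rho> (rearrangement w f)"

definition weighted_space ::
    "((real \<Rightarrow> ennreal) \<Rightarrow> ennreal) \<Rightarrow> (real \<Rightarrow> real) \<Rightarrow> (real \<Rightarrow> complex) set" where
  "weighted_space \<rho> w = {f \<in> measurable_funs. weighted_norm \<rho> w f < \<infinity>}"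

definition bounded_on_weighted_space ::
    "((real \<Rightarrow> ennreal) \<Rightarrow> ennreal) \<Rightarrow> (real \<Rightarrow> real) \<Rightarrow>
     ((real \<Rightarrow> complex) \<Rightarrow> real \<Rightarrow> complex) \<Rightarrow> bool" where
  "bounded_on_weighted_space \<rho> w T \<longleftrightarrow>
     (\<exists>C::real. \<forall>f\<in>weighted_space \<rho> w.
        T f \<in> weighted_space \<rho> w \<and> weighted_norm \<rho> w (T f) \<le> ennreal C * weighted_norm \<rho> w f)"


section \<open>The Hardy operators and classes of weights\<close>

definition hardy_P :: "(real \<Rightarrow> complex) \<Rightarrow> real \<Rightarrow> complex" where
  "hardy_P f t = (1 / t) *\<^sub>R set_lebesgue_integral lebesgue {0..t} f"

definition hardy_Q :: "(real \<Rightarrow> complex) \<Rightarrow> real \<Rightarrow> complex" where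
  "hardy_Q f t = set_lebesgue_integral lebesgue {t<..} (\<lambda>s. (1 / s) *\<^sub>R f s)"

definition hardy_Q_domain :: "(real \<Rightarrow> complex) set" where
  "hardy_Q_domain =
     {f \<in> measurable_funs. \<forall>\<tau>>0. set_integrable lebesgue {\<tau><..} (\<lambda>s. (1 / s) *\<^sub>R f s)}"

definition M_lower :: "((real \<Rightarrow> ennreal) \<Rightarrow> ennreal) \<Rightarrow> (real \<Rightarrow> real) set" where
  "M_lower \<rho> =
     {w. weight w \<and> weighted_space \<rho> w \<subseteq> L1_loc \<and> bounded_on_weighted_space \<rho> w hardy_P}"

definition M_upper :: "((real \<Rightarrow> ennreal) \<Rightarrow> ennreal) \<Rightarrow> (real \<Rightarrow> real) set" where
  "M_upper \<rho> =
     {w. weight w \<and> weighted_space \<rho> w \<subseteq> hardy_Q_domain \<and> bounded_on_weighted_space \<rho> w hardy_Q}"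

definition C_class :: "((real \<Rightarrow> ennreal) \<Rightarrow> ennreal) \<Rightarrow> (real \<Rightarrow> real) set" where
  "C_class \<rho> = M_lower \<rho> \<inter> M_upper \<rho>"

text \<open>Powers of elements of \<open>[0,\<infinity>]\<close>, for positive exponents.\<close>

definition ennreal_powr :: "ennreal \<Rightarrow> real \<Rightarrow> ennreal" where
  "ennreal_powr x r = (if x = \<infinity> then \<infinity> else ennreal (enn2real x powr r))"

definition conj_exp :: "real \<Rightarrow> real" where
  "conj_exp p = p / (p - 1)"

text \<open>The integral of \<open>w powr (1 - p')\<close> may a priori be infinite, hence the supremum in \<open>[0,\<infinity>]\<close>.\<close>

definition A_minus :: "real \<Rightarrow> (real \<Rightarrow> real) set" where
  "A_minus p =
     {w. weight w \<and>
        (SUP (a, b, c)\<in>{(a::real, b::real, c::real). 0 \<le> a \<and> a < b \<and> b < c}.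
           ennreal (1 / (c - a) powr p) *
           (\<integral>\<^sup>+t\<in>{b<..<c}. ennreal (w t) \<partial>lebesgue) *
           ennreal_powr (\<integral>\<^sup>+t\<in>{a<..<b}. ennreal (w t powr (1 - conj_exp p)) \<partial>lebesgue) (p - 1)) < \<infinity>}"

text \<open>Equality of functions only on \<open>(0,\<infinity>)\<close>, the domain of a weight.\<close>

definition A_plus :: "real \<Rightarrow> (real \<Rightarrow> real) set" where
  "A_plus p = {v. \<exists>w\<in>A_minus (conj_exp p). \<forall>t>0. v t = w t powr (1 - p)}"

end

theory Submission
  imports Defs
begin

text \<open>
  Both operators are controlled by interpolation. For \<open>P\<close>, a weight in \<open>A\<^sub>p\<^sup>-\<close> is shown to lie in
  \<open>A\<^sub>r\<^sup>-\<close> for some \<open>r < p\<close>: on a component of the set where the backward maximal function of the dual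
  weight exceeds a level (rising sun lemma) the \<open>A\<^sub>p\<close> condition forces the dual weight to be large
  on half of the component, which gives a one-sided reverse Hoelder inequality. The same decomposition
  shows that \<open>A\<^sub>r\<^sup>-\<close> implies weak type \<open>(r, r)\<close> for \<open>P\<close>. For \<open>Q\<close> the self-improvement is transferred by
  the reflection \<open>t \<mapsto> - t\<close>, and weak type \<open>(r, r)\<close> follows from the geometric growth of the mass of
  \<open>(0, 2\<^sup>k b)\<close>. Since the classes grow with the exponent, both operators have weak types \<open>r\<^sub>0 < p\<close> and
  \<open>r\<^sub>1 > max p q\<close>; so the rearrangement of the image is bounded by a sum of dilations of \<open>f\<^sup>*\<^sub>w\<close> with
  coefficients \<open>2\<^sup>-\<^sup>k\<^sup>/\<^sup>r\<^sup>0\<close> and \<open>2\<^sup>k\<^sup>/\<^sup>r\<^sup>1\<close>, and the Boyd indices make the norms of these dilations summable.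
\<close>

section \<open>Weighted measures\<close>

text \<open>Weak type at the exponent p itself would not be enough. It yields the coefficients
  2^(-k/p), while the Boyd index p bounds the norm of the dilation by 2^k only by multiples of
  2^(k/r) with r < p, so the series of norms need not converge; an exponent r0 strictly below p
  restores a geometric ratio. This is why the weight class must be improved before interpolation
  starts. The dual weight is w to the power -1/(p-1), so lowering p means raising the integrability
  of the dual weight: hence a reverse Hoelder inequality for \<open>dual_weight p w\<close>. The
  obstacle is that the conditions are one-sided: A_p^- compares w on an interval with the dual
  weight on the interval to its left, never on the same one, and no doubling property is at hand.
  The reverse Hoelder inequality is therefore proved only on intervals whose right end point is
  good, in the sense that all averages of the dual weight reaching back from it stay below a level
  \<mu>; the self-improvement has to find such end points. Its constants depend on p and K alone, so
  that they serve all intervals at once.\<close>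

lemma AE_lebesgue_notin_finite: "finite A \<Longrightarrow> AE t in lebesgue. t \<notin> (A :: real set)"
  by (rule AE_not_in) (simp add: negligible_iff_null_sets[symmetric] negligible_finite)

lemma weight_measure_eq_emeasure:
  assumes "g \<in> borel_measurable lebesgue" "A \<in> sets lebesgue"
  shows "weight_measure g A = emeasure (density lebesgue (\<lambda>t. ennreal (g t))) A"
  using assms by (simp add: weight_measure_def emeasure_density)

lemma weight_measure_mono:
  assumes "\<And>t. t \<in> A \<Longrightarrow> t \<in> B \<and> g t \<le> h t"
  shows "weight_measure g A \<le> weight_measure h B"
  unfolding weight_measure_def
  by (intro nn_integral_mono) (auto simp: indicator_def assms intro!: ennreal_leI)

lemma weight_measure_cong:
  assumes "A = B" "\<And>t. t \<in> B \<Longrightarrow> g t = h t"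
  shows "weight_measure g A = weight_measure h B"
  using assms by (intro antisym weight_measure_mono) auto

lemma weight_measure_UN:
  assumes "countable I" "\<And>i. i \<in> I \<Longrightarrow> A i \<in> sets lebesgue" "disjoint_family_on A I"
    and g: "g \<in> borel_measurable lebesgue"
  shows "weight_measure g (\<Union>i\<in>I. A i) = (\<integral>\<^sup>+i. weight_measure g (A i) \<partial>count_space I)"
proof -
  have U: "(\<Union>i\<in>I. A i) \<in> sets lebesgue" using assms(1,2) by (rule sets.countable_UN'')
  have "emeasure (density lebesgue (\<lambda>t. ennreal (g t))) (\<Union>i\<in>I. A i) =
      (\<integral>\<^sup>+i. emeasure (density lebesgue (\<lambda>t. ennreal (g t))) (A i) \<partial>count_space I)"
    by (rule emeasure_UN_countable) (use assms in \<open>auto\<close>)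
  moreover have "\<dots> = (\<integral>\<^sup>+i. weight_measure g (A i) \<partial>count_space I)"
    by (intro nn_integral_cong) (simp add: weight_measure_eq_emeasure g assms(2))
  ultimately show ?thesis by (simp add: weight_measure_eq_emeasure[OF g U])
qed

text \<open>The passage from single components to a whole level set. Integration against
  \<open>count_space\<close> treats finite and infinite index sets alike. The families
  \<open>A\<close> and \<open>B\<close> may differ, which permits comparing each piece with its
  neighbour.\<close>

lemma weight_measure_le_UN:
  assumes "countable I" "\<And>i. i \<in> I \<Longrightarrow> A i \<in> sets lebesgue" "\<And>i. i \<in> I \<Longrightarrow> B i \<in> sets lebesgue"
    and "disjoint_family_on A I" "disjoint_family_on B I"
    and "g \<in> borel_measurable lebesgue" "h \<in> borel_measurable lebesgue"
    and le: "\<And>i. i \<in> I \<Longrightarrow> weight_measure g (A i) \<le> c * weight_measure h (B i)"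
  shows "weight_measure g (\<Union>i\<in>I. A i) \<le> c * weight_measure h (\<Union>i\<in>I. B i)"
proof -
  have "weight_measure g (\<Union>i\<in>I. A i) = (\<integral>\<^sup>+i. weight_measure g (A i) \<partial>count_space I)"
    by (rule weight_measure_UN) fact+
  also have "\<dots> \<le> (\<integral>\<^sup>+i. c * weight_measure h (B i) \<partial>count_space I)"
    by (intro nn_integral_mono) (auto simp: le)
  also have "\<dots> = c * (\<integral>\<^sup>+i. weight_measure h (B i) \<partial>count_space I)"
    by (intro nn_integral_cmult) auto
  also have "(\<integral>\<^sup>+i. weight_measure h (B i) \<partial>count_space I) = weight_measure h (\<Union>i\<in>I. B i)"
    by (rule weight_measure_UN[symmetric]) fact+
  finally show ?thesis .
qed

lemma weight_measure_add:
  assumes "g \<in> borel_measurable lebesgue" "h \<in> borel_measurable lebesgue" "A \<in> sets lebesgue"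
    "\<And>t. 0 \<le> g t" "\<And>t. 0 \<le> h t"
  shows "weight_measure (\<lambda>t. g t + h t) A = weight_measure g A + weight_measure h A"
  unfolding weight_measure_def using assms
  by (subst nn_integral_add[symmetric]) (auto simp: distrib_right intro!: nn_integral_cong)

lemma weight_measure_cmult:
  assumes "g \<in> borel_measurable lebesgue" "A \<in> sets lebesgue" "0 \<le> c"
  shows "weight_measure (\<lambda>t. c * g t) A = ennreal c * weight_measure g A"
  unfolding weight_measure_def using assms
  by (subst nn_integral_cmult[symmetric]) (auto simp: ennreal_mult' ac_simps intro!: nn_integral_cong)

lemma weight_measure_Un:
  assumes "g \<in> borel_measurable lebesgue" "A \<in> sets lebesgue" "B \<in> sets lebesgue" "A \<inter> B = {}"
  shows "weight_measure g (A \<union> B) = weight_measure g A + weight_measure g B"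
  using assms by (simp add: weight_measure_eq_emeasure plus_emeasure)

lemma weight_measure_pos:
  assumes "g \<in> borel_measurable lebesgue" "\<And>t. x < t \<Longrightarrow> t < y \<Longrightarrow> 0 < g t" "x < (y::real)"
  shows "0 < weight_measure g {x<..<y}"
proof -
  have "\<not> (AE t in lebesgue. t \<notin> {x<..<y})"
    using assms(3) by (subst AE_iff_measurable[of "{x<..<y}"]) auto
  moreover have "AE t in lebesgue. t \<notin> {x<..<y}" if "weight_measure g {x<..<y} = 0"
  proof -
    have "AE t in lebesgue. ennreal (g t) * indicator {x<..<y} t = 0"
      using that assms(1) unfolding weight_measure_def
      by (subst (asm) nn_integral_0_iff_AE) (auto intro!: borel_measurable_times_ennreal borel_measurable_indicator)
    then show ?thesis
      by (rule AE_mp) (use assms(2) in \<open>fastforce intro!: AE_I2 simp: indicator_def ennreal_eq_0_iff split: if_splits\<close>)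
  qed
  ultimately show ?thesis by (auto simp: zero_less_iff_neq_zero)
qed

text \<open>Replaces extended masses by a continuous real function, so that intermediate values,
  minima and closed level sets become available.\<close>

lemma weight_measure_primitive:
  assumes [measurable]: "g \<in> borel_measurable lebesgue" and nn: "\<And>t. 0 \<le> g t"
    and fin: "weight_measure g {a<..<b} < \<infinity>" and "a \<le> (b::real)"
  obtains G where "continuous_on {a..b} G" "G a = 0"
    "\<And>x y. a \<le> x \<Longrightarrow> x \<le> y \<Longrightarrow> y \<le> b \<Longrightarrow> G x \<le> G y \<and> weight_measure g {x<..<y} = ennreal (G y - G x)"
proof -
  have e: "weight_measure g {x<..<y} = (\<integral>\<^sup>+t. ennreal (g t * indicator {x..y} t) \<partial>lebesgue)" for x y
    unfolding weight_measure_def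
  proof (intro nn_integral_cong_AE)
    have "AE t in lebesgue. t \<notin> {x,y}"
      by (rule AE_lebesgue_notin_finite) simp
    then show "AE t in lebesgue. ennreal (g t) * indicator {x<..<y} t = ennreal (g t * indicator {x..y} t)"
      by (rule AE_mp) (auto intro!: AE_I2 simp: indicator_def)
  qed
  have gm: "(\<lambda>t. g t * indicator {x..y} t) \<in> borel_measurable lebesgue" for x y
    by (intro borel_measurable_times borel_measurable_indicator) auto
  have int: "set_integrable lebesgue {a..b} g"
  proof -
    have "integrable lebesgue (\<lambda>t. g t * indicator {a..b} t)"
      by (rule integrableI_nonneg[OF gm]) (use fin[unfolded e] nn in auto)
    then show ?thesis by (simp add: set_integrable_def mult.commute)
  qed
  have hk: "g integrable_on {a..b}"
    by (rule set_lebesgue_integral_eq_integral(1)[OF int])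
  define G where "G = (\<lambda>x. integral {a..x} g)"
  have "continuous_on {a..b} G" unfolding G_def by (rule indefinite_integral_continuous_1[OF hk])
  moreover have "G a = 0" by (simp add: G_def)
  moreover have "G x \<le> G y \<and> weight_measure g {x<..<y} = ennreal (G y - G x)"
    if "a \<le> x" "x \<le> y" "y \<le> b" for x y
  proof -
    have int2: "set_integrable lebesgue {x..y} g"
      by (rule set_integrable_subset[OF int]) (use that in auto)
    have "G y = G x + integral {x..y} g" unfolding G_def
      by (rule Henstock_Kurzweil_Integration.integral_combine[symmetric])
        (use that in \<open>auto intro: integrable_subinterval_real[OF hk]\<close>)
    moreover have "integral {x..y} g \<ge> 0"
      by (rule integral_nonneg[OF set_lebesgue_integral_eq_integral(1)[OF int2]]) (use nn in auto)
    moreover have "weight_measure g {x<..<y} = ennreal (integral {x..y} g)"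
    proof -
      have "integral {x..y} g = (\<integral>t. g t * indicator {x..y} t \<partial>lebesgue)"
        using set_lebesgue_integral_eq_integral(2)[OF int2]
        by (simp add: set_lebesgue_integral_def mult.commute)
      moreover have "(\<integral>\<^sup>+t. ennreal (g t * indicator {x..y} t) \<partial>lebesgue) =
          ennreal (\<integral>t. g t * indicator {x..y} t \<partial>lebesgue)"
        by (rule nn_integral_eq_integral)
          (use int2 nn in \<open>auto simp: set_integrable_def mult.commute\<close>)
      ultimately show ?thesis by (simp add: e)
    qed
    ultimately show ?thesis by simp
  qed
  ultimately show thesis by (rule that)
qed

text \<open>For 1 < p the exponent equals \<open>1 - conj_exp p\<close>, so this is the second
  weight in the A_p condition. Written without the conjugate exponent, a change of p is visibly a
  power of the dual weight.\<close>

definition dual_weight :: "real \<Rightarrow> (real \<Rightarrow> real) \<Rightarrow> real \<Rightarrow> real" where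
  "dual_weight p w t = w t powr (- 1 / (p - 1))"

text \<open>Hoelder's inequality up to the factor 2^p, by a truncation: where f exceeds c times the
  dual weight, \<open>f t powr (1 - p)\<close> is at most c^(1-p) w, and elsewhere c times the dual
  weight dominates f. The scale c is free and is chosen at the end.\<close>

lemma weight_measure_Holder_weak:
  assumes [measurable]: "f \<in> borel_measurable lebesgue" "w \<in> borel_measurable lebesgue" "A \<in> sets lebesgue"
    and w: "\<And>t. 0 < w t" and f: "\<And>t. 0 \<le> f t" and p: "1 < p"
    and s: "weight_measure (dual_weight p w) A \<le> ennreal s" "0 < s"
    and \<phi>: "weight_measure (\<lambda>t. f t powr p * w t) A \<le> ennreal \<phi>" "0 \<le> \<phi>"
  obtains i where "0 \<le> i" "weight_measure f A = ennreal i"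
    "i powr p \<le> 2 powr p * s powr (p - 1) * \<phi>"
proof -
  have [measurable]: "dual_weight p w \<in> borel_measurable lebesgue"
    unfolding dual_weight_def by measurable
  have dual_nn: "0 \<le> dual_weight p w t" for t by (simp add: dual_weight_def)
  have main: "weight_measure f A \<le> ennreal (c * s + c powr (1 - p) * \<phi>)" if c: "0 < c" for c
  proof -
    have pw: "f t \<le> c * dual_weight p w t + c powr (1 - p) * (f t powr p * w t)" for t
    proof (cases "f t \<le> c * dual_weight p w t")
      case True
      then show ?thesis using w[of t] f[of t] by (simp add: add_increasing2 less_imp_le)
    next
      case False
      have dpos: "0 < dual_weight p w t" using w[of t] by (simp add: dual_weight_def)
      with False c have ft: "0 < f t" by (smt (verit) mult_pos_pos)
      have "f t = f t powr p * f t powr (1 - p)" using ft by (simp add: powr_add[symmetric])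
      also have "\<dots> \<le> f t powr p * (c * dual_weight p w t) powr (1 - p)"
        using False p c dpos ft by (intro mult_left_mono powr_mono2') auto
      also have "(c * dual_weight p w t) powr (1 - p) = c powr (1 - p) * w t"
        using c w[of t] p by (simp add: powr_mult dual_weight_def powr_powr minus_divide_left del: minus_divide_left[symmetric])
      finally have "f t \<le> c powr (1 - p) * (f t powr p * w t)" by (simp add: ac_simps)
      then show ?thesis using dpos c by (simp add: add_increasing)
    qed
    have "weight_measure f A \<le> weight_measure (\<lambda>t. c * dual_weight p w t + c powr (1 - p) * (f t powr p * w t)) A"
      by (rule weight_measure_mono) (use pw in auto)
    also have "\<dots> = ennreal c * weight_measure (dual_weight p w) A + ennreal (c powr (1 - p)) * weight_measure (\<lambda>t. f t powr p * w t) A"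
      using c w[THEN less_imp_le] by (subst weight_measure_add) (auto simp: weight_measure_cmult dual_nn)
    also have "\<dots> \<le> ennreal c * ennreal s + ennreal (c powr (1 - p)) * ennreal \<phi>"
      by (intro add_mono mult_left_mono s \<phi>) auto
    also have "\<dots> = ennreal (c * s + c powr (1 - p) * \<phi>)"
      using c s \<phi> by (simp add: ennreal_mult[symmetric] ennreal_plus[symmetric] del: ennreal_plus)
    finally show ?thesis .
  qed
  define i where "i = enn2real (weight_measure f A)"
  have fin: "weight_measure f A < \<infinity>" using main[of 1] by (simp add: le_less_trans)
  have i: "weight_measure f A = ennreal i" "0 \<le> i" using fin by (auto simp: i_def)
  have "i powr p \<le> 2 powr p * s powr (p - 1) * \<phi>"
  proof (cases "i = 0")
    case False
    then have ipos: "0 < i" using i by simp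
    \<comment> \<open>With this scale \<open>c * s\<close> is half of i, so that the other term has
      to carry the other half.\<close>
    define c where "c = i / (2 * s)"
    have c: "0 < c" using ipos s by (simp add: c_def)
    have "ennreal i \<le> ennreal (c * s + c powr (1 - p) * \<phi>)" using main[OF c] i by simp
    then have "i \<le> c * s + c powr (1 - p) * \<phi>" using c s \<phi> by (subst (asm) ennreal_le_iff) auto
    then have "i / 2 \<le> c powr (1 - p) * \<phi>" using s by (simp add: c_def)
    then have "i / 2 * c powr (p - 1) \<le> c powr (1 - p) * \<phi> * c powr (p - 1)"
      by (intro mult_right_mono) auto
    also have "\<dots> = \<phi>" using c by (simp add: powr_add[symmetric] ac_simps)
    finally have *: "i / 2 * c powr (p - 1) \<le> \<phi>" .
    have "i powr p = i * i powr (p - 1)" using ipos by (simp add: powr_mult_base)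
    also have "\<dots> = 2 powr p * s powr (p - 1) * (i / 2 * c powr (p - 1))"
      using ipos s by (simp add: c_def powr_divide powr_mult powr_diff)
    also have "\<dots> \<le> 2 powr p * s powr (p - 1) * \<phi>" by (intro mult_left_mono *) auto
    finally show ?thesis .
  qed (use \<phi> in simp)
  with i show thesis using that by blast
qed

section \<open>The rising sun lemma and the backward maximal function\<close>

text \<open>Components are named by their end points, the pairs outside U that enclose a part of U;
  this makes distinct pairs disjoint. For a given x the end points are the nearest points of the
  compact sets \<open>{a..x} - U\<close> and \<open>{x..b} - U\<close>, which are nonempty since U
  misses a and b.\<close>

lemma open_real_components:
  assumes "open U" "U \<subseteq> {a<..<b::real}"
  obtains J where "countable J" "U = (\<Union>(\<alpha>,\<beta>)\<in>J. {\<alpha><..<\<beta>})"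
    "disjoint_family_on (\<lambda>(\<alpha>,\<beta>). {\<alpha><..<\<beta>}) J"
    "\<And>\<alpha> \<beta>. (\<alpha>,\<beta>) \<in> J \<Longrightarrow> a \<le> \<alpha> \<and> \<alpha> < \<beta> \<and> \<beta> \<le> b \<and> \<alpha> \<notin> U \<and> \<beta> \<notin> U"
proof -
  define J where "J = {(\<alpha>,\<beta>). \<alpha> < \<beta> \<and> {\<alpha><..<\<beta>} \<subseteq> U \<and> \<alpha> \<notin> U \<and> \<beta> \<notin> U}"
  have sub: "a \<le> \<alpha> \<and> \<beta> \<le> b" if "(\<alpha>,\<beta>) \<in> J" for \<alpha> \<beta>
  proof -
    have "{\<alpha><..<\<beta>} \<subseteq> {a<..<b}" "\<alpha> < \<beta>" using that assms by (auto simp: J_def)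
    then show ?thesis by (simp add: greaterThanLessThan_subseteq_greaterThanLessThan)
  qed
  have disj: "{\<alpha><..<\<beta>} \<inter> {\<alpha>'<..<\<beta>'} = {}" if "(\<alpha>,\<beta>) \<in> J" "(\<alpha>',\<beta>') \<in> J" "(\<alpha>,\<beta>) \<noteq> (\<alpha>',\<beta>')" for \<alpha> \<beta> \<alpha>' \<beta>'
  proof (rule ccontr)
    assume "\<not> ?thesis"
    then obtain x where "x \<in> {\<alpha><..<\<beta>} \<inter> {\<alpha>'<..<\<beta>'}" by blast
    then have x: "\<alpha> < x" "x < \<beta>" "\<alpha>' < x" "x < \<beta>'" by auto
    have "\<not> (\<alpha> < \<alpha>')" "\<not> (\<alpha>' < \<alpha>)" "\<not> (\<beta> < \<beta>')" "\<not> (\<beta>' < \<beta>)"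
      using that x by (auto simp: J_def subset_iff)
    with that(3) show False by auto
  qed
  have dis: "disjoint_family_on (\<lambda>(\<alpha>,\<beta>). {\<alpha><..<\<beta>}) J"
    unfolding disjoint_family_on_def using disj by fast
  have inj: "inj_on (\<lambda>(\<alpha>,\<beta>). {\<alpha><..<\<beta>}) J"
  proof (rule inj_onI, clarify)
    fix \<alpha> \<beta> \<alpha>' \<beta>' assume J: "(\<alpha>,\<beta>) \<in> J" "(\<alpha>',\<beta>') \<in> J" and "{\<alpha><..<\<beta>} = {\<alpha>'<..<\<beta>'}"
    moreover have "{\<alpha><..<\<beta>} \<noteq> {}" using J by (auto simp: J_def)
    ultimately show "\<alpha> = \<alpha>' \<and> \<beta> = \<beta>'" using disj[OF J] by auto
  qed
  have "countable ((\<lambda>(\<alpha>,\<beta>). {\<alpha><..<\<beta>}) ` J)"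
    proof (rule countable_disjoint_open_subsets)
    show "pairwise disjnt ((\<lambda>(\<alpha>,\<beta>). {\<alpha><..<\<beta>}) ` J)"
      unfolding pairwise_image by (rule pairwiseI) (use disj in \<open>force simp: disjnt_def\<close>)
  qed auto
  then have cnt: "countable J" using inj by (rule countable_image_inj_on)
  have "\<exists>\<alpha> \<beta>. (\<alpha>,\<beta>) \<in> J \<and> \<alpha> < x \<and> x < \<beta>" if x: "x \<in> U" for x
  proof -
    have bx: "a < x" "x < b" using x assms by auto
    define L where "L = {a..x} - U" 
    define R where "R = {x..b} - U"
    have "a \<in> L" "b \<in> R" using assms(2) bx by (auto simp: L_def R_def)
    then have L: "compact L" "L \<noteq> {}" and R: "compact R" "R \<noteq> {}"
      using assms(1) by (auto simp: L_def R_def intro!: compact_diff)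
    obtain \<alpha> where \<alpha>: "\<alpha> \<in> L" "\<And>y. y \<in> L \<Longrightarrow> y \<le> \<alpha>" using compact_attains_sup[OF L] by blast
    obtain \<beta> where \<beta>: "\<beta> \<in> R" "\<And>y. y \<in> R \<Longrightarrow> \<beta> \<le> y" using compact_attains_inf[OF R] by blast
    have "\<alpha> < x" "x < \<beta>" using \<alpha> \<beta> x by (auto simp: L_def R_def order.order_iff_strict)
    moreover have "y \<in> U" if "\<alpha> < y" "y < \<beta>" for y
      using \<alpha>(2)[of y] \<beta>(2)[of y] that \<alpha>(1) \<beta>(1) by (cases "y \<le> x") (auto simp: L_def R_def)
    ultimately show ?thesis using \<alpha>(1) \<beta>(1) by (intro exI[of _ \<alpha>] exI[of _ \<beta>]) (auto simp: J_def L_def R_def)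
  qed
  then have "U \<subseteq> (\<Union>(\<alpha>,\<beta>)\<in>J. {\<alpha><..<\<beta>})" by fastforce
  moreover have "(\<Union>(\<alpha>,\<beta>)\<in>J. {\<alpha><..<\<beta>}) \<subseteq> U" by (auto simp: J_def)
  ultimately have "U = (\<Union>(\<alpha>,\<beta>)\<in>J. {\<alpha><..<\<beta>})" by (rule antisym)
  then show thesis
  proof (rule that[OF cnt _ dis])
    fix \<alpha> \<beta> assume J: "(\<alpha>,\<beta>) \<in> J"
    then show "a \<le> \<alpha> \<and> \<alpha> < \<beta> \<and> \<beta> \<le> b \<and> \<alpha> \<notin> U \<and> \<beta> \<notin> U"
      using sub[OF J] by (simp add: J_def)
  qed
qed

lemma weight_measure_const:
  assumes "A \<in> sets lebesgue" "0 \<le> c"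
  shows "weight_measure (\<lambda>_. c) A = ennreal c * weight_measure (\<lambda>_. 1) A"
  using weight_measure_cmult[of "\<lambda>_. 1" A c] assms by simp

lemma weight_measure_one_interval:
  "x \<le> y \<Longrightarrow> weight_measure (\<lambda>_. 1) {x<..<y::real} = ennreal (y - x)"
  by (simp add: weight_measure_def)

lemma weight_measure_greaterThanAtMost:
  "weight_measure g {x<..y::real} = weight_measure g {x<..<y}"
  unfolding weight_measure_def
proof (intro nn_integral_cong_AE)
  have "AE t in lebesgue. t \<notin> {y}"
    by (rule AE_lebesgue_notin_finite) simp
  then show "AE t in lebesgue. ennreal (g t) * indicator {x<..y} t = ennreal (g t) * indicator {x<..<y} t"
    by (rule AE_mp) (auto intro!: AE_I2 simp: indicator_def)
qed

lemma weight_measure_subset: "A \<subseteq> B \<Longrightarrow> weight_measure g A \<le> weight_measure g B"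
  by (rule weight_measure_mono) auto

lemma weight_measure_empty [simp]: "weight_measure g {} = 0"
  by (simp add: weight_measure_def)

text \<open>A one-sided substitute for the Lebesgue differentiation theorem.\<close>

lemma weight_measure_le_of_backward_averages:
  fixes a b \<mu> :: real
  assumes f [measurable]: "f \<in> borel_measurable lebesgue" and nn: "\<And>t. 0 \<le> f t"
    and fin: "weight_measure f {a<..<b} < \<infinity>" and \<mu>: "0 \<le> \<mu>"
    and B: "B \<in> sets lebesgue" "B \<subseteq> {a<..<b}"
    and avg: "\<And>x y. x \<in> B \<Longrightarrow> a \<le> y \<Longrightarrow> y < x \<Longrightarrow> weight_measure f {y<..<x} \<le> ennreal (\<mu> * (x - y))"
  shows "weight_measure f B \<le> ennreal \<mu> * weight_measure (\<lambda>_. 1) B"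
proof (cases "a < b")
  case True
  obtain G where G: "continuous_on {a..b} G" "G a = 0"
    "\<And>x y. a \<le> x \<Longrightarrow> x \<le> y \<Longrightarrow> y \<le> b \<Longrightarrow> G x \<le> G y \<and> weight_measure f {x<..<y} = ennreal (G y - G x)"
    using weight_measure_primitive[OF f nn fin] True by (metis less_imp_le)
  have approx: "weight_measure f B \<le> ennreal \<mu> * weight_measure (\<lambda>_. 1) B + ennreal (\<mu> * e)" if e: "0 < e" for e
  proof -
    \<comment> \<open>Outer regularity: the components of a slightly larger open set take the place
      of B, at the price of an error of at most \<open>\<mu> * e\<close>.\<close>
    obtain T where T: "open T" "B \<subseteq> T" "T - B \<in> lmeasurable" "emeasure lebesgue (T - B) < ennreal e"
      using sets_lebesgue_outer_open[OF B(1) e] by metis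
    define U where "U = T \<inter> {a<..<b}"
    have U: "open U" "U \<subseteq> {a<..<b}" "B \<subseteq> U" "U - B \<in> sets lebesgue"
      using T B by (auto simp: U_def intro!: sets.Diff borel_open)
    obtain J where J: "countable J" "U = (\<Union>(\<alpha>,\<beta>)\<in>J. {\<alpha><..<\<beta>})"
      "disjoint_family_on (\<lambda>(\<alpha>,\<beta>). {\<alpha><..<\<beta>}) J"
      "\<And>\<alpha> \<beta>. (\<alpha>,\<beta>) \<in> J \<Longrightarrow> a \<le> \<alpha> \<and> \<alpha> < \<beta> \<and> \<beta> \<le> b \<and> \<alpha> \<notin> U \<and> \<beta> \<notin> U"
      using open_real_components[OF U(1,2)] by metis
    have comp: "weight_measure f ({\<alpha><..<\<beta>} \<inter> B) \<le> ennreal \<mu> * weight_measure (\<lambda>_. 1) {\<alpha><..<\<beta>}"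
      if "(\<alpha>,\<beta>) \<in> J" for \<alpha> \<beta>
    proof (cases "{\<alpha><..<\<beta>} \<inter> B = {}")
      case False
      have ab: "a \<le> \<alpha>" "\<alpha> < \<beta>" "\<beta> \<le> b" using J(4)[OF that] by auto
      let ?S = "{\<alpha><..<\<beta>} \<inter> B"
      \<comment> \<open>Continuity of G carries the bound on the average over (\<alpha>, x) from the
        points x of B to their supremum d, and the part of B in this component lies in (\<alpha>,
        d].\<close>
      define d where "d = Sup ?S"
      define Z where "Z = {x \<in> {\<alpha>..\<beta>}. G x - G \<alpha> - \<mu> * (x - \<alpha>) \<le> 0}"
      have "continuous_on {\<alpha>..\<beta>} G" by (rule continuous_on_subset[OF G(1)]) (use ab in auto)
      then have "closed Z" unfolding Z_def
        by (intro continuous_on_closed_Collect_le continuous_intros) auto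
      moreover have "?S \<subseteq> Z"
      proof
        fix x assume x: "x \<in> ?S"
        then have "weight_measure f {\<alpha><..<x} \<le> ennreal (\<mu> * (x - \<alpha>))" using avg[of x \<alpha>] ab by auto
        with G(3)[of \<alpha> x] x ab \<mu> show "x \<in> Z" by (auto simp: Z_def ennreal_le_iff)
      qed
      ultimately have "closure ?S \<subseteq> Z" by (rule closure_minimal[rotated])
      moreover have bdd: "bdd_above ?S" by (rule bdd_aboveI[of _ \<beta>]) auto
      ultimately have d: "d \<in> Z" using closure_contains_Sup[OF False bdd] by (auto simp: d_def)
      then have d': "\<alpha> \<le> d" "d \<le> \<beta>" "G d - G \<alpha> \<le> \<mu> * (d - \<alpha>)" by (auto simp: Z_def)
      have "weight_measure f ?S \<le> weight_measure f {\<alpha><..d}"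
        by (rule weight_measure_subset) (auto simp: d_def intro!: cSup_upper bdd)
      also have "\<dots> = ennreal (G d - G \<alpha>)"
        using G(3)[of \<alpha> d] ab d' by (simp add: weight_measure_greaterThanAtMost)
      also have "\<dots> \<le> ennreal (\<mu> * (\<beta> - \<alpha>))"
        using d' \<mu> by (intro ennreal_leI) (meson diff_right_mono mult_left_mono order_trans)
      also have "\<dots> = ennreal \<mu> * weight_measure (\<lambda>_. 1) {\<alpha><..<\<beta>}"
        using \<mu> ab by (simp add: weight_measure_one_interval ennreal_mult)
      finally show ?thesis .
    qed simp
    have "weight_measure f (\<Union>i\<in>J. (case i of (\<alpha>,\<beta>) \<Rightarrow> {\<alpha><..<\<beta>}) \<inter> B)
      \<le> ennreal \<mu> * weight_measure (\<lambda>_. 1) (\<Union>i\<in>J. (case i of (\<alpha>,\<beta>) \<Rightarrow> {\<alpha><..<\<beta>}))"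
    proof (rule weight_measure_le_UN[OF J(1)])
      show "disjoint_family_on (\<lambda>i. (case i of (\<alpha>,\<beta>) \<Rightarrow> {\<alpha><..<\<beta>}) \<inter> B) J"
        using J(3) unfolding disjoint_family_on_def by blast
    qed (use J(3) comp B(1) in auto)
    also have "(\<Union>i\<in>J. (case i of (\<alpha>,\<beta>) \<Rightarrow> {\<alpha><..<\<beta>})) = U" using J(2) by simp
    also have "(\<Union>i\<in>J. (case i of (\<alpha>,\<beta>) \<Rightarrow> {\<alpha><..<\<beta>}) \<inter> B) = B" using J(2) U(3) by auto
    also have "weight_measure (\<lambda>_. 1) U = weight_measure (\<lambda>_. 1) (B \<union> (U - B))" using U by (simp add: Un_absorb1)
    also have "\<dots> = weight_measure (\<lambda>_. 1) B + weight_measure (\<lambda>_. 1) (U - B)"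
      by (rule weight_measure_Un) (use B U in auto)
    also have "weight_measure (\<lambda>_. 1) (U - B) \<le> weight_measure (\<lambda>_. 1) (T - B)"
      by (rule weight_measure_subset) (auto simp: U_def)
    also have "weight_measure (\<lambda>_. 1) (T - B) \<le> ennreal e"
      using T(3,4) by (simp add: weight_measure_def fmeasurableD less_imp_le)
    finally have "weight_measure f B \<le> ennreal \<mu> * (weight_measure (\<lambda>_. 1) B + ennreal e)"
      by (simp add: add_left_mono mult_left_mono)
    then show ?thesis using \<mu> e by (simp add: distrib_left ennreal_mult)
  qed
  show ?thesis
  proof (rule ennreal_le_epsilon)
    fix e :: real assume "0 < e"
    \<comment> \<open>The denominator \<open>\<mu> + 1\<close> keeps the choice of the error
      meaningful for \<mu> = 0.\<close>
    have "weight_measure f B \<le> ennreal \<mu> * weight_measure (\<lambda>_. 1) B + ennreal (\<mu> * (e / (\<mu> + 1)))"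
      by (rule approx) (use \<open>0 < e\<close> \<mu> in auto)
    also have "ennreal (\<mu> * (e / (\<mu> + 1))) \<le> ennreal e"
      using \<open>0 < e\<close> \<mu> by (intro ennreal_leI) (simp add: field_simps)
    finally show "weight_measure f B \<le> ennreal \<mu> * weight_measure (\<lambda>_. 1) B + ennreal e"
      by (simp add: add_left_mono)
  qed
next
  case False
  then have "B = {}" using B(2) by auto
  then show ?thesis by simp
qed

text \<open>Let z be a minimum point of H on [a, x]. No earlier value is lower, so z is outside the
  set; as (\<alpha>, x] lies inside, z is at or before \<alpha>, and since \<alpha> is outside too,
  H \<alpha> is the same minimum. The upper bound at \<beta> comes from \<beta> lying outside as
  well. For \<beta> = b that carries no information, because the set excludes b by definition; hence
  the hypothesis on b in the last clause.\<close>

lemma rising_sun: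
  fixes H :: "real \<Rightarrow> real"
  assumes cont: "continuous_on {a..b} H"
  obtains J where "countable J"
    "{x \<in> {a<..<b}. \<exists>y. a \<le> y \<and> y < x \<and> H y < H x} = (\<Union>(\<alpha>,\<beta>)\<in>J. {\<alpha><..<\<beta>})"
    "disjoint_family_on (\<lambda>(\<alpha>,\<beta>). {\<alpha><..<\<beta>}) J"
    "\<And>\<alpha> \<beta>. (\<alpha>,\<beta>) \<in> J \<Longrightarrow> a \<le> \<alpha> \<and> \<alpha> < \<beta> \<and> \<beta> \<le> b"
    "\<And>\<alpha> \<beta> x. (\<alpha>,\<beta>) \<in> J \<Longrightarrow> \<alpha> < x \<Longrightarrow> x \<le> \<beta> \<Longrightarrow> H \<alpha> \<le> H x"
    "\<And>\<alpha> \<beta>. (\<alpha>,\<beta>) \<in> J \<Longrightarrow> (\<And>y. a \<le> y \<Longrightarrow> y < b \<Longrightarrow> H b \<le> H y) \<Longrightarrow> H \<beta> \<le> H \<alpha>"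
proof -
  define U where "U = {x \<in> {a<..<b}. \<exists>y. a \<le> y \<and> y < x \<and> H y < H x}"
  have "U = (\<Union>y\<in>{a..<b}. {x \<in> {y<..<b}. H x \<in> {H y<..}})"
    by (auto simp: U_def intro!: bexI)
  moreover have "open {x \<in> {y<..<b}. H x \<in> {H y<..}}" if "y \<in> {a..<b}" for y
  proof -
    have "open ({y<..<b} \<inter> H -` {H y<..})"
      by (rule continuous_open_preimage)
        (use that in \<open>auto intro!: continuous_on_subset[OF cont]\<close>)
    then show ?thesis by (simp add: Int_def vimage_def)
  qed
  ultimately have "open U" by auto
  moreover have Uab: "U \<subseteq> {a<..<b}" by (auto simp: U_def)
  ultimately obtain J where J: "countable J" "U = (\<Union>(\<alpha>,\<beta>)\<in>J. {\<alpha><..<\<beta>})"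
      "disjoint_family_on (\<lambda>(\<alpha>,\<beta>). {\<alpha><..<\<beta>}) J"
      "\<And>\<alpha> \<beta>. (\<alpha>,\<beta>) \<in> J \<Longrightarrow> a \<le> \<alpha> \<and> \<alpha> < \<beta> \<and> \<beta> \<le> b \<and> \<alpha> \<notin> U \<and> \<beta> \<notin> U"
    using open_real_components by metis
  have low: "H \<alpha> \<le> H x" if "(\<alpha>,\<beta>) \<in> J" "\<alpha> < x" "x < \<beta>" for \<alpha> \<beta> x
  proof -
    have ab: "a \<le> \<alpha>" "\<beta> \<le> b" "\<alpha> \<notin> U" using J(4)[OF that(1)] by auto
    have "\<exists>z\<in>{a..x}. \<forall>y\<in>{a..x}. H z \<le> H y"
    proof -
      have "continuous_on {a..x} H" by (rule continuous_on_subset[OF cont]) (use that(2,3) ab in auto)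
      then show ?thesis by (intro continuous_attains_inf) (use that(2,3) ab in auto)
    qed
    then obtain z where z: "z \<in> {a..x}" "\<forall>y\<in>{a..x}. H z \<le> H y" by blast
    have "z \<notin> U" using z by (force simp: U_def)
    then have "z \<le> \<alpha>" using J(2) that z(1) by force
    have "H \<alpha> \<le> H z"
    proof (cases "z = \<alpha>")
      case False
      then have "z < \<alpha>" using \<open>z \<le> \<alpha>\<close> by simp
      moreover have "\<alpha> \<in> {a<..<b}" "a \<le> z" using \<open>z < \<alpha>\<close> z(1) ab that by auto
      ultimately show ?thesis using \<open>\<alpha> \<notin> U\<close> unfolding U_def by force
    qed simp
    also have "\<dots> \<le> H x" using z that ab by auto
    finally show ?thesis .
  qed
  have low': "H \<alpha> \<le> H x" if "(\<alpha>,\<beta>) \<in> J" "\<alpha> < x" "x \<le> \<beta>" for \<alpha> \<beta> x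
  proof (cases "x < \<beta>")
    case False
    then have x: "x = \<beta>" using that by simp
    have ab: "a \<le> \<alpha>" "\<beta> \<le> b" "\<alpha> < \<beta>" using J(4)[OF that(1)] by auto
    have "continuous_on {\<alpha>..\<beta>} H" by (rule continuous_on_subset[OF cont]) (use ab in auto)
    then have "(H \<longlongrightarrow> H \<beta>) (at \<beta> within {\<alpha>..\<beta>})"
      using ab by (simp add: continuous_on)
    then have lim: "(H \<longlongrightarrow> H \<beta>) (at_left \<beta>)" using ab(3) by (simp add: at_within_Icc_at_left)
    have "eventually (\<lambda>x. x \<in> {\<alpha><..<\<beta>}) (at_left \<beta>)"
      using eventually_at_left[OF ab(3)] ab(3) by auto
    then have "eventually (\<lambda>x. H \<alpha> \<le> H x) (at_left \<beta>)"
      by (rule eventually_mono) (use low[OF that(1)] in auto)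
    with lim show ?thesis unfolding x by (rule tendsto_lowerbound) simp
  qed (use low that in auto)
  have up: "H \<beta> \<le> H \<alpha>" if "(\<alpha>,\<beta>) \<in> J" and b: "\<And>y. a \<le> y \<Longrightarrow> y < b \<Longrightarrow> H b \<le> H y" for \<alpha> \<beta>
  proof (cases "\<beta> = b")
    case False
    then show ?thesis using J(4)[OF that(1)] by (auto simp: U_def not_less)
  qed (use J(4)[OF that(1)] b in auto)
  show thesis using that[OF J(1) _ J(3)] J(2,4) low' up by (simp add: U_def)
qed

text \<open>
  The \<open>A\<^sub>p\<^sup>-\<close> condition on the triples from \<open>I\<close>, solved for the mass of \<open>w\<close> in order to avoid powers of
  extended reals.
\<close>

definition Ap_minus_on :: "real \<Rightarrow> real \<Rightarrow> real set \<Rightarrow> (real \<Rightarrow> real) \<Rightarrow> bool" where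
  "Ap_minus_on p K I w \<longleftrightarrow> (\<forall>x y z. x \<in> I \<longrightarrow> z \<in> I \<longrightarrow> x < y \<longrightarrow> y < z \<longrightarrow>
     (\<exists>s>0. weight_measure (dual_weight p w) {x<..<y} = ennreal s \<and>
       weight_measure w {y<..<z} \<le> ennreal (K * (z - x) powr p * s powr (1 - p))))"

text \<open>
  The proof cuts \<open>(a, b]\<close> at points where the mass of \<open>f\<close> is halved: then the \<open>A\<^sub>p\<close> condition
  on neighbouring pieces is applied with \<open>f\<close> living on the left one.
\<close>

lemma Ap_minus_interval_bound:
  fixes a b \<mu> :: real
  assumes f [measurable]: "f \<in> borel_measurable lebesgue" and w [measurable]: "w \<in> borel_measurable lebesgue"
    and nn: "\<And>t. 0 \<le> f t" and wpos: "\<And>t. 0 < w t"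
    and p: "1 < p" and K: "0 < K" and \<mu>: "0 < \<mu>"
    and Ap: "Ap_minus_on p K {a..b} w" and ab: "a < b"
    and fin: "weight_measure f {a<..<b} < \<infinity>"
    and avg: "\<And>x. a < x \<Longrightarrow> x \<le> b \<Longrightarrow> ennreal (\<mu> * (x - a)) \<le> weight_measure f {a<..<x}"
  shows "weight_measure w {a<..<b} \<le>
    ennreal (8 powr p * K * \<mu> powr (- p)) * weight_measure (\<lambda>t. f t powr p * w t) {a<..<b}"
proof -
  obtain G where G: "continuous_on {a..b} G" "G a = 0"
    "\<And>x y. a \<le> x \<Longrightarrow> x \<le> y \<Longrightarrow> y \<le> b \<Longrightarrow> G x \<le> G y \<and> weight_measure f {x<..<y} = ennreal (G y - G x)"
    using weight_measure_primitive[OF f nn fin] ab by (metis less_imp_le)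
  have Glow: "\<mu> * (x - a) \<le> G x" if "a < x" "x \<le> b" for x
  proof -
    have "ennreal (\<mu> * (x - a)) \<le> ennreal (G x)" using avg[OF that] G(2) G(3)[of a x] that by simp
    moreover have "0 \<le> G x" using G(2) G(3)[of a x] that by simp
    ultimately show ?thesis by (simp add: ennreal_le_iff)
  qed
  have Gb: "0 < G b" using Glow[of b] \<mu> ab by (smt (verit) mult_pos_pos)
  have "\<exists>x. x \<in> {a..b} \<and> G x = G b / 2 ^ k" for k :: nat
  proof -
    have "G b / 2 ^ k \<le> G b" using Gb by (simp add: divide_le_eq)
    then show ?thesis using IVT'[of G a "G b / 2 ^ k" b] G(1,2) Gb ab by auto
  qed
  then obtain x0 where x0: "\<And>k. x0 k \<in> {a..b}" "\<And>k. G (x0 k) = G b / 2 ^ k" by metis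
  \<comment> \<open>The intermediate value theorem may place \<open>x0 0\<close> before b if f
    vanishes near b. Starting at b itself lets the pieces cover (a, b).\<close>
  define x where "x k = (if k = 0 then b else x0 k)" for k
  have x: "x k \<in> {a..b}" "G (x k) = G b / 2 ^ k" for k
    using x0[of k] ab by (auto simp: x_def)
  have xdec: "x (Suc k) < x k" for k
  proof (rule ccontr)
    assume "\<not> ?thesis"
    then have "G (x k) \<le> G (x (Suc k))" using G(3)[of "x k" "x (Suc k)"] x(1) by auto
    then show False using Gb by (simp add: x(2) field_simps)
  qed
  have xa: "a < x k" for k
    using xdec[of k] x(1)[of "Suc k"] by auto
  have mono: "x m \<le> x n" if "n \<le> m" for m n
    by (rule lift_Suc_antimono_le[OF _ that]) (use xdec less_imp_le in auto)
  define A where "A k = {x (Suc k)<..x k}" for k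
  have disj: "disjoint_family A"
    unfolding disjoint_family_on_def
  proof (intro ballI impI)
    fix m n :: nat assume "m \<noteq> n"
    then consider "Suc m \<le> n" | "Suc n \<le> m" by linarith
    then show "A m \<inter> A n = {}"
    proof cases
      case 1
      then show ?thesis using mono[of "Suc m" n] by (auto simp: A_def)
    next
      case 2
      then show ?thesis using mono[of "Suc n" m] by (auto simp: A_def)
    qed
  qed
  have cover: "{a<..<b} \<subseteq> (\<Union>k. A k)"
  proof
    fix t assume t: "t \<in> {a<..<b}"
    then have "0 < G t" using Glow[of t] \<mu> by (smt (verit) greaterThanLessThan_iff mult_pos_pos)
    then obtain n where n: "G b / G t < 2 ^ n" using real_arch_pow[of 2 "G b / G t"] by auto
    then have "G (x n) < G t" using \<open>0 < G t\<close> Gb by (simp add: x(2) field_simps)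
    then have ex: "x n < t" using G(3)[of t "x n"] t x(1)[of n] by (cases "x n < t") auto
    define k where "k = (LEAST k. x k < t)"
    have k: "x k < t" unfolding k_def using ex by (rule LeastI)
    then have "k \<noteq> 0" using t by (cases k) (auto simp: x_def)
    then obtain m where m: "k = Suc m" by (cases k) auto
    then have "\<not> x m < t" using not_less_Least[of m "\<lambda>k. x k < t"] by (auto simp: k_def)
    then show "t \<in> (\<Union>k. A k)" using k m by (auto simp: A_def)
  qed
  let ?h = "\<lambda>t. f t powr p * w t"
  \<comment> \<open>8 = 4 * 2: the factor 4 compares the mass of f on (a, X) with that on (Z, Y),
    the factor 2 is the loss in \<open>weight_measure_Holder_weak\<close>.\<close>
  let ?c = "8 powr p * K * \<mu> powr (- p)"
  have c: "0 < ?c" using K \<mu> by simp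
  have step: "weight_measure w (A k) \<le> ennreal ?c * weight_measure ?h (A (Suc k))" for k
  proof (cases "weight_measure ?h (A (Suc k)) = \<infinity>")
    case True
    then show ?thesis using K \<mu> by (simp add: ennreal_mult_top)
  next
    case False
    define X Y Z where "X = x k" and "Y = x (Suc k)" and "Z = x (Suc (Suc k))"
    have xyz: "a < Z" "Z < Y" "Y < X" "X \<le> b"
      using xdec[of k] xdec[of "Suc k"] xa[of "Suc (Suc k)"] x(1)[of k] by (auto simp: X_def Y_def Z_def)
    define \<phi> where "\<phi> = enn2real (weight_measure ?h {Z<..<Y})"
    have \<phi>: "weight_measure ?h {Z<..<Y} = ennreal \<phi>" "0 \<le> \<phi>"
      using False by (auto simp: \<phi>_def A_def weight_measure_greaterThanAtMost Y_def Z_def less_top[symmetric])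
    obtain s where s: "0 < s" "weight_measure (dual_weight p w) {Z<..<Y} = ennreal s"
       "weight_measure w {Y<..<X} \<le> ennreal (K * (X - Z) powr p * s powr (1 - p))"
      using Ap[unfolded Ap_minus_on_def, rule_format, of Z X Y] xyz by auto
    obtain i where i: "0 \<le> i" "weight_measure f {Z<..<Y} = ennreal i" "i powr p \<le> 2 powr p * s powr (p - 1) * \<phi>"
      by (rule weight_measure_Holder_weak[OF f w _ wpos nn p, of "{Z<..<Y}" s \<phi>]) (use s \<phi> in auto)
    \<comment> \<open>Halving twice: (Z, Y) carries a quarter of the mass of f on (a, X). The lower
      bound on the average over (a, X) then bounds the length X - Z by a multiple of i.\<close>
    have "i = G Y - G Z" using i G(3)[of Z Y] xyz by simp
    also have "\<dots> = G b / 2 ^ k / 4" unfolding Y_def Z_def x(2) by (simp add: field_simps)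
    also have "\<dots> = G X / 4" by (simp add: X_def x(2))
    finally have GX: "G X = 4 * i" by simp
    have "\<mu> * (X - Z) \<le> 4 * i"
      using Glow[of X] xyz \<mu> GX by (smt (verit) mult_left_mono)
    then have "(\<mu> * (X - Z)) powr p \<le> (4 * i) powr p"
      using xyz \<mu> p by (intro powr_mono2) auto
    also have "\<dots> = 4 powr p * i powr p" using i by (simp add: powr_mult)
    also have "\<dots> \<le> 4 powr p * (2 powr p * s powr (p - 1) * \<phi>)" by (intro mult_left_mono i) auto
    also have "\<dots> = 8 powr p * s powr (p - 1) * \<phi>" by (simp add: powr_mult[symmetric])
    finally have bnd: "(\<mu> * (X - Z)) powr p \<le> 8 powr p * s powr (p - 1) * \<phi>" .
    have "K * (X - Z) powr p * s powr (1 - p) = K * \<mu> powr (- p) * s powr (1 - p) * (\<mu> * (X - Z)) powr p"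
      using \<mu> xyz by (simp add: powr_mult powr_minus)
    also have "\<dots> \<le> K * \<mu> powr (- p) * s powr (1 - p) * (8 powr p * s powr (p - 1) * \<phi>)"
      by (intro mult_left_mono bnd) (use K in auto)
    also have "\<dots> = ?c * \<phi> * (s powr (1 - p) * s powr (p - 1))" by (simp add: ac_simps)
    also have "s powr (1 - p) * s powr (p - 1) = 1" using s by (simp add: powr_add[symmetric])
    finally have "K * (X - Z) powr p * s powr (1 - p) \<le> ?c * \<phi>" by simp
    then have "ennreal (K * (X - Z) powr p * s powr (1 - p)) \<le> ennreal ?c * ennreal \<phi>"
      using c by (simp add: ennreal_mult[symmetric] \<phi> ennreal_leI)
    with s(3) have "weight_measure w {Y<..<X} \<le> ennreal ?c * ennreal \<phi>" by (rule order_trans)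
    then show ?thesis
      using \<phi> by (simp add: A_def weight_measure_greaterThanAtMost X_def Y_def Z_def)
  qed
  have "weight_measure w {a<..<b} \<le> weight_measure w (\<Union>k. A k)"
    by (rule weight_measure_subset[OF cover])
  \<comment> \<open>Each piece is charged to its left neighbour. The shifted family is again
    disjoint and stays inside (a, b).\<close>
  also have "\<dots> \<le> ennreal ?c * weight_measure ?h (\<Union>k. A (Suc k))"
  proof (rule weight_measure_le_UN)
    show "disjoint_family (\<lambda>k. A (Suc k))"
      using disj unfolding disjoint_family_on_def by blast
    show "disjoint_family A" by (rule disj)
  qed (use step in \<open>auto simp: A_def\<close>)
  also have "weight_measure ?h (\<Union>k. A (Suc k)) \<le> weight_measure ?h {a<..<b}"
  proof (rule weight_measure_subset, clarify)
    fix t k assume "t \<in> A (Suc k)"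
    then have "x (Suc (Suc k)) < t" "t \<le> x (Suc k)" by (auto simp: A_def)
    then show "t \<in> {a<..<b}" using xa[of "Suc (Suc k)"] xdec[of k] x(1)[of k] by auto
  qed
  finally show ?thesis by (simp add: mult_left_mono)
qed

text \<open>The rising sun lemma for the primitive of f minus \<mu> x; the set is where the backward
  maximal function of f relative to a exceeds \<mu>. The lower bound on averages is exactly what
  \<open>Ap_minus_interval_bound\<close> asks for on a component. The last clause bounds the mean
  over a component from above when b is a good end point.\<close>

lemma backward_maximal_components:
  fixes a b \<mu> :: real
  assumes f: "f \<in> borel_measurable lebesgue" and nn: "\<And>t. 0 \<le> f t"
    and \<mu>: "0 < \<mu>" and ab: "a < b" and fin: "weight_measure f {a<..<b} < \<infinity>"
  obtains J where "countable J"
    "{x \<in> {a<..<b}. \<exists>y. a \<le> y \<and> y < x \<and> ennreal (\<mu> * (x - y)) < weight_measure f {y<..<x}}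
       = (\<Union>(\<alpha>,\<beta>)\<in>J. {\<alpha><..<\<beta>})"
    "disjoint_family_on (\<lambda>(\<alpha>,\<beta>). {\<alpha><..<\<beta>}) J"
    "\<And>\<alpha> \<beta>. (\<alpha>,\<beta>) \<in> J \<Longrightarrow> a \<le> \<alpha> \<and> \<alpha> < \<beta> \<and> \<beta> \<le> b"
    "\<And>\<alpha> \<beta> x. (\<alpha>,\<beta>) \<in> J \<Longrightarrow> \<alpha> < x \<Longrightarrow> x \<le> \<beta> \<Longrightarrow> ennreal (\<mu> * (x - \<alpha>)) \<le> weight_measure f {\<alpha><..<x}"
    "\<And>\<alpha> \<beta>. (\<alpha>,\<beta>) \<in> J \<Longrightarrow> (\<And>y. a \<le> y \<Longrightarrow> y < b \<Longrightarrow> weight_measure f {y<..<b} \<le> ennreal (\<mu> * (b - y))) \<Longrightarrow>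
       weight_measure f {\<alpha><..<\<beta>} \<le> ennreal (\<mu> * (\<beta> - \<alpha>))"
proof -
  obtain G where G: "continuous_on {a..b} G" "G a = 0"
    "\<And>x y. a \<le> x \<Longrightarrow> x \<le> y \<Longrightarrow> y \<le> b \<Longrightarrow> G x \<le> G y \<and> weight_measure f {x<..<y} = ennreal (G y - G x)"
    using weight_measure_primitive[OF f nn fin] ab by (metis less_imp_le)
  define H where "H x = G x - \<mu> * x" for x
  have iff1: "ennreal (\<mu> * (x - y)) < weight_measure f {y<..<x} \<longleftrightarrow> H y < H x" 
   and iff2: "ennreal (\<mu> * (x - y)) \<le> weight_measure f {y<..<x} \<longleftrightarrow> H y \<le> H x"
   and iff3: "weight_measure f {y<..<x} \<le> ennreal (\<mu> * (x - y)) \<longleftrightarrow> H x \<le> H y"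
    if "a \<le> y" "y \<le> x" "x \<le> b" for x y
    using G(3)[OF that] that \<mu> by (auto simp: H_def ennreal_less_iff ennreal_le_iff algebra_simps)
  have "continuous_on {a..b} H" unfolding H_def by (intro continuous_intros G)
  then obtain J where J: "countable J"
    "{x \<in> {a<..<b}. \<exists>y. a \<le> y \<and> y < x \<and> H y < H x} = (\<Union>(\<alpha>,\<beta>)\<in>J. {\<alpha><..<\<beta>})"
    "disjoint_family_on (\<lambda>(\<alpha>,\<beta>). {\<alpha><..<\<beta>}) J"
    "\<And>\<alpha> \<beta>. (\<alpha>,\<beta>) \<in> J \<Longrightarrow> a \<le> \<alpha> \<and> \<alpha> < \<beta> \<and> \<beta> \<le> b"
    "\<And>\<alpha> \<beta> x. (\<alpha>,\<beta>) \<in> J \<Longrightarrow> \<alpha> < x \<Longrightarrow> x \<le> \<beta> \<Longrightarrow> H \<alpha> \<le> H x"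
    "\<And>\<alpha> \<beta>. (\<alpha>,\<beta>) \<in> J \<Longrightarrow> (\<And>y. a \<le> y \<Longrightarrow> y < b \<Longrightarrow> H b \<le> H y) \<Longrightarrow> H \<beta> \<le> H \<alpha>"
    by (rule rising_sun[of a b H]) (assumption | blast)+
  have E: "{x \<in> {a<..<b}. \<exists>y. a \<le> y \<and> y < x \<and> ennreal (\<mu> * (x - y)) < weight_measure f {y<..<x}}
    = {x \<in> {a<..<b}. \<exists>y. a \<le> y \<and> y < x \<and> H y < H x}"
    using iff1 by (auto simp: less_imp_le)
  show thesis
  proof (rule that[OF J(1) _ J(3,4)])
    show "ennreal (\<mu> * (x - \<alpha>)) \<le> weight_measure f {\<alpha><..<x}" if "(\<alpha>,\<beta>) \<in> J" "\<alpha> < x" "x \<le> \<beta>" for \<alpha> \<beta> x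
      using J(4)[OF that(1)] J(5)[OF that] that by (subst iff2) auto
    show "weight_measure f {\<alpha><..<\<beta>} \<le> ennreal (\<mu> * (\<beta> - \<alpha>))"
      if "(\<alpha>,\<beta>) \<in> J" and b: "\<And>y. a \<le> y \<Longrightarrow> y < b \<Longrightarrow> weight_measure f {y<..<b} \<le> ennreal (\<mu> * (b - y))" for \<alpha> \<beta>
    proof -
      have "H b \<le> H y" if "a \<le> y" "y < b" for y using b[OF that] that by (subst (asm) iff3) auto
      then have "H \<beta> \<le> H \<alpha>" by (rule J(6)[OF \<open>(\<alpha>,\<beta>) \<in> J\<close>])
      then show ?thesis using J(4)[OF \<open>(\<alpha>,\<beta>) \<in> J\<close>] by (subst iff3) auto
    qed
  qed (use J(2) E in auto)
qed

lemma Ap_minus_on_subset: "Ap_minus_on p K I w \<Longrightarrow> J \<subseteq> I \<Longrightarrow> Ap_minus_on p K J w"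
  unfolding Ap_minus_on_def by blast

text \<open>\<open>Ap_minus_interval_bound\<close> applies to every component of the level set, and
  the components are disjoint: summation takes the place of a covering argument.\<close>

lemma backward_maximal_weak_type:
  fixes a b \<mu> :: real
  assumes f: "f \<in> borel_measurable lebesgue" and w: "w \<in> borel_measurable lebesgue"
    and nn: "\<And>t. 0 \<le> f t" and wpos: "\<And>t. 0 < w t"
    and p: "1 < p" and K: "0 < K" and \<mu>: "0 < \<mu>"
    and Ap: "Ap_minus_on p K {a..b} w" and ab: "a < b"
    and fin: "weight_measure f {a<..<b} < \<infinity>"
  shows "weight_measure w {x \<in> {a<..<b}. \<exists>y. a \<le> y \<and> y < x \<and> ennreal (\<mu> * (x - y)) < weight_measure f {y<..<x}}
    \<le> ennreal (8 powr p * K * \<mu> powr (- p)) * weight_measure (\<lambda>t. f t powr p * w t) {a<..<b}"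
    (is "weight_measure w ?O \<le> ennreal ?c * weight_measure ?h _")
proof -
  obtain J where J: "countable J"
    "?O = (\<Union>(\<alpha>,\<beta>)\<in>J. {\<alpha><..<\<beta>})"
    "disjoint_family_on (\<lambda>(\<alpha>,\<beta>). {\<alpha><..<\<beta>}) J"
    "\<And>\<alpha> \<beta>. (\<alpha>,\<beta>) \<in> J \<Longrightarrow> a \<le> \<alpha> \<and> \<alpha> < \<beta> \<and> \<beta> \<le> b"
    "\<And>\<alpha> \<beta> x. (\<alpha>,\<beta>) \<in> J \<Longrightarrow> \<alpha> < x \<Longrightarrow> x \<le> \<beta> \<Longrightarrow> ennreal (\<mu> * (x - \<alpha>)) \<le> weight_measure f {\<alpha><..<x}"
    by (rule backward_maximal_components[OF f nn \<mu> ab fin]) (assumption | blast)+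
  have comp: "weight_measure w {\<alpha><..<\<beta>} \<le> ennreal ?c * weight_measure ?h {\<alpha><..<\<beta>}" if "(\<alpha>,\<beta>) \<in> J" for \<alpha> \<beta>
  proof (rule Ap_minus_interval_bound[OF f w nn wpos p K \<mu>])
    have ab: "a \<le> \<alpha>" "\<alpha> < \<beta>" "\<beta> \<le> b" using J(4)[OF that] by auto
    show "Ap_minus_on p K {\<alpha>..\<beta>} w" by (rule Ap_minus_on_subset[OF Ap]) (use ab in auto)
    show "\<alpha> < \<beta>" by fact
    have "weight_measure f {\<alpha><..<\<beta>} \<le> weight_measure f {a<..<b}" by (rule weight_measure_subset) (use ab in auto)
    then show "weight_measure f {\<alpha><..<\<beta>} < \<infinity>" using fin by (rule order.strict_trans1)
  qed (use J(5)[OF that] in auto)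
  have hm: "?h \<in> borel_measurable lebesgue" using f w by measurable
  have "weight_measure w (\<Union>i\<in>J. case i of (\<alpha>,\<beta>) \<Rightarrow> {\<alpha><..<\<beta>})
     \<le> ennreal ?c * weight_measure ?h (\<Union>i\<in>J. case i of (\<alpha>,\<beta>) \<Rightarrow> {\<alpha><..<\<beta>})"
    by (rule weight_measure_le_UN[OF J(1) _ _ J(3) J(3) w hm]) (use comp in auto)
  also have "weight_measure ?h (\<Union>i\<in>J. case i of (\<alpha>,\<beta>) \<Rightarrow> {\<alpha><..<\<beta>}) \<le> weight_measure ?h {a<..<b}"
    unfolding J(2)[symmetric] by (rule weight_measure_subset) auto
  finally show ?thesis unfolding J(2) by (simp add: mult_left_mono)
qed

section \<open>Reverse Hoelder inequality and self-improvement\<close>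

lemma dual_weight_pos: "0 < w t \<Longrightarrow> 0 < dual_weight p w t"
  by (simp add: dual_weight_def)

lemma dual_weight_nonneg: "0 \<le> dual_weight p w t"
  by (simp add: dual_weight_def)

lemma dual_weight_measurable [measurable]:
  "w \<in> borel_measurable M \<Longrightarrow> dual_weight p w \<in> borel_measurable M"
  unfolding dual_weight_def by measurable

lemma dual_weight_powr:
  assumes "0 < w t" "1 < p"
  shows "dual_weight p w t powr (1 - p) = w t"
proof -
  have "- 1 / (p - 1) * (1 - p) = 1" using assms by (simp add: field_simps)
  then show ?thesis using assms by (simp add: dual_weight_def powr_powr)
qed

text \<open>The dual weight is its own test function: inserted for f, it turns the integral of f^p w
  back into the dual mass.\<close>

lemma dual_weight_powr_mult:
  assumes "0 < w t" "1 < p"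
  shows "dual_weight p w t powr p * w t = dual_weight p w t"
proof -
  have "dual_weight p w t powr p * w t = dual_weight p w t powr p * dual_weight p w t powr (1 - p)"
    using assms by (simp add: dual_weight_powr)
  also have "\<dots> = dual_weight p w t"
    using dual_weight_pos[of w t p] assms(1) by (simp add: powr_add[symmetric])
  finally show ?thesis .
qed

lemma sets_lebesgue_Collect_interval:
  assumes "g \<in> borel_measurable lebesgue"
  shows "{x \<in> {a<..<b::real}. (c::real) < g x} \<in> sets lebesgue"
proof -
  have "g -` {c<..} \<inter> space lebesgue \<in> sets lebesgue" using assms by (rule measurable_sets) simp
  then have "{a<..<b} \<inter> (g -` {c<..} \<inter> space lebesgue) \<in> sets lebesgue" by (rule sets.Int[rotated]) simp
  moreover have "{x \<in> {a<..<b}. c < g x} = {a<..<b} \<inter> (g -` {c<..} \<inter> space lebesgue)" by auto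
  ultimately show ?thesis by (simp only:)
qed

text \<open>An estimate in the manner of Gehring. On a component of the level set of the maximal
  function, \<open>Ap_minus_interval_bound\<close> with f the dual weight shows that the mean of w
  is at most 8^p K \<mu>^(1-p). Where the dual weight is at most \<beta> \<mu>, w is at least
  (\<beta> \<mu>)^(1-p), so by the choice of \<beta> this happens on at most half of the component.
  As b is good, the mean of the dual weight over the component is at most \<mu>, and the other half
  pays for it.\<close>

lemma dual_weight_good_lambda:
  fixes a b \<mu> :: real
  assumes w [measurable]: "w \<in> borel_measurable lebesgue" and wpos: "\<And>t. 0 < w t"
    and p: "1 < p" and K: "0 < K" and \<mu>: "0 < \<mu>"
    and Ap: "Ap_minus_on p K {a..b} w" and ab: "a < b"
    and fin: "weight_measure (dual_weight p w) {a<..<b} < \<infinity>"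
    and avg: "\<And>y. a \<le> y \<Longrightarrow> y < b \<Longrightarrow> weight_measure (dual_weight p w) {y<..<b} \<le> ennreal (\<mu> * (b - y))"
    and \<beta>: "0 < \<beta>" "\<beta> \<le> 1" "\<beta> powr (p - 1) * (8 powr p * K) \<le> 1 / 2"
  shows "weight_measure (dual_weight p w) {x \<in> {a<..<b}. \<mu> < dual_weight p w x}
    \<le> ennreal (2 * \<mu>) * weight_measure (\<lambda>_. 1) {x \<in> {a<..<b}. \<beta> * \<mu> < dual_weight p w x}"
proof -
  let ?s = "dual_weight p w"
  let ?O = "{x \<in> {a<..<b}. \<exists>y. a \<le> y \<and> y < x \<and> ennreal (\<mu> * (x - y)) < weight_measure ?s {y<..<x}}"
  define E where "E m = {x \<in> {a<..<b}. m < ?s x}" for m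
  have E [measurable]: "E m \<in> sets lebesgue" for m
    unfolding E_def by (rule sets_lebesgue_Collect_interval) measurable
  have sm: "?s \<in> borel_measurable lebesgue" by measurable
  have spos: "0 < ?s t" for t using wpos by (rule dual_weight_pos)
  have spw: "?s t powr (1 - p) = w t" for t using wpos p by (rule dual_weight_powr)
  have smw: "?s t powr p * w t = ?s t" for t using wpos p by (rule dual_weight_powr_mult)
  obtain J where J: "countable J"
    "?O = (\<Union>(\<alpha>,\<beta>)\<in>J. {\<alpha><..<\<beta>})"
    "disjoint_family_on (\<lambda>(\<alpha>,\<beta>). {\<alpha><..<\<beta>}) J"
    "\<And>\<alpha> \<beta>. (\<alpha>,\<beta>) \<in> J \<Longrightarrow> a \<le> \<alpha> \<and> \<alpha> < \<beta> \<and> \<beta> \<le> b"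
    "\<And>\<alpha> \<beta> x. (\<alpha>,\<beta>) \<in> J \<Longrightarrow> \<alpha> < x \<Longrightarrow> x \<le> \<beta> \<Longrightarrow> ennreal (\<mu> * (x - \<alpha>)) \<le> weight_measure ?s {\<alpha><..<x}"
    "\<And>\<alpha> \<beta>. (\<alpha>,\<beta>) \<in> J \<Longrightarrow> (\<And>y. a \<le> y \<Longrightarrow> y < b \<Longrightarrow> weight_measure ?s {y<..<b} \<le> ennreal (\<mu> * (b - y))) \<Longrightarrow>
       weight_measure ?s {\<alpha><..<\<beta>} \<le> ennreal (\<mu> * (\<beta> - \<alpha>))"
    by (rule backward_maximal_components[OF sm dual_weight_nonneg \<mu> ab fin]) (assumption | blast)+
  have O: "?O \<in> sets lebesgue"
    unfolding J(2) by (rule sets.countable_UN''[OF J(1)]) auto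
  have comp: "weight_measure ?s {\<alpha><..<\<gamma>} \<le> ennreal (2 * \<mu>) * weight_measure (\<lambda>_. 1) ({\<alpha><..<\<gamma>} \<inter> E (\<beta> * \<mu>))"
    if I: "(\<alpha>,\<gamma>) \<in> J" for \<alpha> \<gamma>
  proof -
    have ab: "a \<le> \<alpha>" "\<alpha> < \<gamma>" "\<gamma> \<le> b" using J(4)[OF I] by auto
    have sI: "weight_measure ?s {\<alpha><..<\<gamma>} \<le> ennreal (\<mu> * (\<gamma> - \<alpha>))"
      by (rule J(6)[OF I avg])
    have "weight_measure w {\<alpha><..<\<gamma>} \<le>
      ennreal (8 powr p * K * \<mu> powr (- p)) * weight_measure (\<lambda>t. ?s t powr p * w t) {\<alpha><..<\<gamma>}"
    proof (rule Ap_minus_interval_bound[OF sm w dual_weight_nonneg wpos p K \<mu>])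
      show "Ap_minus_on p K {\<alpha>..\<gamma>} w" by (rule Ap_minus_on_subset[OF Ap]) (use ab in auto)
      show "weight_measure ?s {\<alpha><..<\<gamma>} < \<infinity>" using sI by (rule le_less_trans) simp
    qed (use J(5)[OF I] ab in auto)
    also have "weight_measure (\<lambda>t. ?s t powr p * w t) {\<alpha><..<\<gamma>} = weight_measure ?s {\<alpha><..<\<gamma>}"
      by (rule weight_measure_cong) (simp_all add: smw)
    also have "ennreal (8 powr p * K * \<mu> powr (- p)) * weight_measure ?s {\<alpha><..<\<gamma>}
        \<le> ennreal (8 powr p * K * \<mu> powr (- p)) * ennreal (\<mu> * (\<gamma> - \<alpha>))"
      by (rule mult_left_mono[OF sI]) simp
    also have "\<dots> = ennreal (8 powr p * K * \<mu> powr (1 - p) * (\<gamma> - \<alpha>))"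
      using K \<mu> ab by (simp add: ennreal_mult[symmetric] powr_diff powr_minus_divide)
    finally have wI: "weight_measure w {\<alpha><..<\<gamma>} \<le> ennreal (8 powr p * K * \<mu> powr (1 - p) * (\<gamma> - \<alpha>))" .
    have wlow: "1 \<le> (\<beta> * \<mu>) powr (p - 1) * w t" if "?s t \<le> \<beta> * \<mu>" for t
    proof -
      have "(\<beta> * \<mu>) powr (1 - p) \<le> ?s t powr (1 - p)"
        using that spos p by (intro powr_mono2') auto
      also have "\<dots> = w t" by (rule spw)
      finally have "(\<beta> * \<mu>) powr (p - 1) * (\<beta> * \<mu>) powr (1 - p) \<le> (\<beta> * \<mu>) powr (p - 1) * w t"
        by (rule mult_left_mono) simp
      then show ?thesis using \<beta> \<mu> by (simp add: powr_add[symmetric])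
    qed
    let ?L = "{\<alpha><..<\<gamma>} - E (\<beta> * \<mu>)"
    have "weight_measure (\<lambda>_. 1) ?L \<le> weight_measure (\<lambda>t. (\<beta> * \<mu>) powr (p - 1) * w t) {\<alpha><..<\<gamma>}"
      by (rule weight_measure_mono) (use ab wlow in \<open>auto simp: E_def not_less\<close>)
    also have "\<dots> = ennreal ((\<beta> * \<mu>) powr (p - 1)) * weight_measure w {\<alpha><..<\<gamma>}"
      by (rule weight_measure_cmult) auto
    also have "\<dots> \<le> ennreal ((\<beta> * \<mu>) powr (p - 1)) * ennreal (8 powr p * K * \<mu> powr (1 - p) * (\<gamma> - \<alpha>))"
      by (rule mult_left_mono[OF wI]) simp
    also have "\<dots> = ennreal (\<beta> powr (p - 1) * (8 powr p * K) * (\<mu> powr (p - 1) * \<mu> powr (1 - p)) * (\<gamma> - \<alpha>))"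
      using \<mu> \<beta> by (simp add: ennreal_mult'[symmetric] powr_mult ac_simps)
    also have "\<mu> powr (p - 1) * \<mu> powr (1 - p) = 1" using \<mu> by (simp add: powr_add[symmetric])
    also have "ennreal (\<beta> powr (p - 1) * (8 powr p * K) * 1 * (\<gamma> - \<alpha>)) \<le> ennreal (1 / 2 * (\<gamma> - \<alpha>))"
      using \<beta>(3) ab by (intro ennreal_leI mult_right_mono) auto
    finally have small: "weight_measure (\<lambda>_. 1) ?L \<le> ennreal (1 / 2 * (\<gamma> - \<alpha>))" .
    have "ennreal (\<gamma> - \<alpha>) = weight_measure (\<lambda>_. 1) (({\<alpha><..<\<gamma>} \<inter> E (\<beta> * \<mu>)) \<union> ?L)"
      using ab by (simp add: Int_Diff_Un weight_measure_one_interval)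
    also have "\<dots> = weight_measure (\<lambda>_. 1) ({\<alpha><..<\<gamma>} \<inter> E (\<beta> * \<mu>)) + weight_measure (\<lambda>_. 1) ?L"
      by (rule weight_measure_Un) auto
    also have "\<dots> \<le> weight_measure (\<lambda>_. 1) ({\<alpha><..<\<gamma>} \<inter> E (\<beta> * \<mu>)) + ennreal (1 / 2 * (\<gamma> - \<alpha>))"
      by (rule add_left_mono[OF small])
    finally have *: "ennreal (1 / 2 * (\<gamma> - \<alpha>)) + ennreal (1 / 2 * (\<gamma> - \<alpha>)) \<le>
        weight_measure (\<lambda>_. 1) ({\<alpha><..<\<gamma>} \<inter> E (\<beta> * \<mu>)) + ennreal (1 / 2 * (\<gamma> - \<alpha>))"
      using ab by (simp add: ennreal_plus[symmetric] del: ennreal_plus)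
    then have half: "ennreal (1 / 2 * (\<gamma> - \<alpha>)) \<le> weight_measure (\<lambda>_. 1) ({\<alpha><..<\<gamma>} \<inter> E (\<beta> * \<mu>))"
      by (metis add.commute ennreal_add_left_cancel_le ennreal_neq_top infinity_ennreal_def)
    have "weight_measure ?s {\<alpha><..<\<gamma>} \<le> ennreal (2 * \<mu>) * ennreal (1 / 2 * (\<gamma> - \<alpha>))"
      using sI \<mu> by (simp add: ennreal_mult'[symmetric])
    also have "\<dots> \<le> ennreal (2 * \<mu>) * weight_measure (\<lambda>_. 1) ({\<alpha><..<\<gamma>} \<inter> E (\<beta> * \<mu>))"
      by (rule mult_left_mono[OF half]) simp
    finally show ?thesis .
  qed
  have "weight_measure ?s (\<Union>i\<in>J. case i of (\<alpha>,\<gamma>) \<Rightarrow> {\<alpha><..<\<gamma>})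
     \<le> ennreal (2 * \<mu>) * weight_measure (\<lambda>_. 1) (\<Union>i\<in>J. (case i of (\<alpha>,\<gamma>) \<Rightarrow> {\<alpha><..<\<gamma>}) \<inter> E (\<beta> * \<mu>))"
  proof (rule weight_measure_le_UN[OF J(1) _ _ J(3)])
    show "disjoint_family_on (\<lambda>i. (case i of (\<alpha>,\<gamma>) \<Rightarrow> {\<alpha><..<\<gamma>}) \<inter> E (\<beta> * \<mu>)) J"
      using J(3) unfolding disjoint_family_on_def by blast
  qed (use comp E in auto)
  then have good: "weight_measure ?s ?O \<le> ennreal (2 * \<mu>) * weight_measure (\<lambda>_. 1) (?O \<inter> E (\<beta> * \<mu>))"
    unfolding J(2) by simp
  \<comment> \<open>Off the level set every backward average is at most \<mu>, which bounds the dual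
    mass there by \<mu> times the length.\<close>
  let ?B = "E \<mu> - ?O"
  have B: "?B \<in> sets lebesgue" using O E by auto
  have "weight_measure ?s ?B \<le> ennreal \<mu> * weight_measure (\<lambda>_. 1) ?B"
    by (rule weight_measure_le_of_backward_averages[OF sm dual_weight_nonneg fin _ B])
      (use \<mu> in \<open>auto simp: E_def not_less\<close>)
  also have "\<dots> \<le> ennreal (2 * \<mu>) * weight_measure (\<lambda>_. 1) ?B"
    using \<mu> by (intro mult_right_mono ennreal_leI) auto
  finally have bad: "weight_measure ?s ?B \<le> ennreal (2 * \<mu>) * weight_measure (\<lambda>_. 1) ?B" .
  have "\<beta> * \<mu> \<le> \<mu>" using \<beta> \<mu> by simp
  have "weight_measure ?s (E \<mu>) \<le> weight_measure ?s (?O \<union> ?B)"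
    by (rule weight_measure_subset) auto
  also have "\<dots> = weight_measure ?s ?O + weight_measure ?s ?B"
    by (rule weight_measure_Un) (use O B in auto)
  also have "\<dots> \<le> ennreal (2 * \<mu>) * (weight_measure (\<lambda>_. 1) (?O \<inter> E (\<beta> * \<mu>)) + weight_measure (\<lambda>_. 1) ?B)"
    unfolding distrib_left by (rule add_mono[OF good bad])
  also have "weight_measure (\<lambda>_. 1) (?O \<inter> E (\<beta> * \<mu>)) + weight_measure (\<lambda>_. 1) ?B
      = weight_measure (\<lambda>_. 1) ((?O \<inter> E (\<beta> * \<mu>)) \<union> ?B)"
    by (rule weight_measure_Un[symmetric]) (use O B E in auto)
  also have "\<dots> \<le> weight_measure (\<lambda>_. 1) (E (\<beta> * \<mu>))"
    by (rule weight_measure_subset) (use \<open>\<beta> * \<mu> \<le> \<mu>\<close> in \<open>auto simp: E_def\<close>)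
  finally show ?thesis by (simp add: E_def mult_left_mono)
qed

text \<open>Hole filling. Let \<phi> m be the dual mass of the set where the dual weight exceeds m.
  The previous estimate is split at the level 4 \<mu>: below it 2 \<mu> is at most 2/\<beta> times
  the dual weight, above it at most half of the dual weight. So \<phi> \<mu> is at most (2/\<beta>)
  (\<phi> (\<beta> \<mu>) - \<phi> (4 \<mu>)) + \<phi> (4 \<mu>) / 2, and since \<phi> (4 \<mu>)
  \<le> \<phi> \<mu>, collecting the terms at 4 \<mu> on the left leaves a factor below 1. The upper
  level is written \<open>4 / \<beta> * (\<beta> * \<mu>)\<close> to display the fixed ratio of the
  two levels.\<close>

lemma dual_weight_level_decay:
  fixes a b \<mu> :: real
  assumes w [measurable]: "w \<in> borel_measurable lebesgue" and wpos: "\<And>t. 0 < w t"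
    and p: "1 < p" and K: "0 < K" and \<mu>: "0 < \<mu>"
    and Ap: "Ap_minus_on p K {a..b} w" and ab: "a < b"
    and fin: "weight_measure (dual_weight p w) {a<..<b} < \<infinity>"
    and avg: "\<And>y. a \<le> y \<Longrightarrow> y < b \<Longrightarrow> weight_measure (dual_weight p w) {y<..<b} \<le> ennreal (\<mu> * (b - y))"
    and \<beta>: "0 < \<beta>" "\<beta> \<le> 1" "\<beta> powr (p - 1) * (8 powr p * K) \<le> 1 / 2"
  shows "weight_measure (dual_weight p w) {x \<in> {a<..<b}. 4 / \<beta> * (\<beta> * \<mu>) < dual_weight p w x}
    \<le> ennreal (4 / (\<beta> + 4)) * weight_measure (dual_weight p w) {x \<in> {a<..<b}. \<beta> * \<mu> < dual_weight p w x}"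
proof -
  let ?s = "dual_weight p w"
  have sm: "?s \<in> borel_measurable lebesgue" by measurable
  define E where "E m = {x \<in> {a<..<b}. m < ?s x}" for m
  have E: "E m \<in> sets lebesgue" for m
    unfolding E_def by (rule sets_lebesgue_Collect_interval[OF sm])
  define \<phi> where "\<phi> m = enn2real (weight_measure ?s (E m))" for m
  have \<phi>: "weight_measure ?s (E m) = ennreal (\<phi> m)" "0 \<le> \<phi> m" for m
  proof -
    have "weight_measure ?s (E m) \<le> weight_measure ?s {a<..<b}" by (rule weight_measure_subset) (auto simp: E_def)
    also note fin
    finally show "weight_measure ?s (E m) = ennreal (\<phi> m)" by (simp add: \<phi>_def)
  qed (simp add: \<phi>_def)
  have ord: "\<beta> * \<mu> \<le> \<mu>" "\<mu> \<le> 4 * \<mu>" using \<beta> \<mu> by auto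
  have E4: "E (4 * \<mu>) \<subseteq> E (\<beta> * \<mu>)" "E (4 * \<mu>) \<subseteq> E \<mu>" using ord by (auto simp: E_def)
  define D where "D = E (\<beta> * \<mu>) - E (4 * \<mu>)"
  have D: "D \<in> sets lebesgue" using E by (auto simp: D_def)
  have ED: "E (\<beta> * \<mu>) = D \<union> E (4 * \<mu>)" "D \<inter> E (4 * \<mu>) = {}" using E4 by (auto simp: D_def)
  have "weight_measure ?s (E \<mu>) \<le> ennreal (2 * \<mu>) * weight_measure (\<lambda>_. 1) (E (\<beta> * \<mu>))"
    unfolding E_def by (rule dual_weight_good_lambda[OF w wpos p K \<mu> Ap ab fin avg \<beta>])
  also have "\<dots> = weight_measure (\<lambda>_. 2 * \<mu>) (E (\<beta> * \<mu>))"
    using \<mu> E by (intro weight_measure_const[symmetric]) auto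
  also have "\<dots> = weight_measure (\<lambda>_. 2 * \<mu>) D + weight_measure (\<lambda>_. 2 * \<mu>) (E (4 * \<mu>))"
    unfolding ED(1) by (rule weight_measure_Un) (use D E ED in auto)
  also have "weight_measure (\<lambda>_. 2 * \<mu>) D \<le> weight_measure (\<lambda>t. 2 / \<beta> * ?s t) D"
    by (rule weight_measure_mono) (use \<beta> \<mu> in \<open>auto simp: D_def E_def field_simps\<close>)
  also have "weight_measure (\<lambda>_. 2 * \<mu>) (E (4 * \<mu>)) \<le> weight_measure (\<lambda>t. 1 / 2 * ?s t) (E (4 * \<mu>))"
    by (rule weight_measure_mono) (use \<mu> in \<open>auto simp: E_def\<close>)
  \<comment> \<open>The mass on E (4 \<mu>) is added on both sides to avoid a subtraction in the
    extended reals.\<close>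
  finally have "weight_measure ?s (E \<mu>) + weight_measure (\<lambda>t. 2 / \<beta> * ?s t) (E (4 * \<mu>))
     \<le> weight_measure (\<lambda>t. 2 / \<beta> * ?s t) D + weight_measure (\<lambda>t. 1 / 2 * ?s t) (E (4 * \<mu>))
        + weight_measure (\<lambda>t. 2 / \<beta> * ?s t) (E (4 * \<mu>))"
    by (simp add: add_mono)
  also have "\<dots> = weight_measure (\<lambda>t. 2 / \<beta> * ?s t) (E (\<beta> * \<mu>)) + weight_measure (\<lambda>t. 1 / 2 * ?s t) (E (4 * \<mu>))"
  proof -
    have "weight_measure (\<lambda>t. 2 / \<beta> * ?s t) (E (\<beta> * \<mu>)) =
        weight_measure (\<lambda>t. 2 / \<beta> * ?s t) D + weight_measure (\<lambda>t. 2 / \<beta> * ?s t) (E (4 * \<mu>))"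
      unfolding ED(1) by (rule weight_measure_Un) (use D E ED in auto)
    then show ?thesis by (simp add: ac_simps)
  qed
  finally have *: "weight_measure ?s (E \<mu>) + weight_measure (\<lambda>t. 2 / \<beta> * ?s t) (E (4 * \<mu>))
      \<le> weight_measure (\<lambda>t. 2 / \<beta> * ?s t) (E (\<beta> * \<mu>)) + weight_measure (\<lambda>t. 1 / 2 * ?s t) (E (4 * \<mu>))" .
  have cm: "weight_measure (\<lambda>t. c * ?s t) (E m) = ennreal (c * \<phi> m)" if "0 \<le> c" for c m
    using that by (simp add: weight_measure_cmult[OF sm E] \<phi>(1) ennreal_mult')
  have "0 \<le> 2 / \<beta>" "0 \<le> (1 / 2 :: real)" using \<beta> by auto
  then have "ennreal (\<phi> \<mu>) + ennreal (2 / \<beta> * \<phi> (4 * \<mu>)) \<le> ennreal (2 / \<beta> * \<phi> (\<beta> * \<mu>)) + ennreal (1 / 2 * \<phi> (4 * \<mu>))"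
    using * unfolding \<phi>(1) by (simp only: cm)
  then have "ennreal (\<phi> \<mu> + 2 / \<beta> * \<phi> (4 * \<mu>)) \<le> ennreal (2 / \<beta> * \<phi> (\<beta> * \<mu>) + 1 / 2 * \<phi> (4 * \<mu>))"
    using \<beta> \<phi>(2) by (subst (1 2) ennreal_plus) auto
  then have "\<phi> \<mu> + 2 / \<beta> * \<phi> (4 * \<mu>) \<le> 2 / \<beta> * \<phi> (\<beta> * \<mu>) + 1 / 2 * \<phi> (4 * \<mu>)"
    using \<beta> \<phi>(2) by (subst (asm) ennreal_le_iff) auto
  moreover have "\<phi> (4 * \<mu>) \<le> \<phi> \<mu>"
  proof -
    have "weight_measure ?s (E (4 * \<mu>)) \<le> weight_measure ?s (E \<mu>)" by (rule weight_measure_subset[OF E4(2)])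
    then show ?thesis using \<phi> by (simp add: ennreal_le_iff)
  qed
  ultimately have "(1 / 2 + 2 / \<beta>) * \<phi> (4 * \<mu>) \<le> 2 / \<beta> * \<phi> (\<beta> * \<mu>)" by (simp add: algebra_simps)
  then have "2 * \<beta> * ((1 / 2 + 2 / \<beta>) * \<phi> (4 * \<mu>)) \<le> 2 * \<beta> * (2 / \<beta> * \<phi> (\<beta> * \<mu>))"
    using \<beta>(1) by (intro mult_left_mono) auto
  moreover have "2 * \<beta> * ((1 / 2 + 2 / \<beta>) * \<phi> (4 * \<mu>)) = (\<beta> + 4) * \<phi> (4 * \<mu>)"
    using \<beta>(1) by (simp add: algebra_simps)
  ultimately have "(\<beta> + 4) * \<phi> (4 * \<mu>) \<le> 4 * \<phi> (\<beta> * \<mu>)" using \<beta>(1) by simp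
  then have "\<phi> (4 * \<mu>) \<le> 4 / (\<beta> + 4) * \<phi> (\<beta> * \<mu>)"
    using \<beta>(1) by (simp add: pos_le_divide_eq mult.commute)
  then have "ennreal (\<phi> (4 * \<mu>)) \<le> ennreal (4 / (\<beta> + 4)) * ennreal (\<phi> (\<beta> * \<mu>))"
    using \<beta>(1) by (simp add: ennreal_mult'[symmetric] ennreal_leI)
  moreover have "4 / \<beta> * (\<beta> * \<mu>) = 4 * \<mu>" using \<beta>(1) by simp
  ultimately show ?thesis by (simp only: E_def[symmetric] \<phi>)
qed

text \<open>Iterating the decay along the levels \<beta> \<mu> (4/\<beta>)^j, the dual mass above
  the j-th level shrinks like \<theta>^j, faster than a small power \<delta> of the level grows. The
  constants \<delta> and C are fixed before the weight and the interval, since all intervals have to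
  share them.\<close>

lemma dual_weight_reverse_Holder:
  assumes p: "1 < p" and K: "0 < K"
  obtains \<delta> C :: real where "0 < \<delta>" "0 < C"
    "\<And>w a b \<mu>. w \<in> borel_measurable lebesgue \<Longrightarrow> (\<And>t. 0 < w t) \<Longrightarrow> 0 < \<mu> \<Longrightarrow> Ap_minus_on p K {a..b} w \<Longrightarrow> a < b \<Longrightarrow>
      weight_measure (dual_weight p w) {a<..<b} < \<infinity> \<Longrightarrow>
      (\<And>y. a \<le> y \<Longrightarrow> y < b \<Longrightarrow> weight_measure (dual_weight p w) {y<..<b} \<le> ennreal (\<mu> * (b - y))) \<Longrightarrow>
      weight_measure (\<lambda>t. dual_weight p w t powr (1 + \<delta>)) {a<..<b}
        \<le> ennreal (C * \<mu> powr \<delta>) * weight_measure (dual_weight p w) {a<..<b}"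
proof -
  define \<beta> where "\<beta> = min 1 ((1 / (2 * (8 powr p * K))) powr (1 / (p - 1)))"
  have \<beta>: "0 < \<beta>" "\<beta> \<le> 1" using K by (auto simp: \<beta>_def)
  have "\<beta> powr (p - 1) \<le> ((1 / (2 * (8 powr p * K))) powr (1 / (p - 1))) powr (p - 1)"
    using p \<beta> by (intro powr_mono2) (auto simp: \<beta>_def)
  also have "\<dots> = 1 / (2 * (8 powr p * K))" using p K by (simp add: powr_powr)
  finally have \<beta>3: "\<beta> powr (p - 1) * (8 powr p * K) \<le> 1 / 2" using K by (simp add: field_simps)
  define R where "R = 4 / \<beta>"
  define \<theta> where "\<theta> = 4 / (\<beta> + 4)"
  have R: "1 < R" using \<beta> by (simp add: R_def field_simps)
  have \<theta>: "0 < \<theta>" "\<theta> < 1" using \<beta> by (auto simp: \<theta>_def field_simps)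
  \<comment> \<open>Chosen so that \<open>R powr \<delta> * \<theta>\<close> is the square root of
    \<theta>, hence below 1.\<close>
  define \<delta> where "\<delta> = - ln \<theta> / (2 * ln R)"
  have \<delta>: "0 < \<delta>" unfolding \<delta>_def using R \<theta> by (intro divide_pos_pos) auto
  define \<kappa> where "\<kappa> = R powr \<delta> * \<theta>"
  have "\<kappa> = exp (ln \<theta> / 2)"
  proof -
    have "\<kappa> = exp (\<delta> * ln R) * exp (ln \<theta>)" using R \<theta> by (simp add: \<kappa>_def powr_def)
    also have "\<delta> * ln R = - ln \<theta> / 2" using R by (simp add: \<delta>_def)
    also have "exp (- ln \<theta> / 2) * exp (ln \<theta>) = exp (ln \<theta> / 2)"
      unfolding exp_add[symmetric] by (rule arg_cong[of _ _ exp]) (simp add: field_simps)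
    finally show ?thesis .
  qed
  then have \<kappa>: "0 < \<kappa>" "\<kappa> < 1" using \<theta> by auto
  define C where "C = \<beta> powr \<delta> * (1 + R powr \<delta> / (1 - \<kappa>))"
  have C: "0 < C" unfolding C_def using \<beta> \<kappa> R by (intro mult_pos_pos add_pos_nonneg) auto
  show thesis
  proof (rule that[OF \<delta> C])
    fix w :: "real \<Rightarrow> real" and a b \<mu> :: real
    assume w [measurable]: "w \<in> borel_measurable lebesgue" and wpos: "\<And>t. 0 < w t" and \<mu>: "0 < \<mu>"
      and Ap: "Ap_minus_on p K {a..b} w" and ab: "a < b"
      and fin: "weight_measure (dual_weight p w) {a<..<b} < \<infinity>"
      and avg: "\<And>y. a \<le> y \<Longrightarrow> y < b \<Longrightarrow> weight_measure (dual_weight p w) {y<..<b} \<le> ennreal (\<mu> * (b - y))"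
    let ?s = "dual_weight p w"
    have sm: "?s \<in> borel_measurable lebesgue" by measurable
    have spos: "0 < ?s t" for t using wpos by (rule dual_weight_pos)
    define E where "E m = {x \<in> {a<..<b}. m < ?s x}" for m
    have E: "E m \<in> sets lebesgue" for m
      unfolding E_def by (rule sets_lebesgue_Collect_interval[OF sm])
    define T where "T = enn2real (weight_measure ?s {a<..<b})"
    have T: "weight_measure ?s {a<..<b} = ennreal T" "0 \<le> T" using fin by (auto simp: T_def)
    define m where "m j = \<beta> * \<mu> * R ^ j" for j :: nat
    have mpos: "0 < m j" for j using \<beta> \<mu> R by (simp add: m_def)
    have decay: "weight_measure ?s (E (m j)) \<le> ennreal (\<theta> ^ j * T)" for j
    proof (induction j)
      case 0
      show ?case using T by (simp flip: T(1)) (rule weight_measure_subset, auto simp: E_def)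
    next
      case (Suc j)
      have "1 \<le> R ^ j" using R by (simp add: one_le_power less_imp_le)
      then have \<mu>j: "\<mu> \<le> \<mu> * R ^ j" "0 < \<mu> * R ^ j" using \<mu> by auto
      \<comment> \<open>The end point b remains good at every higher level, so the decay step can be
        applied again.\<close>
      have avg': "weight_measure ?s {y<..<b} \<le> ennreal (\<mu> * R ^ j * (b - y))" if "a \<le> y" "y < b" for y
        using avg[OF that] by (rule order_trans) (use that \<mu>j in \<open>auto intro!: ennreal_leI mult_right_mono\<close>)
      have "weight_measure ?s (E (4 / \<beta> * (\<beta> * (\<mu> * R ^ j)))) \<le> ennreal \<theta> * weight_measure ?s (E (\<beta> * (\<mu> * R ^ j)))"
        unfolding E_def \<theta>_def
        by (rule dual_weight_level_decay[OF w wpos p K \<mu>j(2) Ap ab fin avg' \<beta> \<beta>3])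
      then have "weight_measure ?s (E (m (Suc j))) \<le> ennreal \<theta> * weight_measure ?s (E (m j))"
        by (simp add: m_def R_def ac_simps)
      also have "\<dots> \<le> ennreal \<theta> * ennreal (\<theta> ^ j * T)" by (intro mult_left_mono Suc) simp
      also have "\<dots> = ennreal (\<theta> ^ Suc j * T)" using \<theta> T by (simp add: ennreal_mult'[symmetric] ac_simps)
      finally show ?case .
    qed
    have mj: "m (Suc j) powr \<delta> * \<theta> ^ j = (\<beta> * \<mu>) powr \<delta> * R powr \<delta> * \<kappa> ^ j" for j
    proof -
      have "(R ^ j) powr \<delta> = (R powr \<delta>) ^ j" using R by (induction j) (simp_all add: powr_mult)
      then show ?thesis using \<beta> \<mu> R by (simp add: m_def powr_mult \<kappa>_def power_mult_distrib)
    qed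
    \<comment> \<open>A point whose dual weight lies between \<open>m j\<close> and
      \<open>m (Suc j)\<close> pays the \<delta>-th power of the upper level and is charged to the
      set above the lower one.\<close>
    let ?g = "\<lambda>j t. ennreal (m (Suc j) powr \<delta>) * (ennreal (?s t) * indicator (E (m j)) t)"
    have pw: "ennreal (?s t powr (1 + \<delta>)) * indicator {a<..<b} t
       \<le> ennreal (m 0 powr \<delta>) * (ennreal (?s t) * indicator {a<..<b} t) + (\<Sum>j. ?g j t)" for t
    proof (cases "t \<in> {a<..<b}")
      case t: True
      have s1: "?s t powr (1 + \<delta>) = ?s t powr \<delta> * ?s t" using spos[of t] by (simp add: powr_add)
      show ?thesis
      proof (cases "?s t \<le> m 0")
        case True
        then have "?s t powr \<delta> \<le> m 0 powr \<delta>" using \<delta> spos[of t] by (intro powr_mono2) auto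
        then have "ennreal (?s t powr (1 + \<delta>)) \<le> ennreal (m 0 powr \<delta>) * ennreal (?s t)"
          using spos[of t] by (simp add: s1 ennreal_mult'[symmetric] ennreal_leI mult_right_mono)
        then show ?thesis using t by (simp add: add_increasing2)
      next
        case False
        obtain n where "?s t / m 0 < R ^ n" using real_arch_pow[OF R] by blast
        then have ex: "?s t \<le> m n" using mpos[of 0] by (simp add: m_def field_simps)
        define k where "k = (LEAST k. ?s t \<le> m k)"
        have k: "?s t \<le> m k" unfolding k_def using ex by (rule LeastI)
        with False have "k \<noteq> 0" by (cases k) auto
        then obtain j where j: "k = Suc j" by (cases k) auto
        have "\<not> ?s t \<le> m j" using not_less_Least[of j "\<lambda>k. ?s t \<le> m k"] j by (auto simp: k_def)
        then have tE: "t \<in> E (m j)" using t by (simp add: E_def)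
        have "?s t powr \<delta> \<le> m (Suc j) powr \<delta>" using \<delta> spos[of t] k j by (intro powr_mono2) auto
        then have "ennreal (?s t powr (1 + \<delta>)) \<le> ennreal (m (Suc j) powr \<delta>) * ennreal (?s t)"
          using spos[of t] by (simp add: s1 ennreal_mult'[symmetric] ennreal_leI mult_right_mono)
        also have "\<dots> = sum (\<lambda>j. ?g j t) {j}" using tE by simp
        also have "\<dots> \<le> (\<Sum>j. ?g j t)" by (rule sum_le_suminf) auto
        finally show ?thesis using t by (simp add: add_increasing)
      qed
    qed simp
    have "weight_measure (\<lambda>t. ?s t powr (1 + \<delta>)) {a<..<b}
       \<le> (\<integral>\<^sup>+t. ennreal (m 0 powr \<delta>) * (ennreal (?s t) * indicator {a<..<b} t) + (\<Sum>j. ?g j t) \<partial>lebesgue)"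
      unfolding weight_measure_def by (rule nn_integral_mono) (rule pw)
    also have "\<dots> = (\<integral>\<^sup>+t. ennreal (m 0 powr \<delta>) * (ennreal (?s t) * indicator {a<..<b} t) \<partial>lebesgue) + (\<Sum>j. \<integral>\<^sup>+t. ?g j t \<partial>lebesgue)"
    proof -
      have g: "?g j \<in> borel_measurable lebesgue" for j
        by (intro borel_measurable_times_ennreal borel_measurable_indicator E) auto
      have "(\<lambda>t. \<Sum>j. ?g j t) \<in> borel_measurable lebesgue" using g by (rule borel_measurable_suminf_order)
      moreover have "(\<lambda>t. ennreal (m 0 powr \<delta>) * (ennreal (?s t) * indicator {a<..<b} t)) \<in> borel_measurable lebesgue"
        by (intro borel_measurable_times_ennreal borel_measurable_indicator) auto
      ultimately show ?thesis by (simp only: nn_integral_add nn_integral_suminf[OF g])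
    qed
    also have "(\<integral>\<^sup>+t. ennreal (m 0 powr \<delta>) * (ennreal (?s t) * indicator {a<..<b} t) \<partial>lebesgue) = ennreal (m 0 powr \<delta>) * weight_measure ?s {a<..<b}"
      unfolding weight_measure_def by (rule nn_integral_cmult) (auto intro!: borel_measurable_times_ennreal borel_measurable_indicator)
    also have "(\<Sum>j. \<integral>\<^sup>+t. ?g j t \<partial>lebesgue) = (\<Sum>j. ennreal (m (Suc j) powr \<delta>) * weight_measure ?s (E (m j)))"
      unfolding weight_measure_def
      by (intro arg_cong[where f = suminf] ext nn_integral_cmult borel_measurable_times_ennreal borel_measurable_indicator E) auto
    finally have split: "weight_measure (\<lambda>t. ?s t powr (1 + \<delta>)) {a<..<b} \<le> ennreal (m 0 powr \<delta>) * weight_measure ?s {a<..<b}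
        + (\<Sum>j. ennreal (m (Suc j) powr \<delta>) * weight_measure ?s (E (m j)))" .
    have "(\<Sum>j. ennreal (m (Suc j) powr \<delta>) * weight_measure ?s (E (m j))) \<le> (\<Sum>j. ennreal ((\<beta> * \<mu>) powr \<delta> * R powr \<delta> * T * \<kappa> ^ j))"
    proof (intro suminf_le)
      fix j
      have "ennreal (m (Suc j) powr \<delta>) * weight_measure ?s (E (m j)) \<le> ennreal (m (Suc j) powr \<delta>) * ennreal (\<theta> ^ j * T)"
        by (rule mult_left_mono[OF decay]) simp
      also have "\<dots> = ennreal (m (Suc j) powr \<delta> * (\<theta> ^ j * T))" by (rule ennreal_mult'[symmetric]) simp
      also have "m (Suc j) powr \<delta> * (\<theta> ^ j * T) = (\<beta> * \<mu>) powr \<delta> * R powr \<delta> * T * \<kappa> ^ j"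
        using arg_cong[OF mj[of j], of "\<lambda>x. x * T"] by (simp only: mult_ac)
      finally show "ennreal (m (Suc j) powr \<delta>) * weight_measure ?s (E (m j)) \<le> ennreal ((\<beta> * \<mu>) powr \<delta> * R powr \<delta> * T * \<kappa> ^ j)" .
    qed auto
    also have "\<dots> = ennreal ((\<beta> * \<mu>) powr \<delta> * R powr \<delta> * T * (1 / (1 - \<kappa>)))"
      using \<kappa> T by (intro suminf_ennreal_eq sums_mult geometric_sums) auto
    finally have tail: "(\<Sum>j. ennreal (m (Suc j) powr \<delta>) * weight_measure ?s (E (m j)))
        \<le> ennreal ((\<beta> * \<mu>) powr \<delta> * R powr \<delta> * T * (1 / (1 - \<kappa>)))" .
    note split
    also note add_left_mono[OF tail]
    also have "ennreal (m 0 powr \<delta>) * weight_measure ?s {a<..<b} + ennreal ((\<beta> * \<mu>) powr \<delta> * R powr \<delta> * T * (1 / (1 - \<kappa>)))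
       = ennreal (m 0 powr \<delta> * T + (\<beta> * \<mu>) powr \<delta> * R powr \<delta> * T * (1 / (1 - \<kappa>)))"
      using T(2) \<kappa> by (simp add: T(1) ennreal_mult'[symmetric])
    also have "m 0 powr \<delta> * T + (\<beta> * \<mu>) powr \<delta> * R powr \<delta> * T * (1 / (1 - \<kappa>)) = C * \<mu> powr \<delta> * T"
      using \<beta> \<mu> by (simp add: m_def C_def powr_mult algebra_simps)
    also have "ennreal (C * \<mu> powr \<delta> * T) = ennreal (C * \<mu> powr \<delta>) * weight_measure ?s {a<..<b}"
      unfolding T(1) by (rule ennreal_mult') (use C in simp)
    finally show "weight_measure (\<lambda>t. ?s t powr (1 + \<delta>)) {a<..<b} \<le> ennreal (C * \<mu> powr \<delta>) * weight_measure ?s {a<..<b}" .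
  qed
qed

text \<open>
  The factor \<open>s\<close> is the dual mass of \<open>(a, d)\<close>, where \<open>d\<close> halves the mass of \<open>w\<close> on \<open>(b, c)\<close>. Some point
  of \<open>(b, d)\<close> is a good right end point for the reverse Hoelder inequality by the weak type
  estimate on \<open>(a, d)\<close>, while the \<open>A\<^sub>p\<close> condition for \<open>(a, d, c)\<close> controls \<open>s\<close>.
\<close>

lemma Ap_minus_self_improvement:
  assumes p: "1 < p" and K: "0 < K"
  obtains r K' where "1 < r" "r < p" "0 < K'"
    "\<And>I w. w \<in> borel_measurable lebesgue \<Longrightarrow> (\<And>t. 0 < w t) \<Longrightarrow>
      (\<And>x z. x \<in> I \<Longrightarrow> z \<in> I \<Longrightarrow> {x..z} \<subseteq> I) \<Longrightarrow> Ap_minus_on p K I w \<Longrightarrow> Ap_minus_on r K' I w"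
proof -
  obtain \<delta> C where \<delta>: "0 < \<delta>" and C: "0 < C" and RH:
    "\<And>w a b \<mu>. w \<in> borel_measurable lebesgue \<Longrightarrow> (\<And>t. 0 < w t) \<Longrightarrow> 0 < \<mu> \<Longrightarrow> Ap_minus_on p K {a..b} w \<Longrightarrow> a < b \<Longrightarrow>
      weight_measure (dual_weight p w) {a<..<b} < \<infinity> \<Longrightarrow>
      (\<And>y. a \<le> y \<Longrightarrow> y < b \<Longrightarrow> weight_measure (dual_weight p w) {y<..<b} \<le> ennreal (\<mu> * (b - y))) \<Longrightarrow>
      weight_measure (\<lambda>t. dual_weight p w t powr (1 + \<delta>)) {a<..<b}
        \<le> ennreal (C * \<mu> powr \<delta>) * weight_measure (dual_weight p w) {a<..<b}"
    by (rule dual_weight_reverse_Holder[OF p K]) (assumption | blast)+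
  \<comment> \<open>Then r - 1 = (p - 1) / (1 + \<delta>), which makes the dual weight for r the
    power 1 + \<delta> of the dual weight for p, the quantity controlled by the reverse Hoelder
    inequality.\<close>
  define r where "r = (p + \<delta>) / (1 + \<delta>)"
  have r1: "r - 1 = (p - 1) / (1 + \<delta>)" using \<delta> by (simp add: r_def field_simps)
  have r: "1 < r" "r < p" using p \<delta> by (auto simp: r_def field_simps)
  define C1 where "C1 = 8 powr p * K"
  have C1: "0 < C1" using K by (simp add: C1_def)
  define C2 where "C2 = C * (4 * C1) powr (\<delta> / p)"
  have C2: "0 < C2" using C C1 by (simp add: C2_def)
  \<comment> \<open>The exponent with which \<open>s powr (p - 1)\<close> enters the bound for
    \<open>u powr (r - 1)\<close>. The identities below say that the length c - a ends up with the
    power r and the mass \<omega> with the power -1.\<close>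
  define e where "e = (1 + \<delta> / p) * (r - 1) / (p - 1)"
  have e: "0 < e" "p * e = r" "1 - \<delta> * (r - 1) / p - e = 0"
  proof -
    have e': "e = (1 + \<delta> / p) / (1 + \<delta>)" using p by (simp add: e_def r1)
    show "0 < e" unfolding e' using p \<delta> by (intro divide_pos_pos add_pos_pos) auto
    show "p * e = r" unfolding e' r_def using p by (simp add: distrib_left)
    have "1 - \<delta> * ((p - 1) / (1 + \<delta>)) / p - (1 + \<delta> / p) / (1 + \<delta>) = 0"
      using p \<delta> by (simp add: divide_simps) (simp add: algebra_simps)
    then show "1 - \<delta> * (r - 1) / p - e = 0" by (simp add: e' r1)
  qed
  have e2: "e * p = r" using e(2) by (simp add: mult.commute)
  define K' where "K' = C2 powr (r - 1) * (2 * K) powr e"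
  have K': "0 < K'" using C2 K by (simp add: K'_def)
  show thesis
  proof (rule that[OF r K'])
    fix I and w :: "real \<Rightarrow> real"
    assume w [measurable]: "w \<in> borel_measurable lebesgue" and wpos: "\<And>t. 0 < w t"
      and I: "\<And>x z. x \<in> I \<Longrightarrow> z \<in> I \<Longrightarrow> {x..z} \<subseteq> I" and Ap: "Ap_minus_on p K I w"
    let ?s = "dual_weight p w"
    have sm: "?s \<in> borel_measurable lebesgue" by measurable
    have smw: "?s t powr p * w t = ?s t" for t using wpos p by (rule dual_weight_powr_mult)
    have dual: "dual_weight r w t = ?s t powr (1 + \<delta>)" for t
    proof -
      have "- 1 / (r - 1) = - 1 / (p - 1) * (1 + \<delta>)" unfolding r1 using p \<delta> by (simp add: field_simps)
      then show ?thesis by (simp only: dual_weight_def powr_powr)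
    qed
    have "\<exists>u>0. weight_measure (dual_weight r w) {a<..<b} = ennreal u \<and>
        weight_measure w {b<..<c} \<le> ennreal (K' * (c - a) powr r * u powr (1 - r))"
      if abc: "a \<in> I" "c \<in> I" "a < b" "b < c" for a b c
    proof -
      have ac: "Ap_minus_on p K {a..c} w" using Ap by (rule Ap_minus_on_subset) (use I abc in auto)
      define \<omega> where "\<omega> = enn2real (weight_measure w {b<..<c})"
      have Wfin: "weight_measure w {b<..<c} < \<infinity>"
        using ac[unfolded Ap_minus_on_def, rule_format, of a c b] abc by (auto intro: le_less_trans)
      then have \<omega>: "weight_measure w {b<..<c} = ennreal \<omega>" by (simp add: \<omega>_def)
      have "0 < weight_measure w {b<..<c}" by (rule weight_measure_pos) (use wpos abc in auto)
      then have \<omega>pos: "0 < \<omega>" by (simp add: \<omega>)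
      obtain G where G: "continuous_on {b..c} G" "G b = 0"
        "\<And>x y. b \<le> x \<Longrightarrow> x \<le> y \<Longrightarrow> y \<le> c \<Longrightarrow> G x \<le> G y \<and> weight_measure w {x<..<y} = ennreal (G y - G x)"
        using weight_measure_primitive[OF w less_imp_le[OF wpos] Wfin] abc by (metis less_imp_le)
      have Gc: "G c = \<omega>" using G(2) G(3)[of b c] abc \<omega> \<omega>pos by auto
      obtain d where d: "b \<le> d" "d \<le> c" "G d = \<omega> / 2"
        using IVT'[of G b "\<omega> / 2" c] G(1,2) Gc \<omega>pos abc by auto
      have "d \<noteq> b" "d \<noteq> c" using d(3) G(2) Gc \<omega>pos by auto
      with d have d': "b < d" "d < c" by auto
      have Wbd: "weight_measure w {b<..<d} = ennreal (\<omega> / 2)" and Wdc: "weight_measure w {d<..<c} = ennreal (\<omega> / 2)"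
        using G(3)[of b d] G(3)[of d c] G(2) Gc d by auto
      obtain s where s: "0 < s" "weight_measure ?s {a<..<d} = ennreal s"
        "weight_measure w {d<..<c} \<le> ennreal (K * (c - a) powr p * s powr (1 - p))"
        using ac[unfolded Ap_minus_on_def, rule_format, of a c d] abc d' by auto
      have sbound: "s powr (p - 1) \<le> 2 * K * (c - a) powr p / \<omega>"
      proof -
        have "\<omega> / 2 \<le> K * (c - a) powr p * s powr (1 - p)"
          using s(3) K unfolding Wdc by (subst (asm) ennreal_le_iff) auto
        then have "\<omega> / 2 * s powr (p - 1) \<le> K * (c - a) powr p * s powr (1 - p) * s powr (p - 1)"
          by (rule mult_right_mono) simp
        also have "\<dots> = K * (c - a) powr p" using s(1) by (simp add: powr_add[symmetric])
        finally show ?thesis using \<omega>pos by (simp add: field_simps)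
      qed
      \<comment> \<open>The level at which the weak type bound equals \<omega> / 4. As (b, d) has
        mass \<omega> / 2, the bad points cannot fill it.\<close>
      define \<mu> where "\<mu> = (4 * C1 * s / \<omega>) powr (1 / p)"
      have \<mu>: "0 < \<mu>" using C1 s \<omega>pos by (simp add: \<mu>_def)
      have \<mu>p: "\<mu> powr (- p) = \<omega> / (4 * C1 * s)"
        using p C1 s(1) \<omega>pos by (simp add: \<mu>_def powr_powr powr_minus_divide)
      have ad: "a < d" using abc d' by simp
      have Apad: "Ap_minus_on p K {a..d} w" using ac by (rule Ap_minus_on_subset) (use d' in auto)
      have sfin: "weight_measure ?s {a<..<d} < \<infinity>" by (simp add: s(2))
      let ?O = "{x \<in> {a<..<d}. \<exists>y. a \<le> y \<and> y < x \<and> ennreal (\<mu> * (x - y)) < weight_measure ?s {y<..<x}}"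
      have "weight_measure w ?O \<le> ennreal (8 powr p * K * \<mu> powr (- p)) * weight_measure (\<lambda>t. ?s t powr p * w t) {a<..<d}"
        by (rule backward_maximal_weak_type[OF sm w dual_weight_nonneg wpos p K \<mu> Apad ad sfin])
      also have "weight_measure (\<lambda>t. ?s t powr p * w t) {a<..<d} = ennreal s" by (simp add: smw s)
      also have "ennreal (8 powr p * K * \<mu> powr (- p)) * ennreal s = ennreal (\<omega> / 4)"
        unfolding \<mu>p C1_def[symmetric] using C1 s(1) by (simp add: ennreal_mult'[symmetric] \<omega>pos less_imp_le)
      finally have Osmall: "weight_measure w ?O \<le> ennreal (\<omega> / 4)" .
      have "\<not> {b<..<d} \<subseteq> ?O"
      proof
        assume "{b<..<d} \<subseteq> ?O"
        then have "ennreal (\<omega> / 2) \<le> weight_measure w ?O" unfolding Wbd[symmetric] by (rule weight_measure_subset)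
        also note Osmall
        finally show False using \<omega>pos by simp
      qed
      then obtain x where "x \<in> {b<..<d}" "x \<notin> ?O" by (meson subsetI)
      then have x: "b < x" "x < d" "x \<notin> ?O" by auto
      have avg: "weight_measure ?s {y<..<x} \<le> ennreal (\<mu> * (x - y))" if "a \<le> y" "y < x" for y
        using x that abc by (auto simp: not_less)
      have "weight_measure (dual_weight r w) {a<..<b} \<le> weight_measure (\<lambda>t. ?s t powr (1 + \<delta>)) {a<..<x}"
        by (rule weight_measure_mono) (use x in \<open>auto simp: dual\<close>)
      also have "\<dots> \<le> ennreal (C * \<mu> powr \<delta>) * weight_measure ?s {a<..<x}"
      proof (rule RH[OF w wpos \<mu> _ _ _ avg])
        show "Ap_minus_on p K {a..x} w" using Apad by (rule Ap_minus_on_subset) (use x in auto)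
        have "weight_measure ?s {a<..<x} \<le> weight_measure ?s {a<..<d}" by (rule weight_measure_subset) (use x in auto)
        then show "weight_measure ?s {a<..<x} < \<infinity>" using sfin by (rule le_less_trans)
      qed (use x abc in auto)
      also have "\<dots> \<le> ennreal (C * \<mu> powr \<delta>) * ennreal s"
        unfolding s(2)[symmetric] by (intro mult_left_mono weight_measure_subset) (use x in auto)
      also have "\<dots> = ennreal (C * \<mu> powr \<delta> * s)" using C by (intro ennreal_mult'[symmetric]) simp
      finally have Ule: "weight_measure (dual_weight r w) {a<..<b} \<le> ennreal (C * \<mu> powr \<delta> * s)" .
      define u where "u = enn2real (weight_measure (dual_weight r w) {a<..<b})"
      have "weight_measure (dual_weight r w) {a<..<b} < \<infinity>" using Ule by (rule le_less_trans) simp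
      then have u: "weight_measure (dual_weight r w) {a<..<b} = ennreal u" by (simp add: u_def)
      have "0 < weight_measure (dual_weight r w) {a<..<b}"
        by (rule weight_measure_pos) (use wpos abc in \<open>auto intro!: dual_weight_pos\<close>)
      then have upos: "0 < u" by (simp add: u)
      have "u \<le> C * \<mu> powr \<delta> * s" using Ule C s(1) unfolding u by (subst (asm) ennreal_le_iff) auto
      also have "\<dots> = C2 * s powr (1 + \<delta> / p) * \<omega> powr (- \<delta> / p)"
        using C1 s(1) \<omega>pos by (simp add: \<mu>_def C2_def powr_powr powr_divide powr_mult powr_add powr_minus_divide)
      finally have ubound: "u \<le> C2 * s powr (1 + \<delta> / p) * \<omega> powr (- \<delta> / p)" .
      have "u powr (r - 1) \<le> (C2 * s powr (1 + \<delta> / p) * \<omega> powr (- \<delta> / p)) powr (r - 1)"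
        using ubound upos r by (intro powr_mono2) auto
      also have "\<dots> = C2 powr (r - 1) * (s powr (p - 1)) powr e * \<omega> powr (- \<delta> * (r - 1) / p)"
        using C2 p by (simp add: powr_mult powr_powr e_def)
      also have "\<dots> \<le> C2 powr (r - 1) * (2 * K * (c - a) powr p / \<omega>) powr e * \<omega> powr (- \<delta> * (r - 1) / p)"
        using e(1) sbound by (intro mult_right_mono mult_left_mono powr_mono2) auto
      also have "\<dots> = K' * (c - a) powr r * (\<omega> powr (- \<delta> * (r - 1) / p) * \<omega> powr (- e))"
        using K \<omega>pos by (simp add: K'_def powr_mult powr_divide powr_powr e(2) e2 powr_minus_divide ac_simps)
      also have "\<omega> powr (- \<delta> * (r - 1) / p) * \<omega> powr (- e) = \<omega> powr (- 1)"
        unfolding powr_add[symmetric] using e(3) by (intro arg_cong2[where f = "(powr)"]) auto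
      finally have "u powr (r - 1) * \<omega> \<le> K' * (c - a) powr r"
        using \<omega>pos by (simp add: powr_minus_divide field_simps)
      then have "u powr (r - 1) * \<omega> * u powr (1 - r) \<le> K' * (c - a) powr r * u powr (1 - r)"
        by (rule mult_right_mono) simp
      also have "u powr (r - 1) * \<omega> * u powr (1 - r) = \<omega>" using upos by (simp add: powr_add[symmetric])
      finally have "\<omega> \<le> K' * (c - a) powr r * u powr (1 - r)" .
      then show ?thesis using upos u \<omega> by (auto intro!: exI[of _ u] ennreal_leI)
    qed
    then show "Ap_minus_on r K' I w" unfolding Ap_minus_on_def by blast
  qed
qed

section \<open>From the weight classes to conditions on triples of points\<close>

text \<open>A weight is only measurable on \<open>(0,\<infinity>)\<close>; the value \<open>1\<close> elsewhere is never integrated.\<close>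

definition extend_weight :: "(real \<Rightarrow> real) \<Rightarrow> real \<Rightarrow> real" where
  "extend_weight w t = (if 0 < t then w t else 1)"

lemma extend_weight_pos: "weight w \<Longrightarrow> 0 < extend_weight w t"
  by (simp add: extend_weight_def weight_def)

lemma extend_weight_measurable:
  assumes "weight w" shows "extend_weight w \<in> borel_measurable lebesgue"
proof -
  have "(\<lambda>t. if t \<in> {0<..} then w t else 1) \<in> borel_measurable lebesgue"
    using assms by (subst measurable_If_restrict_space_iff) (auto simp: weight_def greaterThan_def)
  moreover have "extend_weight w = (\<lambda>t. if t \<in> {0<..} then w t else 1)" by (simp add: extend_weight_def fun_eq_iff)
  ultimately show ?thesis by simp
qed

lemma weight_measure_extend:
  assumes "A \<subseteq> {0<..}"
  shows "weight_measure (extend_weight w) A = weight_measure w A"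
  by (rule weight_measure_cong) (use assms in \<open>auto simp: extend_weight_def\<close>)

lemma conj_exp_props:
  assumes "1 < p"
  shows "1 < conj_exp p" "conj_exp (conj_exp p) = p" "1 - conj_exp p = - 1 / (p - 1)"
    "conj_exp p - 1 = 1 / (p - 1)"
  using assms by (auto simp: conj_exp_def divide_simps)

text \<open>The mass of w on (y, z) is positive, so an infinite dual mass would make the product
  infinite. With the dual mass finite and positive, the product can be solved for the mass of w by
  dividing by real numbers.\<close>

lemma A_minus_imp_Ap_minus_on:
  assumes "w \<in> A_minus p" and p: "1 < p"
  obtains K where "0 < K" "Ap_minus_on p K {0..} (extend_weight w)"
proof -
  let ?W = "extend_weight w" and ?S = "\<lambda>a b. \<integral>\<^sup>+t\<in>{a<..<b}. ennreal (w t powr (1 - conj_exp p)) \<partial>lebesgue"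
  have w: "weight w" using assms by (simp add: A_minus_def)
  let ?T = "\<lambda>(a, b, c). ennreal (1 / (c - a) powr p) *
           (\<integral>\<^sup>+t\<in>{b<..<c}. ennreal (w t) \<partial>lebesgue) * ennreal_powr (?S a b) (p - 1)"
  define M where "M = (SUP x\<in>{(a::real, b::real, c::real). 0 \<le> a \<and> a < b \<and> b < c}. ?T x)"
  have M: "M < \<infinity>" using assms by (simp add: A_minus_def M_def)
  define K where "K = enn2real M + 1"
  have K: "0 < K" by (simp add: K_def add_nonneg_pos)
  have "ennreal (enn2real M) \<le> ennreal K" by (simp add: K_def)
  then have MK: "M \<le> ennreal K" using M by simp
  have "\<exists>s>0. weight_measure (dual_weight p ?W) {x<..<y} = ennreal s \<and>
      weight_measure ?W {y<..<z} \<le> ennreal (K * (z - x) powr p * s powr (1 - p))"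
    if xyz: "0 \<le> x" "x < y" "y < z" for x y z
  proof -
    have WW: "weight_measure ?W {y<..<z} = (\<integral>\<^sup>+t\<in>{y<..<z}. ennreal (w t) \<partial>lebesgue)"
    proof -
      have "{y<..<z} \<subseteq> {0<..}" using xyz by auto
      then show ?thesis using weight_measure_extend[of "{y<..<z}" w] by (simp add: weight_measure_def)
    qed
    have SS: "weight_measure (dual_weight p ?W) {x<..<y} = ?S x y"
    proof -
      have "weight_measure (dual_weight p ?W) {x<..<y} = weight_measure (\<lambda>t. w t powr (1 - conj_exp p)) {x<..<y}"
        by (rule weight_measure_cong)
          (use xyz p in \<open>auto simp: dual_weight_def extend_weight_def conj_exp_props\<close>)
      then show ?thesis by (simp add: weight_measure_def)
    qed
    have Wpos: "0 < weight_measure ?W {y<..<z}"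
      by (rule weight_measure_pos[OF extend_weight_measurable[OF w]]) (use extend_weight_pos[OF w] xyz in auto)
    have Spos: "0 < weight_measure (dual_weight p ?W) {x<..<y}"
      by (rule weight_measure_pos)
        (use extend_weight_pos[OF w] extend_weight_measurable[OF w] xyz in \<open>auto intro!: dual_weight_pos dual_weight_measurable\<close>)
    have lpos: "0 < 1 / (z - x) powr p" using xyz by simp
    have "?T (x, y, z) \<le> M" unfolding M_def by (rule SUP_upper) (use xyz in auto)
    with MK have le: "ennreal (1 / (z - x) powr p) * weight_measure ?W {y<..<z} *
        ennreal_powr (weight_measure (dual_weight p ?W) {x<..<y}) (p - 1) \<le> ennreal K"
      by (simp only: WW SS prod.case)
    have Sfin: "weight_measure (dual_weight p ?W) {x<..<y} \<noteq> \<infinity>"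
    proof
      assume "weight_measure (dual_weight p ?W) {x<..<y} = \<infinity>"
      then have "ennreal_powr (weight_measure (dual_weight p ?W) {x<..<y}) (p - 1) = \<infinity>"
        by (simp add: ennreal_powr_def)
      moreover have "ennreal (1 / (z - x) powr p) * weight_measure ?W {y<..<z} \<noteq> 0"
        using Wpos lpos xyz by auto
      ultimately show False using le by (auto simp: ennreal_mult_top top_unique)
    qed
    define s where "s = enn2real (weight_measure (dual_weight p ?W) {x<..<y})"
    have s: "weight_measure (dual_weight p ?W) {x<..<y} = ennreal s"
      using Sfin by (simp add: s_def less_top)
    have spos: "0 < s" using Spos unfolding s by simp
    have ps: "ennreal_powr (weight_measure (dual_weight p ?W) {x<..<y}) (p - 1) = ennreal (s powr (p - 1))"
      using spos by (simp add: s ennreal_powr_def)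
    have c: "ennreal (1 / (z - x) powr p * s powr (p - 1)) * weight_measure ?W {y<..<z} \<le> ennreal K"
    proof -
      have "ennreal (1 / (z - x) powr p * s powr (p - 1)) = ennreal (1 / (z - x) powr p) * ennreal (s powr (p - 1))"
        using lpos by (intro ennreal_mult') simp
      then show ?thesis using le unfolding ps by (simp only: mult_ac)
    qed
    define c where "c = 1 / (z - x) powr p * s powr (p - 1)"
    have cpos: "0 < c" using lpos spos by (simp add: c_def)
    have "ennreal (1 / c) * (ennreal c * weight_measure ?W {y<..<z}) \<le> ennreal (1 / c) * ennreal K"
      using c unfolding c_def by (rule mult_left_mono) simp
    also have "ennreal (1 / c) * (ennreal c * weight_measure ?W {y<..<z}) = weight_measure ?W {y<..<z}"
      using cpos by (simp add: mult.assoc[symmetric] ennreal_mult'[symmetric])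
    also have "ennreal (1 / c) * ennreal K = ennreal (K * (z - x) powr p * s powr (1 - p))"
    proof -
      have "1 / c * K = K * (z - x) powr p * s powr (1 - p)"
        using spos xyz by (simp add: c_def powr_diff)
      moreover have "ennreal (1 / c) * ennreal K = ennreal (1 / c * K)"
        using cpos by (intro ennreal_mult'[symmetric]) simp
      ultimately show ?thesis by simp
    qed
    finally show ?thesis using spos s by blast
  qed
  then have "Ap_minus_on p K {0..} ?W" unfolding Ap_minus_on_def by auto
  with K show thesis by (rule that)
qed

text \<open>\<open>A_plus\<close> is given through powers of weights for the dual exponent. Here the
  condition is put on v directly, as the mirror image of \<open>Ap_minus_on\<close>.\<close>

definition Ap_plus :: "real \<Rightarrow> real \<Rightarrow> (real \<Rightarrow> real) \<Rightarrow> bool" where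
  "Ap_plus p K v \<longleftrightarrow> (\<forall>x y z. 0 \<le> x \<longrightarrow> x < y \<longrightarrow> y < z \<longrightarrow>
     (\<exists>s>0. weight_measure (dual_weight p v) {y<..<z} = ennreal s \<and>
       weight_measure v {x<..<y} \<le> ennreal (K * (z - x) powr p * s powr (1 - p))))"

text \<open>If v is the power of u from \<open>A_plus\<close>, then v and u are dual weights of each
  other, for p' and for p. The condition on u bounds the mass of u by a negative power of the mass
  of v; solving for the latter means raising to the power p - 1, whence the constant
  \<open>K powr (p - 1)\<close>.\<close>

lemma A_plus_imp_Ap_plus:
  assumes "v \<in> A_plus p" and p: "1 < p"
  obtains K where "0 < K" "Ap_plus p K (extend_weight v)" "weight v"
proof -
  let ?p' = "conj_exp p"
  obtain u where u: "u \<in> A_minus ?p'" and vu: "\<And>t. 0 < t \<Longrightarrow> v t = u t powr (1 - p)"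
    using assms by (auto simp: A_plus_def)
  have p': "1 < ?p'" using p by (rule conj_exp_props)
  have uw: "weight u" using u by (simp add: A_minus_def)
  let ?U = "extend_weight u" and ?V = "extend_weight v"
  have upos: "0 < ?U t" for t using uw by (rule extend_weight_pos)
  have um: "?U \<in> borel_measurable lebesgue" using uw by (rule extend_weight_measurable)
  obtain K where K: "0 < K" and Ap: "Ap_minus_on ?p' K {0..} ?U"
    using A_minus_imp_Ap_minus_on[OF u p'] by blast
  have e1: "- 1 / (?p' - 1) = 1 - p" using p by (simp add: conj_exp_props)
  have V: "dual_weight ?p' ?U t = ?V t" for t
    unfolding dual_weight_def e1 by (simp add: extend_weight_def vu)
  have U: "dual_weight p ?V t = ?U t" for t
  proof -
    have "(1 - p) * (- 1 / (p - 1)) = 1" using p by (simp add: field_simps)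
    then show ?thesis using upos[of t] unfolding V[symmetric] dual_weight_def e1 powr_powr by simp
  qed
  have Veq: "dual_weight ?p' ?U = ?V" and Ueq: "dual_weight p ?V = ?U" using U V by auto
  have vm: "?V \<in> borel_measurable lebesgue" unfolding Veq[symmetric] using um by (rule dual_weight_measurable)
  have vpos: "0 < ?V t" for t unfolding Veq[symmetric] using upos by (rule dual_weight_pos)
  have main: "\<exists>s>0. weight_measure ?U {y<..<z} = ennreal s \<and>
       weight_measure ?V {x<..<y} \<le> ennreal (K powr (p - 1) * (z - x) powr p * s powr (1 - p))"
    if xyz: "0 \<le> x" "x < y" "y < z" for x y z
  proof -
    obtain m where m: "0 < m" "weight_measure ?V {x<..<y} = ennreal m"
      "weight_measure ?U {y<..<z} \<le> ennreal (K * (z - x) powr ?p' * m powr (1 - ?p'))"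
      using Ap[unfolded Ap_minus_on_def Veq, rule_format, of x z y] xyz by auto
    define s where "s = enn2real (weight_measure ?U {y<..<z})"
    have "weight_measure ?U {y<..<z} < \<infinity>" using m(3) by (rule le_less_trans) simp
    then have s: "weight_measure ?U {y<..<z} = ennreal s" by (simp add: s_def)
    have "0 < weight_measure ?U {y<..<z}" by (rule weight_measure_pos[OF um]) (use upos xyz in auto)
    then have spos: "0 < s" unfolding s by simp
    have "s \<le> K * (z - x) powr ?p' * m powr (1 - ?p')"
      using m(3) K unfolding s by (subst (asm) ennreal_le_iff) auto
    then have "s * m powr (?p' - 1) \<le> K * (z - x) powr ?p' * m powr (1 - ?p') * m powr (?p' - 1)"
      by (rule mult_right_mono) simp
    also have "\<dots> = K * (z - x) powr ?p'" using m(1) by (simp add: powr_add[symmetric])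
    finally have "m powr (?p' - 1) \<le> K * (z - x) powr ?p' / s" using spos by (simp add: field_simps)
    then have "(m powr (?p' - 1)) powr (p - 1) \<le> (K * (z - x) powr ?p' / s) powr (p - 1)"
      using p by (intro powr_mono2) auto
    also have "(m powr (?p' - 1)) powr (p - 1) = m"
      using p m(1) by (simp add: powr_powr conj_exp_props)
    also have "(K * (z - x) powr ?p' / s) powr (p - 1) = K powr (p - 1) * (z - x) powr p * s powr (1 - p)"
    proof -
      have "?p' * (p - 1) = p" using p by (simp add: conj_exp_def)
      moreover have "s powr (1 - p) = inverse (s powr (p - 1))"
        using powr_minus[of s "p - 1"] by simp
      moreover have "inverse s powr (p - 1) = inverse (s powr (p - 1))"
        using powr_divide[of 1 s "p - 1"] spos by (simp add: divide_inverse)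
      ultimately show ?thesis using K spos by (simp add: powr_mult powr_divide powr_powr divide_inverse)
    qed
    finally show ?thesis using spos s m by (auto intro!: ennreal_leI)
  qed
  have Ap_p: "Ap_plus p (K powr (p - 1)) ?V" unfolding Ap_plus_def Ueq using main by auto
  \<comment> \<open>Membership in \<open>A_plus\<close> does not mention that v is a weight.
    Measurability and positivity pass over from u, local integrability comes from the finite mass of
    v on intervals starting at 0.\<close>
  have "weight v" unfolding weight_def
  proof (intro conjI allI impI)
    show "v \<in> borel_measurable (lebesgue_on {0<..})"
    proof (rule measurable_cong[THEN iffD1])
      show "?V \<in> borel_measurable (lebesgue_on {0<..})" using vm by (rule measurable_restrict_space1)
    qed (auto simp: extend_weight_def space_restrict_space)
    show "0 < v t" if "0 < t" for t using vpos[of t] that by (simp add: extend_weight_def)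
    show "locally_integrable_on {0<..} v" unfolding locally_integrable_on_def
    proof (intro allI impI, elim conjE)
      fix S :: "real set" assume S: "compact S" "S \<subseteq> {0<..}"
      obtain b where b: "\<And>t. t \<in> S \<Longrightarrow> norm t \<le> b"
        using compact_imp_bounded[OF S(1)] unfolding bounded_iff by blast
      have Sm: "S \<in> sets lebesgue" using S(1) by (simp add: borel_compact)
      \<comment> \<open>The absolute value keeps the interval nonempty even if S is empty and the
        bound b negative.\<close>
      have "weight_measure ?V S \<le> weight_measure ?V {0<..<\<bar>b\<bar> + 1}"
        by (rule weight_measure_subset) (use S(2) b in force)
      also have "\<dots> < \<infinity>"
      proof -
        have "0 < \<bar>b\<bar> + 1" by simp
        with main[of 0 "\<bar>b\<bar> + 1" "\<bar>b\<bar> + 2"] show ?thesis by (auto intro: le_less_trans)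
      qed
      finally have fin: "weight_measure ?V S < \<infinity>" .
      have "integrable lebesgue (\<lambda>t. ?V t * indicator S t)"
      proof (rule integrableI_nonneg)
        show "(\<lambda>t. ?V t * indicator S t) \<in> borel_measurable lebesgue"
          using vm Sm by (intro borel_measurable_times borel_measurable_indicator)
        have "(\<integral>\<^sup>+t. ennreal (?V t * indicator S t) \<partial>lebesgue) = weight_measure ?V S"
          unfolding weight_measure_def by (rule nn_integral_cong) (auto simp: indicator_def)
        with fin show "(\<integral>\<^sup>+t. ennreal (?V t * indicator S t) \<partial>lebesgue) < \<infinity>" by simp
      qed (use vpos in \<open>auto simp: less_imp_le\<close>)
      moreover have "(\<lambda>t. ?V t * indicator S t) = (\<lambda>t. indicator S t *\<^sub>R v t)"
        using S(2) by (auto simp: indicator_def extend_weight_def fun_eq_iff)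
      ultimately show "set_integrable lebesgue S v" by (simp add: set_integrable_def)
    qed
  qed
  with Ap_p K show thesis by (intro that) auto
qed

section \<open>Reflection at the origin\<close>

lemma uminus_measurable_lebesgue: "uminus \<in> lebesgue \<rightarrow>\<^sub>M (lebesgue :: real measure)"
proof -
  have "(*\<^sub>R) (-1 :: real) = (uminus :: real \<Rightarrow> real)" by auto
  then show ?thesis using lebesgue_measurable_scaling[of "-1 :: real", where 'a = real] by simp
qed

lemma weight_measure_reflect:
  assumes g: "g \<in> borel_measurable lebesgue"
  shows "weight_measure (\<lambda>t. g (- t)) {x<..<y::real} = weight_measure g {- y<..<- x}"
proof -
  have "weight_measure g {- y<..<- x} = (\<integral>\<^sup>+t. ennreal (g (0 + - 1 * t)) * indicator {- y<..<- x} (0 + - 1 * t) \<partial>lebesgue)"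
    unfolding weight_measure_def using g
    by (subst nn_integral_real_affine_lebesgue[of _ "-1" 0]) (auto intro!: borel_measurable_times_ennreal borel_measurable_indicator)
  also have "\<dots> = weight_measure (\<lambda>t. g (- t)) {x<..<y}"
    unfolding weight_measure_def by (rule nn_integral_cong) (auto simp: indicator_def)
  finally show ?thesis by simp
qed

text \<open>The reflection exchanges the left and the right interval and carries [0, \<infinity>) to
  the negative half-line. This is why \<open>Ap_minus_on\<close> has the set of admissible end
  points as a parameter.\<close>

lemma Ap_plus_iff_reflect:
  assumes v: "v \<in> borel_measurable lebesgue"
  shows "Ap_plus p K v \<longleftrightarrow> Ap_minus_on p K {..0} (\<lambda>t. v (- t))"
proof -
  have dual: "dual_weight p (\<lambda>t. v (- t)) = (\<lambda>t. dual_weight p v (- t))" by (simp add: dual_weight_def fun_eq_iff)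
  have dm: "dual_weight p v \<in> borel_measurable lebesgue" using v by measurable
  let ?P = "\<lambda>x y z. \<exists>s>0. weight_measure (dual_weight p v) {y<..<z} = ennreal s \<and>
       weight_measure v {x<..<y} \<le> ennreal (K * (z - x) powr p * s powr (1 - p))"
  have "Ap_minus_on p K {..0} (\<lambda>t. v (- t)) \<longleftrightarrow>
      (\<forall>x y z. x \<le> 0 \<longrightarrow> z \<le> 0 \<longrightarrow> x < y \<longrightarrow> y < z \<longrightarrow> ?P (- z) (- y) (- x))"
    unfolding Ap_minus_on_def dual by (simp add: weight_measure_reflect[OF v] weight_measure_reflect[OF dm])
  also have "\<dots> \<longleftrightarrow> (\<forall>x y z. 0 \<le> x \<longrightarrow> x < y \<longrightarrow> y < z \<longrightarrow> ?P x y z)"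
  proof (intro iffI allI impI)
    fix x y z :: real
    assume H: "\<forall>x y z. x \<le> 0 \<longrightarrow> z \<le> 0 \<longrightarrow> x < y \<longrightarrow> y < z \<longrightarrow> ?P (- z) (- y) (- x)" and "0 \<le> x" "x < y" "y < z"
    then show "?P x y z" using H[rule_format, of "-z" "-x" "-y"] by simp
  next
    fix x y z :: real
    assume H: "\<forall>x y z. 0 \<le> x \<longrightarrow> x < y \<longrightarrow> y < z \<longrightarrow> ?P x y z" and "x \<le> 0" "z \<le> 0" "x < y" "y < z"
    then show "?P (- z) (- y) (- x)" using H[rule_format, of "-z" "-y" "-x"] by simp
  qed
  finally show ?thesis by (simp add: Ap_plus_def)
qed

lemma Ap_plus_self_improvement:
  assumes v: "v \<in> borel_measurable lebesgue" "\<And>t. 0 < v t" and p: "1 < p" and K: "0 < K" and Ap: "Ap_plus p K v"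
  obtains r K' where "1 < r" "r < p" "0 < K'" "Ap_plus r K' v"
proof -
  obtain r K' where r: "1 < r" "r < p" "0 < K'" and imp:
    "\<And>I w. w \<in> borel_measurable lebesgue \<Longrightarrow> (\<And>t. 0 < w t) \<Longrightarrow>
      (\<And>x z. x \<in> I \<Longrightarrow> z \<in> I \<Longrightarrow> {x..z} \<subseteq> I) \<Longrightarrow> Ap_minus_on p K I w \<Longrightarrow> Ap_minus_on r K' I w"
    by (rule Ap_minus_self_improvement[OF p K]) (assumption | blast)+
  have "(\<lambda>t. v (- t)) \<in> borel_measurable lebesgue"
    using measurable_compose[OF uminus_measurable_lebesgue v(1)] by simp
  then have "Ap_minus_on r K' {..0} (\<lambda>t. v (- t))"
    by (rule imp) (use v Ap in \<open>auto simp: Ap_plus_iff_reflect\<close>)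
  then have "Ap_plus r K' v" by (simp add: Ap_plus_iff_reflect v)
  with r show thesis by (rule that)
qed

section \<open>Weak type estimates\<close>

text \<open>The dual weight for r is the power \<theta> < 1 of the dual weight g for p, so this is
  Jensen's inequality for the mean of a concave power. It is replaced by the pointwise bound
  g^\<theta> \<le> c^\<theta> + c^(\<theta>-1) g, at the loss of a factor 2.\<close>

lemma Ap_minus_on_mono:
  assumes v: "v \<in> borel_measurable lebesgue" "\<And>t. 0 < v t" and p: "1 < p" "p < r" and K: "0 < K" and Ap: "Ap_minus_on p K I v"
  obtains K' where "0 < K'" "Ap_minus_on r K' I v"
proof -
  define \<theta> where "\<theta> = (p - 1) / (r - 1)"
  have \<theta>: "0 < \<theta>" "\<theta> < 1" "\<theta> * (r - 1) = p - 1" using p by (auto simp: \<theta>_def)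
  define K' where "K' = K * 2 powr (r - 1)"
  have K': "0 < K'" using K by (simp add: K'_def)
  let ?g = "dual_weight p v" and ?h = "dual_weight r v"
  have gm: "?g \<in> borel_measurable lebesgue" using v by measurable
  have gpos: "0 < ?g t" for t using v(2) by (rule dual_weight_pos)
  have h: "?h t = ?g t powr \<theta>" for t
  proof -
    have "- 1 / (r - 1) = - 1 / (p - 1) * \<theta>" using p by (simp add: \<theta>_def)
    then show ?thesis by (simp only: dual_weight_def powr_powr)
  qed
  have "\<exists>u>0. weight_measure ?h {x<..<y} = ennreal u \<and>
       weight_measure v {y<..<z} \<le> ennreal (K' * (z - x) powr r * u powr (1 - r))"
    if xyz: "x \<in> I" "z \<in> I" "x < y" "y < z" for x y z
  proof -
    obtain s where s: "0 < s" "weight_measure ?g {x<..<y} = ennreal s"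
      "weight_measure v {y<..<z} \<le> ennreal (K * (z - x) powr p * s powr (1 - p))"
      using Ap xyz unfolding Ap_minus_on_def by meson
    define l where "l = z - x"
    have l: "0 < l" "y - x \<le> l" using xyz by (auto simp: l_def)
    \<comment> \<open>With this c, the dual mass divided by the whole length, both terms of the
      pointwise bound integrate to at most s^\<theta> l^(1-\<theta>).\<close>
    define c where "c = s / l"
    have c: "0 < c" using s l by (simp add: c_def)
    have pw: "?h t \<le> c powr \<theta> * 1 + c powr (\<theta> - 1) * ?g t" for t
    proof (cases "?g t \<le> c")
      case True
      then have "?g t powr \<theta> \<le> c powr \<theta>" using gpos[of t] \<theta> by (intro powr_mono2) auto
      then show ?thesis using gpos[of t] by (simp add: h add_increasing2)
    next
      case False
      then have "?g t powr (\<theta> - 1) \<le> c powr (\<theta> - 1)" using c \<theta> by (intro powr_mono2') auto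
      then have "?g t powr (\<theta> - 1) * ?g t \<le> c powr (\<theta> - 1) * ?g t" using gpos[of t] by (intro mult_right_mono) auto
      moreover have "?g t powr (\<theta> - 1) * ?g t = ?g t powr \<theta>"
        using gpos[of t] by (simp add: powr_diff)
      ultimately show ?thesis by (simp add: h add_increasing)
    qed
    have "weight_measure ?h {x<..<y} \<le> weight_measure (\<lambda>t. c powr \<theta> * 1 + c powr (\<theta> - 1) * ?g t) {x<..<y}"
      by (rule weight_measure_mono) (use pw in auto)
    also have "\<dots> = weight_measure (\<lambda>t. c powr \<theta> * 1) {x<..<y} + weight_measure (\<lambda>t. c powr (\<theta> - 1) * ?g t) {x<..<y}"
      by (rule weight_measure_add) (use gm gpos in \<open>auto simp: less_imp_le\<close>)
    also have "\<dots> = ennreal (c powr \<theta>) * weight_measure (\<lambda>_. 1) {x<..<y} + ennreal (c powr (\<theta> - 1)) * weight_measure ?g {x<..<y}"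
      by (intro arg_cong2[where f = "(+)"] weight_measure_cmult gm) auto
    also have "\<dots> = ennreal (c powr \<theta> * (y - x) + c powr (\<theta> - 1) * s)"
      using xyz s(1) by (simp add: weight_measure_one_interval s(2) ennreal_mult'[symmetric])
    also have "\<dots> \<le> ennreal (2 * (s powr \<theta> * l powr (1 - \<theta>)))"
    proof (rule ennreal_leI)
      have "c powr \<theta> * (y - x) \<le> c powr \<theta> * l" using l by (intro mult_left_mono) auto
      also have "\<dots> = s powr \<theta> * l powr (1 - \<theta>)" using s l by (simp add: c_def powr_divide powr_diff)
      finally have "c powr \<theta> * (y - x) \<le> s powr \<theta> * l powr (1 - \<theta>)" .
      moreover have "c powr (\<theta> - 1) * s = s powr \<theta> * l powr (1 - \<theta>)"
        using s l by (simp add: c_def powr_divide powr_diff)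
      ultimately show "c powr \<theta> * (y - x) + c powr (\<theta> - 1) * s \<le> 2 * (s powr \<theta> * l powr (1 - \<theta>))" by simp
    qed
    finally have ule: "weight_measure ?h {x<..<y} \<le> ennreal (2 * (s powr \<theta> * l powr (1 - \<theta>)))" .
    define u where "u = enn2real (weight_measure ?h {x<..<y})"
    have "weight_measure ?h {x<..<y} < \<infinity>" using ule by (rule le_less_trans) simp
    then have u: "weight_measure ?h {x<..<y} = ennreal u" by (simp add: u_def)
    have "0 < weight_measure ?h {x<..<y}"
      by (rule weight_measure_pos) (use v xyz in \<open>auto intro!: dual_weight_pos dual_weight_measurable\<close>)
    then have upos: "0 < u" unfolding u by simp
    have "u \<le> 2 * (s powr \<theta> * l powr (1 - \<theta>))" using ule unfolding u by (subst (asm) ennreal_le_iff) auto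
    then have "u powr (r - 1) \<le> (2 * (s powr \<theta> * l powr (1 - \<theta>))) powr (r - 1)"
      using upos p by (intro powr_mono2) auto
    also have "\<dots> = 2 powr (r - 1) * (s powr (\<theta> * (r - 1)) * l powr ((1 - \<theta>) * (r - 1)))"
      by (simp add: powr_mult powr_powr)
    also have "(1 - \<theta>) * (r - 1) = r - p" using \<theta>(3) by (simp add: algebra_simps)
    finally have ub: "u powr (r - 1) \<le> 2 powr (r - 1) * (s powr (p - 1) * l powr (r - p))" unfolding \<theta>(3) .
    have "s powr (1 - p) = s powr (1 - p) * (u powr (r - 1) * u powr (1 - r))"
      using upos by (simp add: powr_add[symmetric])
    also have "\<dots> \<le> s powr (1 - p) * (2 powr (r - 1) * (s powr (p - 1) * l powr (r - p)) * u powr (1 - r))"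
      by (intro mult_left_mono mult_right_mono ub) auto
    also have "\<dots> = (s powr (1 - p) * s powr (p - 1)) * (2 powr (r - 1) * l powr (r - p) * u powr (1 - r))"
      by (simp only: mult_ac)
    also have "s powr (1 - p) * s powr (p - 1) = 1" using s by (simp add: powr_add[symmetric])
    finally have sb: "s powr (1 - p) \<le> 2 powr (r - 1) * l powr (r - p) * u powr (1 - r)" by simp
    have "K * l powr p * s powr (1 - p) \<le> K * l powr p * (2 powr (r - 1) * l powr (r - p) * u powr (1 - r))"
      using K by (intro mult_left_mono sb) auto
    also have "\<dots> = K' * (l powr p * l powr (r - p)) * u powr (1 - r)" by (simp add: K'_def)
    also have "l powr p * l powr (r - p) = l powr r" by (simp add: powr_add[symmetric])
    finally have "ennreal (K * l powr p * s powr (1 - p)) \<le> ennreal (K' * l powr r * u powr (1 - r))"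
      by (rule ennreal_leI)
    then show ?thesis using u upos s(3) unfolding l_def by (meson order_trans)
  qed
  then show thesis by (intro that[OF K']) (simp add: Ap_minus_on_def)
qed

lemma Ap_plus_mono:
  assumes v: "v \<in> borel_measurable lebesgue" "\<And>t. 0 < v t" and p: "1 < p" "p < r" and K: "0 < K" and Ap: "Ap_plus p K v"
  obtains K' where "0 < K'" "Ap_plus r K' v"
proof -
  have "(\<lambda>t. v (- t)) \<in> borel_measurable lebesgue"
    using measurable_compose[OF uminus_measurable_lebesgue v(1)] by simp
  then obtain K' where "0 < K'" "Ap_minus_on r K' {..0} (\<lambda>t. v (- t))"
    by (rule Ap_minus_on_mono[OF _ _ p K, of "\<lambda>t. v (- t)" "{..0}"]) (use v Ap in \<open>auto simp: Ap_plus_iff_reflect\<close>)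
  then show thesis by (intro that) (simp_all add: Ap_plus_iff_reflect v)
qed

text \<open>Together with \<open>tail_op\<close> this models \<open>hardy_P\<close> and
  \<open>hardy_Q\<close> on nonnegative functions with values in [0, \<infinity>], so that weak
  types can be stated before any integrability is known.\<close>

definition average_op :: "(real \<Rightarrow> real) \<Rightarrow> real \<Rightarrow> ennreal" where
  "average_op f t = ennreal (1 / t) * weight_measure f {0<..<t}"

definition tail_op :: "(real \<Rightarrow> real) \<Rightarrow> real \<Rightarrow> ennreal" where
  "tail_op f t = weight_measure (\<lambda>s. f s / s) {t<..}"

definition weak_type :: "real \<Rightarrow> (real \<Rightarrow> real) \<Rightarrow> ((real \<Rightarrow> real) \<Rightarrow> real \<Rightarrow> ennreal) \<Rightarrow> bool" where
  "weak_type r w T \<longleftrightarrow> (\<exists>C>0. \<forall>f \<mu>. f \<in> borel_measurable lebesgue \<longrightarrow> (\<forall>t. 0 \<le> f t) \<longrightarrow> 0 < \<mu> \<longrightarrow>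
     weight_measure w {t. 0 < t \<and> ennreal \<mu> < T f t}
       \<le> ennreal (C * \<mu> powr (- r)) * weight_measure (\<lambda>t. f t powr r * w t) {0<..})"

text \<open>The condition for the points 0, n and n + 1 makes the dual mass of (0, n) finite, so
  Hoelder's inequality works all the way down to the origin.\<close>

lemma Ap_minus_integrable:
  assumes w: "w \<in> borel_measurable lebesgue" "\<And>t. 0 < w t" and r: "1 < r" and Ap: "Ap_minus_on r K {0..} w"
    and f: "f \<in> borel_measurable lebesgue" "\<And>t. 0 \<le> f t"
    and fin: "weight_measure (\<lambda>t. f t powr r * w t) {0<..} < \<infinity>"
  shows "weight_measure f {0<..<n} < \<infinity>"
proof (cases "0 < n")
  case True
  obtain s where s: "0 < s" "weight_measure (dual_weight r w) {0<..<n} = ennreal s"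
    using Ap[unfolded Ap_minus_on_def, rule_format, of 0 "n + 1" n] True by auto
  define \<phi> where "\<phi> = enn2real (weight_measure (\<lambda>t. f t powr r * w t) {0<..})"
  have \<phi>: "weight_measure (\<lambda>t. f t powr r * w t) {0<..} = ennreal \<phi>" using fin by (simp add: \<phi>_def)
  have "weight_measure (\<lambda>t. f t powr r * w t) {0<..<n} \<le> ennreal \<phi>"
    unfolding \<phi>[symmetric] by (rule weight_measure_subset) auto
  then obtain i where "weight_measure f {0<..<n} = ennreal i"
    by (rule weight_measure_Holder_weak[OF f(1) w(1) _ w(2) f(2) r, of "{0<..<n}" s \<phi>, rotated 3])
      (use s in \<open>auto simp: \<phi>_def\<close>)
  then show ?thesis by simp
qed simp

text \<open>An average over (0, t) above \<mu> is a backward average starting at y = 0, so the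
  maximal function dominates. Its weak type bound on bounded intervals has a constant independent of
  the interval and passes to the increasing union.\<close>

lemma Ap_minus_weak_type:
  assumes w: "w \<in> borel_measurable lebesgue" "\<And>t. 0 < w t" and r: "1 < r" and K: "0 < K" and Ap: "Ap_minus_on r K {0..} w"
  shows "weak_type r w average_op"
  unfolding weak_type_def
proof (intro exI[of _ "8 powr r * K"] conjI allI impI)
  show "0 < 8 powr r * K" using K by simp
  fix f :: "real \<Rightarrow> real" and \<mu> :: real
  assume f: "f \<in> borel_measurable lebesgue" "\<forall>t. 0 \<le> f t" and \<mu>: "0 < \<mu>"
  let ?c = "8 powr r * K * \<mu> powr (- r)"
  let ?h = "\<lambda>t. f t powr r * w t"
  show "weight_measure w {t. 0 < t \<and> ennreal \<mu> < average_op f t} \<le> ennreal ?c * weight_measure ?h {0<..}"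
  proof (cases "weight_measure ?h {0<..} = \<infinity>")
    case True
    then show ?thesis using K \<mu> by (simp add: ennreal_mult_top)
  next
    case False
    have fin: "weight_measure f {0<..<n} < \<infinity>" for n
      by (rule Ap_minus_integrable[OF w r Ap f(1)]) (use False f in \<open>auto simp: less_top\<close>)
    define L where "L n = {x \<in> {0<..<real (Suc n)}. \<exists>y. 0 \<le> y \<and> y < x \<and> ennreal (\<mu> * (x - y)) < weight_measure f {y<..<x}}" for n
    have On: "weight_measure w (L n) \<le> ennreal ?c * weight_measure ?h {0<..}" for n
    proof -
      have "weight_measure w (L n) \<le> ennreal ?c * weight_measure ?h {0<..<real (Suc n)}"
        unfolding L_def
        by (rule backward_maximal_weak_type[OF f(1) w(1) f(2)[rule_format] w(2) r K \<mu> Ap_minus_on_subset[OF Ap] _ fin]) auto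
      also have "\<dots> \<le> ennreal ?c * weight_measure ?h {0<..}"
        by (intro mult_left_mono weight_measure_subset) auto
      finally show ?thesis .
    qed
    have inc: "incseq L" unfolding L_def by (rule incseq_SucI) auto
    have Om: "L n \<in> sets lebesgue" for n
    proof -
      have n: "0 < real (Suc n)" by simp
      obtain J where "countable J" "L n = (\<Union>(\<alpha>,\<beta>)\<in>J. {\<alpha><..<\<beta>})"
        unfolding L_def
        by (rule backward_maximal_components[OF f(1) f(2)[rule_format] \<mu> n fin]) (assumption | blast)+
      then show ?thesis by (simp only:) (rule sets.countable_UN'', auto)
    qed
    have sub: "{t. 0 < t \<and> ennreal \<mu> < average_op f t} \<subseteq> (\<Union>n. L n)"
    proof clarify
      fix t assume t: "0 < t" "ennreal \<mu> < average_op f t"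
      define i where "i = enn2real (weight_measure f {0<..<t})"
      have i: "weight_measure f {0<..<t} = ennreal i" "0 \<le> i" using fin[of t] by (auto simp: i_def)
      have "ennreal \<mu> < ennreal (1 / t * i)" using t i by (simp add: average_op_def ennreal_mult'[symmetric])
      then have "\<mu> < i / t" using \<mu> by (subst (asm) ennreal_less_iff) auto
      then have "\<mu> * (t - 0) < i" using t by (simp add: field_simps)
      then have "ennreal (\<mu> * (t - 0)) < weight_measure f {0<..<t}"
        unfolding i using \<mu> t by (subst ennreal_less_iff) auto
      moreover obtain n where "t < real n" using reals_Archimedean2 by blast
      ultimately have "t \<in> L n" using t by (auto simp: L_def)
      then show "t \<in> (\<Union>n. L n)" by blast
    qed
    have "weight_measure w {t. 0 < t \<and> ennreal \<mu> < average_op f t} \<le> weight_measure w (\<Union>n. L n)"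
      by (rule weight_measure_subset[OF sub])
    also have "\<dots> = (SUP n. weight_measure w (L n))"
    proof -
      have "(SUP n. emeasure (density lebesgue (\<lambda>t. ennreal (w t))) (L n)) = emeasure (density lebesgue (\<lambda>t. ennreal (w t))) (\<Union>n. L n)"
        by (rule SUP_emeasure_incseq) (use Om inc in auto)
      then show ?thesis using Om w by (simp add: weight_measure_eq_emeasure)
    qed
    also have "\<dots> \<le> ennreal ?c * weight_measure ?h {0<..}" by (rule SUP_least) (rule On)
    finally show ?thesis .
  qed
qed

section \<open>Tail estimates for weights in the upper class\<close>

lemma powr_measurable_lebesgue: "(\<lambda>t::real. t powr c) \<in> borel_measurable lebesgue"
  by (rule measurable_completion) measurable

text \<open>Let V_k be the mass of v on (0, 2^k b) and s_k the dual mass of the dyadic piece that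
  follows. The one-sided condition bounds V_k s_k^(r-1) by a multiple of (2^k b)^r, and Hoelder's
  inequality on the piece bounds (2^k b)^r by a multiple of s_k^(r-1) times the mass of v there.
  Hence every piece adds at least the fraction \<eta> of V_k, and V_k grows geometrically. The first
  bound then makes s_k, divided by (2^k b)^(r/(r-1)), decay geometrically. The exponent r/(r-1) is
  the conjugate of r, as the pairing of f with 1/s requires.\<close>

lemma Ap_plus_tail_bound:
  assumes v: "v \<in> borel_measurable lebesgue" "\<And>t. 0 < v t" and r: "1 < r" and K: "0 < K" and Ap: "Ap_plus r K v"
  obtains C where "0 < C"
    "\<And>b. 0 < b \<Longrightarrow> \<exists>V>0. weight_measure v {0<..<b} = ennreal V \<and>
       weight_measure (\<lambda>t. dual_weight r v t * t powr (- r / (r - 1))) {b<..} \<le> ennreal (C * V powr (- 1 / (r - 1)))"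
proof -
  define \<eta> where "\<eta> = 4 powr (- r) / K"
  have \<eta>: "0 < \<eta>" using K by (simp add: \<eta>_def)
  define e where "e = 1 / (r - 1)"
  have e: "0 < e" using r by (simp add: e_def)
  define \<kappa> where "\<kappa> = (1 + \<eta>) powr (- e)"
  have \<kappa>: "0 < \<kappa>" "\<kappa> < 1" using \<eta> e by (auto simp: \<kappa>_def powr_less_one)
  define C where "C = (K * 2 powr r) powr e * (1 / (1 - \<kappa>))"
  have C: "0 < C" using K \<kappa> by (simp add: C_def)
  let ?g = "dual_weight r v" and ?h = "\<lambda>t. dual_weight r v t * t powr (- r / (r - 1))"
  have gm: "?g \<in> borel_measurable lebesgue" using v by measurable
  have hm: "?h \<in> borel_measurable lebesgue" using gm powr_measurable_lebesgue by (rule borel_measurable_times)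
  show thesis
  proof (rule that[OF C])
    fix b :: real assume b: "0 < b"
    define x where "x k = 2 ^ k * b" for k :: nat
    have x: "0 < x k" "x (Suc k) = 2 * x k" for k using b by (auto simp: x_def)
    have "\<exists>s>0. weight_measure ?g {x k<..<x (Suc k)} = ennreal s \<and>
       weight_measure v {0<..<x k} \<le> ennreal (K * (x (Suc k) - 0) powr r * s powr (1 - r))" for k
      using Ap[unfolded Ap_plus_def, rule_format, of 0 "x k" "x (Suc k)"] x[of k] by auto
    then obtain s where s: "\<And>k. 0 < s k" "\<And>k. weight_measure ?g {x k<..<x (Suc k)} = ennreal (s k)"
      "\<And>k. weight_measure v {0<..<x k} \<le> ennreal (K * x (Suc k) powr r * s k powr (1 - r))"
      by (metis diff_zero)
    define V where "V k = enn2real (weight_measure v {0<..<x k})" for k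
    have V: "weight_measure v {0<..<x k} = ennreal (V k)" for k
      using s(3)[of k] by (simp add: V_def le_less_trans)
    have Vpos: "0 < V k" for k
    proof -
      have "0 < weight_measure v {0<..<x k}" by (rule weight_measure_pos) (use v x in auto)
      then show ?thesis by (simp add: V)
    qed
    have Vs: "V k * s k powr (r - 1) \<le> K * 2 powr r * x k powr r" for k
    proof -
      have "V k \<le> K * x (Suc k) powr r * s k powr (1 - r)"
        using s(3)[of k] K unfolding V by (subst (asm) ennreal_le_iff) auto
      then have "V k * s k powr (r - 1) \<le> K * x (Suc k) powr r * s k powr (1 - r) * s k powr (r - 1)"
        by (rule mult_right_mono) simp
      also have "\<dots> = K * x (Suc k) powr r" using s(1)[of k] by (simp add: powr_add[symmetric])
      finally show ?thesis using x(1)[of k] by (simp add: x(2) powr_mult)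
    qed
    have growth: "(1 + \<eta>) * V k \<le> V (Suc k)" for k
    proof -
      define \<nu> where "\<nu> = enn2real (weight_measure v {x k<..<x (Suc k)})"
      have split: "weight_measure v {0<..<x k} + weight_measure v {x k<..<x (Suc k)} \<le> weight_measure v {0<..<x (Suc k)}"
        using x[of k] v by (subst weight_measure_Un[symmetric]) (auto intro!: weight_measure_subset)
      then have "weight_measure v {x k<..<x (Suc k)} < \<infinity>" unfolding V
        by (metis ennreal_less_top infinity_ennreal_def le_less_trans add.commute le_iff_add)
      then have \<nu>: "weight_measure v {x k<..<x (Suc k)} = ennreal \<nu>" "0 \<le> \<nu>" by (auto simp: \<nu>_def)
      have h1: "weight_measure (\<lambda>t. 1 powr r * v t) {x k<..<x (Suc k)} \<le> ennreal \<nu>" using \<nu> by simp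
      have h2: "weight_measure ?g {x k<..<x (Suc k)} \<le> ennreal (s k)" by (simp add: s)
      \<comment> \<open>For the constant function 1 the inequality becomes a lower bound for the
        mass of v on the piece, as the integral is the known length \<open>x k\<close>.\<close>
      obtain i where i: "0 \<le> i" "weight_measure (\<lambda>_. 1) {x k<..<x (Suc k)} = ennreal i"
          "i powr r \<le> 2 powr r * s k powr (r - 1) * \<nu>"
        by (rule weight_measure_Holder_weak[OF _ v(1) _ v(2) _ r h2 s(1) h1 \<nu>(2)]) auto
      have "i = x k" using i x[of k] by (simp add: weight_measure_one_interval)
      then have "V k * s k powr (r - 1) \<le> K * 2 powr r * (2 powr r * s k powr (r - 1) * \<nu>)"
        using Vs[of k] i(3) K by (smt (verit, best) mult_left_mono mult_nonneg_nonneg powr_ge_zero)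
      also have "\<dots> = K * 4 powr r * \<nu> * s k powr (r - 1)" by (simp add: powr_mult[symmetric])
      finally have "V k \<le> K * 4 powr r * \<nu>" using s(1)[of k] by simp
      then have "\<eta> * V k \<le> \<nu>" using K by (simp add: \<eta>_def powr_minus_divide field_simps)
      moreover have "V k + \<nu> \<le> V (Suc k)"
        using split \<nu> Vpos[of k] Vpos[of "Suc k"] unfolding V \<nu>(1)
        by (simp add: ennreal_plus[symmetric] ennreal_le_iff del: ennreal_plus)
      ultimately show ?thesis by (simp add: algebra_simps)
    qed
    have Vlow: "(1 + \<eta>) ^ k * V 0 \<le> V k" for k
    proof (induction k)
      case (Suc k)
      have "(1 + \<eta>) ^ Suc k * V 0 = (1 + \<eta>) * ((1 + \<eta>) ^ k * V 0)" by simp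
      also have "\<dots> \<le> (1 + \<eta>) * V k" using \<eta> by (intro mult_left_mono Suc) auto
      also have "\<dots> \<le> V (Suc k)" by (rule growth)
      finally show ?case .
    qed simp
    have sb: "x k powr (- r / (r - 1)) * s k \<le> (K * 2 powr r) powr e * V 0 powr (- e) * \<kappa> ^ k" for k
    proof -
      have A: "0 < (1 + \<eta>) ^ k * V 0" using \<eta> Vpos[of 0] by simp
      have "s k powr (r - 1) * ((1 + \<eta>) ^ k * V 0) \<le> s k powr (r - 1) * V k"
        by (intro mult_left_mono Vlow) simp
      also have "\<dots> \<le> K * 2 powr r * x k powr r" using Vs[of k] by (simp add: mult.commute)
      finally have "s k powr (r - 1) \<le> K * 2 powr r * x k powr r / ((1 + \<eta>) ^ k * V 0)"
        using A by (simp add: pos_le_divide_eq)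
      then have "(s k powr (r - 1)) powr e \<le> (K * 2 powr r * x k powr r / ((1 + \<eta>) ^ k * V 0)) powr e"
        using e by (intro powr_mono2) auto
      also have "(s k powr (r - 1)) powr e = s k" using r s(1)[of k] by (simp add: powr_powr e_def)
      also have "(K * 2 powr r * x k powr r / ((1 + \<eta>) ^ k * V 0)) powr e
          = (K * 2 powr r) powr e * x k powr (r * e) * (((1 + \<eta>) ^ k) powr (- e) * V 0 powr (- e))"
      proof -
        have "(K * 2 powr r * x k powr r / ((1 + \<eta>) ^ k * V 0)) powr e
          = ((K * 2 powr r) powr e * (x k powr r) powr e) / (((1 + \<eta>) ^ k) powr e * V 0 powr e)"
          using K \<eta> Vpos[of 0] by (simp add: powr_divide powr_mult)
        then show ?thesis by (simp add: powr_powr powr_minus_divide)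
      qed
      also have "((1 + \<eta>) ^ k) powr (- e) = \<kappa> ^ k"
        unfolding \<kappa>_def using \<eta> by (induction k) (auto simp: powr_mult)
      finally have "x k powr (- r / (r - 1)) * s k \<le>
          x k powr (- r / (r - 1)) * ((K * 2 powr r) powr e * x k powr (r * e) * (\<kappa> ^ k * V 0 powr (- e)))"
        by (rule mult_left_mono) simp
      also have "\<dots> = (x k powr (- r / (r - 1)) * x k powr (r * e)) * ((K * 2 powr r) powr e * V 0 powr (- e) * \<kappa> ^ k)"
        by (simp only: mult_ac)
      also have "x k powr (- r / (r - 1)) * x k powr (r * e) = 1"
        unfolding powr_add[symmetric] e_def using x(1)[of k] by simp
      finally show ?thesis by simp
    qed
    define A where "A k = {x k<..x (Suc k)}" for k
    have xmono: "x m \<le> x n" if "m \<le> n" for m n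
      using that b by (simp add: x_def power_increasing)
    have disj: "disjoint_family A"
      unfolding disjoint_family_on_def
    proof (intro ballI impI)
      fix m n :: nat assume "m \<noteq> n"
      then consider "Suc m \<le> n" | "Suc n \<le> m" by linarith
      then show "A m \<inter> A n = {}"
        by cases (auto simp: A_def dest: xmono)
    qed
    have cover: "{b<..} \<subseteq> (\<Union>k. A k)"
    proof
      fix t assume t: "t \<in> {b<..}"
      obtain n where "t / b < 2 ^ n" using real_arch_pow[of 2 "t / b"] by auto
      then have ex: "t \<le> x n" using b by (simp add: x_def field_simps)
      define k where "k = (LEAST k. t \<le> x k)"
      have k: "t \<le> x k" unfolding k_def using ex by (rule LeastI)
      then have "k \<noteq> 0" using t by (cases k) (auto simp: x_def)
      then obtain m where m: "k = Suc m" by (cases k) auto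
      then have "\<not> t \<le> x m" using not_less_Least[of m "\<lambda>k. t \<le> x k"] by (auto simp: k_def)
      then show "t \<in> (\<Union>k. A k)" using k m by (auto simp: A_def not_le)
    qed
    have step: "weight_measure ?h (A k) \<le> ennreal ((K * 2 powr r) powr e * V 0 powr (- e) * \<kappa> ^ k)" for k
    proof -
      have "weight_measure ?h (A k) = weight_measure ?h {x k<..<x (Suc k)}"
        by (simp add: A_def weight_measure_greaterThanAtMost)
      also have "\<dots> \<le> weight_measure (\<lambda>t. x k powr (- r / (r - 1)) * ?g t) {x k<..<x (Suc k)}"
      proof (rule weight_measure_mono, intro conjI)
        fix t assume t: "t \<in> {x k<..<x (Suc k)}"
        then show "t \<in> {x k<..<x (Suc k)}" .
        have "t powr (- r / (r - 1)) \<le> x k powr (- r / (r - 1))"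
          using t x(1)[of k] r by (intro powr_mono2') auto
        then show "?g t * t powr (- r / (r - 1)) \<le> x k powr (- r / (r - 1)) * ?g t"
          by (subst mult.commute) (intro mult_right_mono dual_weight_nonneg)
      qed
      also have "\<dots> = ennreal (x k powr (- r / (r - 1))) * ennreal (s k)"
        unfolding s(2)[symmetric] by (rule weight_measure_cmult[OF gm]) auto
      also have "\<dots> = ennreal (x k powr (- r / (r - 1)) * s k)" by (rule ennreal_mult'[symmetric]) simp
      also have "\<dots> \<le> ennreal ((K * 2 powr r) powr e * V 0 powr (- e) * \<kappa> ^ k)" by (rule ennreal_leI[OF sb])
      finally show ?thesis .
    qed
    have "weight_measure ?h {b<..} \<le> weight_measure ?h (\<Union>k. A k)" by (rule weight_measure_subset[OF cover])
    also have "\<dots> = (\<Sum>k. weight_measure ?h (A k))"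
      by (subst weight_measure_UN[OF _ _ disj hm]) (auto simp: A_def nn_integral_count_space_nat)
    also have "\<dots> \<le> (\<Sum>k. ennreal ((K * 2 powr r) powr e * V 0 powr (- e) * \<kappa> ^ k))"
      by (rule suminf_le) (use step in auto)
    also have "\<dots> = ennreal ((K * 2 powr r) powr e * V 0 powr (- e) * (1 / (1 - \<kappa>)))"
      using \<kappa> by (intro suminf_ennreal_eq sums_mult geometric_sums) auto
    also have "\<dots> = ennreal (C * V 0 powr (- 1 / (r - 1)))" by (simp add: C_def e_def mult_ac)
    finally have "weight_measure ?h {b<..} \<le> ennreal (C * V 0 powr (- 1 / (r - 1)))" .
    then show "\<exists>V>0. weight_measure v {0<..<b} = ennreal V \<and> weight_measure ?h {b<..} \<le> ennreal (C * V powr (- 1 / (r - 1)))"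
      using Vpos[of 0] V[of 0] by (intro exI[of _ "V 0"]) (simp add: x_def)
  qed
qed

text \<open>The mass of (0, t) depends continuously on t, so the bound passes from the points of E
  to Sup E, and E lies in (0, Sup E]; if E is unbounded, all segments (0, n) obey the bound. This
  fits \<open>tail_op\<close>, where each point of a level set bounds the mass of everything before
  it.\<close>

lemma weight_measure_initial_segments:
  assumes v: "v \<in> borel_measurable lebesgue" "\<And>t. 0 \<le> v t"
    and fin: "\<And>t. weight_measure v {0<..<t::real} < \<infinity>"
    and E: "E \<subseteq> {0<..}" "\<And>t. t \<in> E \<Longrightarrow> weight_measure v {0<..<t} \<le> ennreal B" and B: "0 \<le> B"
  shows "weight_measure v E \<le> ennreal B"
proof (cases "bdd_above E")
  case bdd: True
  show ?thesis
  proof (cases "E = {}")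
    case False
    define d where "d = Sup E"
    obtain t where t: "t \<in> E" using False by blast
    have d: "0 < d" using t E(1) cSup_upper[OF t bdd] by (auto simp: d_def)
    obtain G where G: "continuous_on {0..d} G" "G 0 = 0"
      "\<And>x y. 0 \<le> x \<Longrightarrow> x \<le> y \<Longrightarrow> y \<le> d \<Longrightarrow> G x \<le> G y \<and> weight_measure v {x<..<y} = ennreal (G y - G x)"
      using weight_measure_primitive[OF v fin] d by (metis less_imp_le)
    define Z where "Z = {x \<in> {0..d}. G x \<le> B}"
    have "closed Z" unfolding Z_def
      by (intro continuous_on_closed_Collect_le continuous_intros G)
    moreover have "E \<subseteq> Z"
    proof
      fix x assume x: "x \<in> E"
      then have "0 < x" "x \<le> d" using E(1) cSup_upper[OF x bdd] by (auto simp: d_def)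
      then show "x \<in> Z" using E(2)[OF x] G(2) G(3)[of 0 x] B by (auto simp: Z_def ennreal_le_iff)
    qed
    ultimately have "closure E \<subseteq> Z" by (rule closure_minimal[rotated])
    then have "d \<in> Z" using closure_contains_Sup[OF False bdd] by (auto simp: d_def)
    then have "ennreal (G d) \<le> ennreal B" by (auto simp: Z_def intro: ennreal_leI)
    moreover have "weight_measure v E \<le> weight_measure v {0<..d}"
      by (rule weight_measure_subset) (use E(1) bdd in \<open>auto simp: d_def intro: cSup_upper\<close>)
    ultimately show ?thesis
      using G(2) G(3)[of 0 d] d by (simp add: weight_measure_greaterThanAtMost)
  qed simp
next
  case False
  have le: "weight_measure v {0<..<real n} \<le> ennreal B" for n
  proof -
    obtain t where t: "t \<in> E" "real n < t" using False by (force simp: bdd_above_def not_le)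
    have "weight_measure v {0<..<real n} \<le> weight_measure v {0<..<t}"
      by (rule weight_measure_subset) (use t in auto)
    also have "\<dots> \<le> ennreal B" by (rule E(2)[OF t(1)])
    finally show ?thesis .
  qed
  have "weight_measure v E \<le> weight_measure v (\<Union>n. {0<..<real n})"
  proof (rule weight_measure_subset, rule subsetI)
    fix t assume "t \<in> E"
    then have "0 < t" using E(1) by auto
    moreover obtain n where "t < real n" using reals_Archimedean2 by blast
    ultimately show "t \<in> (\<Union>n. {0<..<real n})" by auto
  qed
  also have "\<dots> = (SUP n. weight_measure v {0<..<real n})"
  proof -
    have "(SUP n. emeasure (density lebesgue (\<lambda>t. ennreal (v t))) {0<..<real n}) =
        emeasure (density lebesgue (\<lambda>t. ennreal (v t))) (\<Union>n. {0<..<real n})"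
      by (rule SUP_emeasure_incseq) (auto intro!: incseq_SucI)
    moreover have "(\<Union>n. {0<..<real n}) \<in> sets lebesgue" by auto
    ultimately show ?thesis using v by (simp add: weight_measure_eq_emeasure)
  qed
  also have "\<dots> \<le> ennreal B" by (rule SUP_least) (rule le)
  finally show ?thesis .
qed

text \<open>Hoelder's inequality for f / s and the weight v s^r, whose dual weight is the integrand
  in \<open>Ap_plus_tail_bound\<close>. The tail of the dual mass is controlled by a negative power
  of the mass V of (0, t), so V appears as a factor: a bound at each single point, from which the
  weak type follows.\<close>

lemma Ap_plus_tail_Holder:
  assumes v: "v \<in> borel_measurable lebesgue" "\<And>t. 0 < v t" and r: "1 < r" and K: "0 < K" and Ap: "Ap_plus r K v"
  obtains C where "0 < C"
    "\<And>f \<phi> t. f \<in> borel_measurable lebesgue \<Longrightarrow> (\<And>t. 0 \<le> f t) \<Longrightarrow> 0 < t \<Longrightarrow> 0 \<le> \<phi> \<Longrightarrow>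
      weight_measure (\<lambda>t. f t powr r * v t) {0<..} \<le> ennreal \<phi> \<Longrightarrow>
      \<exists>V>0. \<exists>i\<ge>0. weight_measure v {0<..<t} = ennreal V \<and> tail_op f t = ennreal i \<and> V * i powr r \<le> C * \<phi>"
proof -
  obtain C where C: "0 < C" and tail: "\<And>b. 0 < b \<Longrightarrow> \<exists>V>0. weight_measure v {0<..<b} = ennreal V \<and>
       weight_measure (\<lambda>t. dual_weight r v t * t powr (- r / (r - 1))) {b<..} \<le> ennreal (C * V powr (- 1 / (r - 1)))"
    using Ap_plus_tail_bound[OF v r K Ap] by blast
  define C' where "C' = 2 powr r * C powr (r - 1)"
  have C': "0 < C'" using C by (simp add: C'_def)
  show thesis
  proof (rule that[OF C'])
    fix f :: "real \<Rightarrow> real" and \<phi> t :: real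
    assume f: "f \<in> borel_measurable lebesgue" "\<And>t. 0 \<le> f t" and t: "0 < t" and \<phi>: "0 \<le> \<phi>"
      "weight_measure (\<lambda>t. f t powr r * v t) {0<..} \<le> ennreal \<phi>"
    obtain V where V: "0 < V" "weight_measure v {0<..<t} = ennreal V"
       "weight_measure (\<lambda>t. dual_weight r v t * t powr (- r / (r - 1))) {t<..} \<le> ennreal (C * V powr (- 1 / (r - 1)))"
      using tail[OF t] by blast
    \<comment> \<open>The value 1 and the absolute value provide the signs that
      \<open>weight_measure_Holder_weak\<close> demands on the whole line; the integrals extend over
      s > t only.\<close>
    let ?w = "\<lambda>s. if 0 < s then v s * s powr r else 1" and ?f = "\<lambda>s. f s / \<bar>s\<bar>"
    have wm: "?w \<in> borel_measurable lebesgue"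
    proof -
      have "(\<lambda>s. v s * s powr r) \<in> borel_measurable lebesgue"
        using v(1) powr_measurable_lebesgue by (rule borel_measurable_times)
      moreover have "{s::real. 0 < s} \<in> sets lebesgue" by simp
      ultimately show ?thesis by (intro measurable_If) auto
    qed
    have "(\<lambda>s::real. \<bar>s\<bar>) \<in> borel_measurable lebesgue" by (rule measurable_completion) measurable
    with f(1) have fm: "?f \<in> borel_measurable lebesgue" by (rule borel_measurable_divide)
    have wpos: "0 < ?w s" for s using v(2) by simp
    have 1: "weight_measure (dual_weight r ?w) {t<..} \<le> ennreal (C * V powr (- 1 / (r - 1)))"
    proof -
      have "weight_measure (dual_weight r ?w) {t<..} = weight_measure (\<lambda>t. dual_weight r v t * t powr (- r / (r - 1))) {t<..}"
        by (rule weight_measure_cong) (use t v(2) in \<open>auto simp: dual_weight_def powr_mult powr_powr\<close>)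
      then show ?thesis using V(3) by simp
    qed
    have 2: "weight_measure (\<lambda>s. ?f s powr r * ?w s) {t<..} \<le> ennreal \<phi>"
    proof -
      have "weight_measure (\<lambda>s. ?f s powr r * ?w s) {t<..} = weight_measure (\<lambda>s. f s powr r * v s) {t<..}"
        by (rule weight_measure_cong) (use t f(2) in \<open>auto simp: powr_divide\<close>)
      also have "\<dots> \<le> weight_measure (\<lambda>s. f s powr r * v s) {0<..}" by (rule weight_measure_subset) (use t in auto)
      also note \<phi>(2)
      finally show ?thesis .
    qed
    have spos: "0 < C * V powr (- 1 / (r - 1))" using C V by simp
    obtain i where i: "0 \<le> i" "weight_measure ?f {t<..} = ennreal i"
       "i powr r \<le> 2 powr r * (C * V powr (- 1 / (r - 1))) powr (r - 1) * \<phi>"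
      by (rule weight_measure_Holder_weak[OF fm wm _ wpos _ r 1 spos 2 \<phi>(1)]) (use f in auto)
    have "(C * V powr (- 1 / (r - 1))) powr (r - 1) = C powr (r - 1) * V powr (- 1)"
      using r by (simp add: powr_mult powr_powr)
    also have "\<dots> = C powr (r - 1) / V" using V(1) by (simp add: powr_minus_divide)
    finally have "i powr r \<le> C' * \<phi> / V" using i(3) by (simp add: C'_def)
    then have "V * i powr r \<le> C' * \<phi>" using V(1) by (simp add: field_simps)
    moreover have "tail_op f t = ennreal i"
      unfolding tail_op_def i(2)[symmetric] by (rule weight_measure_cong) (use t in auto)
    ultimately show "\<exists>V>0. \<exists>i\<ge>0. weight_measure v {0<..<t} = ennreal V \<and> tail_op f t = ennreal i \<and> V * i powr r \<le> C' * \<phi>"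
      using V i(1) by blast
  qed
qed

lemma Ap_plus_weak_type:
  assumes v: "v \<in> borel_measurable lebesgue" "\<And>t. 0 < v t" and r: "1 < r" and K: "0 < K" and Ap: "Ap_plus r K v"
  shows "weak_type r v tail_op"
proof -
  obtain C where C: "0 < C" and H: "\<And>f \<phi> t. f \<in> borel_measurable lebesgue \<Longrightarrow> (\<And>t. 0 \<le> f t) \<Longrightarrow> 0 < t \<Longrightarrow> 0 \<le> \<phi> \<Longrightarrow>
      weight_measure (\<lambda>t. f t powr r * v t) {0<..} \<le> ennreal \<phi> \<Longrightarrow>
      \<exists>V>0. \<exists>i\<ge>0. weight_measure v {0<..<t} = ennreal V \<and> tail_op f t = ennreal i \<and> V * i powr r \<le> C * \<phi>"
    by (rule Ap_plus_tail_Holder[OF v r K Ap]) (assumption | blast)+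
  have fin: "weight_measure v {0<..<t} < \<infinity>" for t
  proof (cases "0 < t")
    case True
    \<comment> \<open>The estimate for the zero function contains the finiteness of the mass of (0,
      t).\<close>
    then show ?thesis using H[of "\<lambda>_. 0" t 0] r by (auto simp: weight_measure_def)
  qed simp
  show ?thesis unfolding weak_type_def
  proof (intro exI[of _ C] conjI allI impI)
    fix f :: "real \<Rightarrow> real" and \<mu> :: real
    assume f: "f \<in> borel_measurable lebesgue" "\<forall>t. 0 \<le> f t" and \<mu>: "0 < \<mu>"
    let ?h = "\<lambda>t. f t powr r * v t"
    show "weight_measure v {t. 0 < t \<and> ennreal \<mu> < tail_op f t} \<le> ennreal (C * \<mu> powr (- r)) * weight_measure ?h {0<..}"
    proof (cases "weight_measure ?h {0<..} = \<infinity>")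
      case True
      then show ?thesis using C \<mu> by (simp add: ennreal_mult_top)
    next
      case False
      define \<phi> where "\<phi> = enn2real (weight_measure ?h {0<..})"
      have \<phi>: "weight_measure ?h {0<..} = ennreal \<phi>" "0 \<le> \<phi>" using False by (auto simp: \<phi>_def less_top)
      have "weight_measure v {t. 0 < t \<and> ennreal \<mu> < tail_op f t} \<le> ennreal (C * \<mu> powr (- r) * \<phi>)"
      proof (rule weight_measure_initial_segments[OF v(1) less_imp_le[OF v(2)] fin])
        fix t assume "t \<in> {t. 0 < t \<and> ennreal \<mu> < tail_op f t}"
        then have t: "0 < t" "ennreal \<mu> < tail_op f t" by auto
        obtain V i where Vi: "0 < V" "0 \<le> i" "weight_measure v {0<..<t} = ennreal V" "tail_op f t = ennreal i" "V * i powr r \<le> C * \<phi>"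
          using H[of f t \<phi>] f t \<phi> by auto
        have "\<mu> < i" using t(2) Vi(4) \<mu> by (simp add: ennreal_less_iff)
        then have "V * \<mu> powr r \<le> V * i powr r" using \<mu> r Vi by (intro mult_left_mono powr_mono2) auto
        then have "V * \<mu> powr r \<le> C * \<phi>" using Vi(5) by (rule order_trans)
        then have "V \<le> C * \<mu> powr (- r) * \<phi>" using \<mu> by (simp add: powr_minus_divide field_simps)
        then show "weight_measure v {0<..<t} \<le> ennreal (C * \<mu> powr (- r) * \<phi>)"
          unfolding Vi(3) by (rule ennreal_leI)
      qed (use C \<phi> in auto)
      also have "\<dots> = ennreal (C * \<mu> powr (- r)) * weight_measure ?h {0<..}"
        unfolding \<phi>(1) using C by (intro ennreal_mult') simp
      finally show ?thesis .
    qed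
  qed (rule C)
qed

section \<open>Interpolation\<close>

lemma monotone_ennreal_measurable:
  fixes f :: "real \<Rightarrow> ennreal"
  assumes "(\<forall>x y. x \<le> y \<longrightarrow> f x \<le> f y) \<or> (\<forall>x y. x \<le> y \<longrightarrow> f y \<le> f x)"
  shows "f \<in> borel_measurable borel"
proof (rule borel_measurableI_greater)
  fix y :: ennreal
  have "is_interval {x. y < f x}"
    unfolding is_interval_1
  proof (intro ballI allI impI, elim conjE)
    fix a b x assume "a \<in> {x. y < f x}" "b \<in> {x. y < f x}" "a \<le> x" "x \<le> b"
    then show "x \<in> {x. y < f x}" using assms by (auto intro: less_le_trans)
  qed
  then have "{x. y < f x} \<in> sets borel" by (rule real_interval_borel_measurable)
  then show "{x \<in> space borel. y < f x} \<in> sets borel" by simp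
qed

lemma monotone_ennreal_measurable_lebesgue:
  fixes f :: "real \<Rightarrow> ennreal"
  assumes "(\<forall>x y. x \<le> y \<longrightarrow> f x \<le> f y) \<or> (\<forall>x y. x \<le> y \<longrightarrow> f y \<le> f x)"
  shows "f \<in> borel_measurable lebesgue"
proof -
  have "f \<in> borel_measurable lborel" using monotone_ennreal_measurable[OF assms] by simp
  then show ?thesis by (rule measurable_completion)
qed

lemma average_op_measurable: "average_op f \<in> borel_measurable lebesgue"
proof -
  have "(\<lambda>t. weight_measure f {0<..<t}) \<in> borel_measurable lebesgue"
    by (rule monotone_ennreal_measurable_lebesgue) (auto intro!: weight_measure_subset)
  moreover have "(\<lambda>t::real. ennreal (1 / t)) \<in> borel_measurable lebesgue"
    by (rule measurable_completion) measurable
  ultimately show ?thesis unfolding average_op_def by (intro borel_measurable_times_ennreal)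
qed

lemma tail_op_measurable: "tail_op f \<in> borel_measurable lebesgue"
  unfolding tail_op_def
  by (rule monotone_ennreal_measurable_lebesgue) (auto intro!: weight_measure_subset)

lemma average_op_add:
  assumes "f \<in> borel_measurable lebesgue" "g \<in> borel_measurable lebesgue" "\<And>t. 0 \<le> f t" "\<And>t. 0 \<le> g t"
  shows "average_op (\<lambda>t. f t + g t) x = average_op f x + average_op g x"
  using assms by (simp add: average_op_def weight_measure_add distrib_left)

lemma tail_op_add:
  assumes f: "f \<in> borel_measurable lebesgue" "\<And>t. 0 \<le> f t" and g: "g \<in> borel_measurable lebesgue" "\<And>t. 0 \<le> g t" and x: "0 < x"
  shows "tail_op (\<lambda>t. f t + g t) x = tail_op f x + tail_op g x"
proof -
  have e: "tail_op h x = weight_measure (\<lambda>s. h s / \<bar>s\<bar>) {x<..}" for h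
    unfolding tail_op_def by (rule weight_measure_cong) (use x in auto)
  have m: "(\<lambda>s. h s / \<bar>s\<bar>) \<in> borel_measurable lebesgue" if "h \<in> borel_measurable lebesgue" for h :: "real \<Rightarrow> real"
  proof -
    have "(\<lambda>s::real. \<bar>s\<bar>) \<in> borel_measurable lebesgue" by (rule measurable_completion) measurable
    with that show ?thesis by (rule borel_measurable_divide)
  qed
  have "weight_measure (\<lambda>s. f s / \<bar>s\<bar> + g s / \<bar>s\<bar>) {x<..} = weight_measure (\<lambda>s. f s / \<bar>s\<bar>) {x<..} + weight_measure (\<lambda>s. g s / \<bar>s\<bar>) {x<..}"
    by (rule weight_measure_add) (use f g m in auto)
  then show ?thesis by (simp add: e add_divide_distrib)
qed

text \<open>Every a_k is at most A, so a_k^r \<le> A^(r-1) a_k. This pulls the exponent out of a sum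
  over layers and leaves the power of a sum that is linear in the terms.\<close>

lemma suminf_powr_le:
  fixes a :: "nat \<Rightarrow> real"
  assumes a: "\<And>k. 0 \<le> a k" "a sums A" and r: "1 \<le> r"
  shows "(\<Sum>k. ennreal (a k powr r)) \<le> ennreal (A powr r)"
proof -
  have aA: "a k \<le> A" for k
    using a sum_le_suminf[of a "{k}"] by (auto simp: sums_iff)
  have A: "0 \<le> A" using aA[of 0] a(1)[of 0] by simp
  have "a k powr r \<le> A powr (r - 1) * a k" for k
  proof -
    have "a k powr r = a k powr (r - 1) * a k"
      using a(1)[of k] by (cases "a k = 0") (auto simp: powr_diff)
    also have "\<dots> \<le> A powr (r - 1) * a k"
      using a(1)[of k] aA[of k] r by (intro mult_right_mono powr_mono2) auto
    finally show ?thesis .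
  qed
  then have "(\<Sum>k. ennreal (a k powr r)) \<le> (\<Sum>k. ennreal (A powr (r - 1) * a k))"
    by (intro suminf_le) (auto intro: ennreal_leI)
  also have "\<dots> = ennreal (A powr (r - 1) * A)"
    using a A by (intro suminf_ennreal_eq sums_mult) auto
  also have "A powr (r - 1) * A = A powr r" using A by (cases "A = 0") (auto simp: powr_diff)
  finally show ?thesis .
qed

text \<open>The assumptions on \<open>g\<close> say that it dominates the rearrangement of \<open>F\<close> with respect to \<open>w\<close>.\<close>

lemma rearrangement_split:
  fixes F g :: "real \<Rightarrow> real"
  assumes w: "w \<in> borel_measurable lebesgue" "\<And>t. 0 < w t"
    and F: "F \<in> borel_measurable lebesgue" "\<And>t. 0 \<le> F t"
    and g: "\<And>s. 0 < s \<Longrightarrow> 0 \<le> g s" "\<And>s. 0 < s \<Longrightarrow> weight_measure w {x. 0 < x \<and> g s < F x} \<le> ennreal s"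
    and t: "0 < t" and r: "1 \<le> r0" "1 \<le> r1"
    and A: "(\<lambda>k. 2 powr (- real k / r0) * g (t / 2 ^ Suc k)) sums A"
    and B: "(\<lambda>k. 2 powr (real (Suc k) / r1) * g (2 ^ k * t)) sums B"
  shows "weight_measure (\<lambda>x. (if g t < F x then F x else 0) powr r0 * w x) {0<..} \<le> ennreal (t * A powr r0)" (is ?A)
    and "weight_measure (\<lambda>x. (if g t < F x then 0 else F x) powr r1 * w x) {0<..} \<le> ennreal (t * B powr r1)" (is ?B)
proof -
  define E where "E s = {x. 0 < x \<and> g s < F x}" for s
  have E: "E s \<in> sets lebesgue" for s
  proof -
    have "F -` {g s<..} \<inter> space lebesgue \<in> sets lebesgue" using F(1) by (rule measurable_sets) simp
    then have "{0<..} \<inter> (F -` {g s<..} \<inter> space lebesgue) \<in> sets lebesgue" by (rule sets.Int[rotated]) simp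
    moreover have "E s = {0<..} \<inter> (F -` {g s<..} \<inter> space lebesgue)" by (auto simp: E_def)
    ultimately show ?thesis by simp
  qed
  have Es: "weight_measure w (E s) \<le> ennreal s" if "0 < s" for s using g(2)[OF that] by (simp add: E_def)
  have wE: "(\<lambda>x. ennreal (w x) * indicator S x) \<in> borel_measurable lebesgue" if "S \<in> sets lebesgue" for S
    using w that by (intro borel_measurable_times_ennreal borel_measurable_indicator) auto
  show ?A
  proof -
    define N where "N = (\<Inter>k. E (t / 2 ^ k))"
    have N: "N \<in> sets lebesgue" unfolding N_def using E by auto
    have N0: "weight_measure w N = 0"
    proof -
      have "weight_measure w N \<le> ennreal (t / 2 ^ k)" for k
      proof -
        have "weight_measure w N \<le> weight_measure w (E (t / 2 ^ k))" by (rule weight_measure_subset) (auto simp: N_def)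
        also have "\<dots> \<le> ennreal (t / 2 ^ k)" by (rule Es) (use t in simp)
        finally show ?thesis .
      qed
      moreover have "(\<lambda>k. ennreal (t / 2 ^ k)) \<longlonglongrightarrow> ennreal 0"
      proof (rule tendsto_ennrealI)
        have "(\<lambda>k. t * (1 / 2) ^ k) \<longlonglongrightarrow> t * 0" by (intro tendsto_mult tendsto_const LIMSEQ_power_zero) simp
        then show "(\<lambda>k. t / 2 ^ k) \<longlonglongrightarrow> 0" by (simp add: power_one_over)
      qed
      ultimately have "weight_measure w N \<le> ennreal 0" by (intro LIMSEQ_le_const) auto
      then show ?thesis by simp
    qed
    \<comment> \<open>The points where \<open>F\<close> exceeds all \<open>g (t / 2\<^sup>k)\<close> form the null set \<open>N\<close>; weighting it with \<open>\<infinity>\<close> makes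
      the following bound valid everywhere.\<close>
    let ?G = "\<lambda>k x. ennreal (g (t / 2 ^ Suc k) powr r0) * (ennreal (w x) * indicator (E (t / 2 ^ k)) x)"
    have pw: "ennreal ((if g t < F x then F x else 0) powr r0 * w x) * indicator {0<..} x
       \<le> (\<Sum>k. ?G k x) + \<infinity> * (ennreal (w x) * indicator N x)" for x
    proof (cases "0 < x \<and> g t < F x")
      case x: True
      show ?thesis
      proof (cases "x \<in> N")
        case True
        then have "\<infinity> * (ennreal (w x) * indicator N x) = \<infinity>" using w(2)[of x] by (simp add: ennreal_top_mult)
        then show ?thesis by simp
      next
        case False
        then obtain n where n: "F x \<le> g (t / 2 ^ n)" using x by (auto simp: N_def E_def not_less)
        define k where "k = (LEAST k. F x \<le> g (t / 2 ^ k))"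
        have k: "F x \<le> g (t / 2 ^ k)" unfolding k_def using n by (rule LeastI)
        then have "k \<noteq> 0" using x by (cases k) auto
        then obtain m where m: "k = Suc m" by (cases k) auto
        then have "\<not> F x \<le> g (t / 2 ^ m)" using not_less_Least[of m "\<lambda>k. F x \<le> g (t / 2 ^ k)"] by (auto simp: k_def)
        then have xE: "x \<in> E (t / 2 ^ m)" using x by (simp add: E_def)
        have "F x powr r0 \<le> g (t / 2 ^ Suc m) powr r0" using k m F(2)[of x] r by (intro powr_mono2) auto
        then have "ennreal (F x powr r0 * w x) \<le> ennreal (g (t / 2 ^ Suc m) powr r0 * w x)"
          using w(2)[of x] by (intro ennreal_leI mult_right_mono) auto
        also have "\<dots> = sum (\<lambda>k. ?G k x) {m}" using xE by (simp add: ennreal_mult')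
        also have "\<dots> \<le> (\<Sum>k. ?G k x)" by (rule sum_le_suminf) auto
        finally show ?thesis using x by (simp add: add_increasing2)
      qed
    qed auto
    have "weight_measure (\<lambda>x. (if g t < F x then F x else 0) powr r0 * w x) {0<..}
       \<le> (\<integral>\<^sup>+x. (\<Sum>k. ?G k x) + \<infinity> * (ennreal (w x) * indicator N x) \<partial>lebesgue)"
      unfolding weight_measure_def by (rule nn_integral_mono) (rule pw)
    also have "\<dots> = (\<Sum>k. \<integral>\<^sup>+x. ?G k x \<partial>lebesgue) + (\<integral>\<^sup>+x. \<infinity> * (ennreal (w x) * indicator N x) \<partial>lebesgue)"
    proof -
      have G: "?G k \<in> borel_measurable lebesgue" for k by (intro borel_measurable_times_ennreal wE E) auto
      then have "(\<lambda>x. \<Sum>k. ?G k x) \<in> borel_measurable lebesgue" by (rule borel_measurable_suminf_order)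
      moreover have "(\<lambda>x. \<infinity> * (ennreal (w x) * indicator N x)) \<in> borel_measurable lebesgue"
        by (intro borel_measurable_times_ennreal wE N) auto
      ultimately show ?thesis by (simp only: nn_integral_add nn_integral_suminf[OF G])
    qed
    also have "(\<integral>\<^sup>+x. \<infinity> * (ennreal (w x) * indicator N x) \<partial>lebesgue) = \<infinity> * weight_measure w N"
      unfolding weight_measure_def by (rule nn_integral_cmult) (rule wE[OF N])
    also have "\<dots> = 0" by (simp add: N0)
    also have "(\<Sum>k. \<integral>\<^sup>+x. ?G k x \<partial>lebesgue) = (\<Sum>k. ennreal (g (t / 2 ^ Suc k) powr r0) * weight_measure w (E (t / 2 ^ k)))"
      unfolding weight_measure_def by (intro arg_cong[where f = suminf] ext nn_integral_cmult wE E)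
    \<comment> \<open>On the k-th layer F is at most g (t / 2^(k+1)), while the layer has mass at
      most t / 2^k; the factor 2^(-k) moves under the power r0 as 2^(-k/r0).\<close>
    also have "\<dots> \<le> (\<Sum>k. ennreal t * ennreal ((2 powr (- real k / r0) * g (t / 2 ^ Suc k)) powr r0))"
    proof (rule suminf_le)
      fix k
      have "ennreal (g (t / 2 ^ Suc k) powr r0) * weight_measure w (E (t / 2 ^ k)) \<le> ennreal (g (t / 2 ^ Suc k) powr r0) * ennreal (t / 2 ^ k)"
        by (intro mult_left_mono Es) (use t in auto)
      also have "\<dots> = ennreal (g (t / 2 ^ Suc k) powr r0 * (t / 2 ^ k))" by (rule ennreal_mult'[symmetric]) simp
      also have "g (t / 2 ^ Suc k) powr r0 * (t / 2 ^ k) = t * (2 powr (- real k / r0) * g (t / 2 ^ Suc k)) powr r0"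
      proof -
        have "- real k / r0 * r0 = - real k" using r by simp
        then have "2 powr (- real k / r0 * r0) = 1 / 2 ^ k" by (simp only: powr_minus_divide powr_realpow)
        then show ?thesis using g(1)[of "t / 2 ^ Suc k"] t by (simp only: powr_mult powr_powr) simp
      qed
      also have "ennreal \<dots> = ennreal t * ennreal ((2 powr (- real k / r0) * g (t / 2 ^ Suc k)) powr r0)"
        by (rule ennreal_mult') (use t in simp)
      finally show "ennreal (g (t / 2 ^ Suc k) powr r0) * weight_measure w (E (t / 2 ^ k)) \<le>
        ennreal t * ennreal ((2 powr (- real k / r0) * g (t / 2 ^ Suc k)) powr r0)" .
    qed auto
    also have "\<dots> = ennreal t * (\<Sum>k. ennreal ((2 powr (- real k / r0) * g (t / 2 ^ Suc k)) powr r0))"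
      by (rule ennreal_suminf_cmult)
    also have "\<dots> \<le> ennreal t * ennreal (A powr r0)"
      by (intro mult_left_mono suminf_powr_le A r) (use t g in auto)
    also have "\<dots> = ennreal (t * A powr r0)" using t by (intro ennreal_mult'[symmetric]) simp
    finally show ?thesis by simp
  qed
  show ?B
  proof -
    let ?b = "\<lambda>k. 2 powr (real (Suc k) / r1) * g (2 ^ k * t)"
    have b0: "0 \<le> ?b k" for k using g(1)[of "2 ^ k * t"] t by simp
    have bB: "?b k \<le> B" for k
      using B sum_le_suminf[of ?b "{k}"] b0 by (auto simp: sums_iff)
    \<comment> \<open>Convergence of the second series forces g to 0 along the points 2^k t, so
      every x with F x > 0 in the lower part falls into some layer.\<close>
    have small: "\<exists>k. g (2 ^ k * t) < e" if e: "0 < e" for e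
    proof -
      have "?b \<longlonglongrightarrow> 0" using B by (auto simp: sums_iff dest: summable_LIMSEQ_zero)
      then have "eventually (\<lambda>k. ?b k < e) sequentially" using e by (rule order_tendstoD(2))
      then obtain k where k: "?b k < e" by (auto simp: eventually_sequentially)
      have "1 \<le> 2 powr (real (Suc k) / r1)" using r by (intro ge_one_powr_ge_zero) auto
      then have "1 * g (2 ^ k * t) \<le> ?b k" using g(1)[of "2 ^ k * t"] t by (intro mult_right_mono) auto
      with k show ?thesis by (intro exI[of _ k]) simp
    qed
    \<comment> \<open>The layer between the heights g (2^(k+1) t) and g (2^k t) has mass at most
      2^(k+1) t; this is the origin of \<open>Suc k\<close> in the coefficients of the second
      series.\<close>
    let ?G = "\<lambda>k x. ennreal (g (2 ^ k * t) powr r1) * (ennreal (w x) * indicator (E (2 ^ Suc k * t)) x)"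
    have pw: "ennreal ((if g t < F x then 0 else F x) powr r1 * w x) * indicator {0<..} x \<le> (\<Sum>k. ?G k x)" for x
    proof (cases "0 < x \<and> F x \<le> g t \<and> 0 < F x")
      case x: True
      obtain n where n: "g (2 ^ n * t) < F x" using small[of "F x"] x by blast
      define k where "k = (LEAST k. g (2 ^ k * t) < F x)"
      have k: "g (2 ^ k * t) < F x" unfolding k_def using n by (rule LeastI)
      then have "k \<noteq> 0" using x by (cases k) auto
      then obtain m where m: "k = Suc m" by (cases k) auto
      then have "\<not> g (2 ^ m * t) < F x" using not_less_Least[of m "\<lambda>k. g (2 ^ k * t) < F x"] by (auto simp: k_def)
      then have Fm: "F x \<le> g (2 ^ m * t)" by simp
      have xE: "x \<in> E (2 ^ Suc m * t)" using x k m by (simp add: E_def)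
      have "F x powr r1 \<le> g (2 ^ m * t) powr r1" using Fm x r by (intro powr_mono2) auto
      then have "ennreal (F x powr r1 * w x) \<le> ennreal (g (2 ^ m * t) powr r1 * w x)"
        using w(2)[of x] by (intro ennreal_leI mult_right_mono) auto
      also have "\<dots> = sum (\<lambda>k. ?G k x) {m}" using xE by (simp add: ennreal_mult')
      also have "\<dots> \<le> (\<Sum>k. ?G k x)" by (rule sum_le_suminf) auto
      finally show ?thesis using x by simp
    next
      case False
      then have z: "ennreal ((if g t < F x then 0 else F x) powr r1 * w x) * indicator {0<..} x = 0"
        using F(2)[of x] by (auto simp: indicator_def order.order_iff_strict)
      show ?thesis unfolding z by simp
    qed
    have "weight_measure (\<lambda>x. (if g t < F x then 0 else F x) powr r1 * w x) {0<..} \<le> (\<integral>\<^sup>+x. (\<Sum>k. ?G k x) \<partial>lebesgue)"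
      unfolding weight_measure_def by (rule nn_integral_mono) (rule pw)
    also have "\<dots> = (\<Sum>k. \<integral>\<^sup>+x. ?G k x \<partial>lebesgue)"
      by (rule nn_integral_suminf) (intro borel_measurable_times_ennreal wE E borel_measurable_const)
    also have "\<dots> = (\<Sum>k. ennreal (g (2 ^ k * t) powr r1) * weight_measure w (E (2 ^ Suc k * t)))"
      unfolding weight_measure_def by (intro arg_cong[where f = suminf] ext nn_integral_cmult wE E)
    also have "\<dots> \<le> (\<Sum>k. ennreal t * ennreal (?b k powr r1))"
    proof (rule suminf_le)
      fix k
      have "ennreal (g (2 ^ k * t) powr r1) * weight_measure w (E (2 ^ Suc k * t)) \<le> ennreal (g (2 ^ k * t) powr r1) * ennreal (2 ^ Suc k * t)"
        by (intro mult_left_mono Es) (use t in auto)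
      also have "\<dots> = ennreal (g (2 ^ k * t) powr r1 * (2 ^ Suc k * t))" by (rule ennreal_mult'[symmetric]) simp
      also have "g (2 ^ k * t) powr r1 * (2 ^ Suc k * t) = t * ?b k powr r1"
      proof -
        have "2 powr (real (Suc k) / r1 * r1) = 2 ^ Suc k" using r by (simp only: powr_realpow[symmetric]) simp
        then show ?thesis using g(1)[of "2 ^ k * t"] t by (simp only: powr_mult powr_powr mult_ac)
      qed
      also have "ennreal (t * ?b k powr r1) = ennreal t * ennreal (?b k powr r1)"
        by (rule ennreal_mult') (use t in simp)
      finally show "ennreal (g (2 ^ k * t) powr r1) * weight_measure w (E (2 ^ Suc k * t)) \<le> ennreal t * ennreal (?b k powr r1)" .
    qed auto
    also have "\<dots> = ennreal t * (\<Sum>k. ennreal (?b k powr r1))" by (rule ennreal_suminf_cmult)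
    also have "\<dots> \<le> ennreal t * ennreal (B powr r1)"
      by (intro mult_left_mono suminf_powr_le B r b0) auto
    also have "\<dots> = ennreal (t * B powr r1)" using t by (intro ennreal_mult'[symmetric]) simp
    finally show ?thesis .
  qed
qed

text \<open>F is cut at the height g t. By \<open>rearrangement_split\<close> the upper part has
  norm at most t^(1/r0) A in the weighted space with exponent r0, the lower part at most t^(1/r1) B
  with exponent r1. At levels above C A and C B the two weak types leave sets of mass at most t
  each, whence the bound 2 t.\<close>

lemma weak_type_interpolation:
  assumes w: "w \<in> borel_measurable lebesgue" "\<And>t. 0 < w t"
    and weak: "weak_type r0 w T" "weak_type r1 w T" and r: "1 \<le> r0" "1 \<le> r1"
    and Tm: "\<And>f. f \<in> borel_measurable lebesgue \<Longrightarrow> (\<And>t. 0 \<le> f t) \<Longrightarrow> T f \<in> borel_measurable lebesgue"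
    and Tadd: "\<And>f g x. f \<in> borel_measurable lebesgue \<Longrightarrow> (\<And>t. 0 \<le> f t) \<Longrightarrow> g \<in> borel_measurable lebesgue \<Longrightarrow> (\<And>t. 0 \<le> g t) \<Longrightarrow>
       0 < x \<Longrightarrow> T (\<lambda>t. f t + g t) x \<le> T f x + T g x"
  obtains C where "0 < C"
    "\<And>F g t A B y. F \<in> borel_measurable lebesgue \<Longrightarrow> (\<And>t. 0 \<le> F t) \<Longrightarrow> (\<And>s. 0 < s \<Longrightarrow> 0 \<le> g s) \<Longrightarrow>
       (\<And>s. 0 < s \<Longrightarrow> weight_measure w {x. 0 < x \<and> g s < F x} \<le> ennreal s) \<Longrightarrow> 0 < t \<Longrightarrow>
       (\<lambda>k. 2 powr (- real k / r0) * g (t / 2 ^ Suc k)) sums A \<Longrightarrow>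
       (\<lambda>k. 2 powr (real (Suc k) / r1) * g (2 ^ k * t)) sums B \<Longrightarrow> C * (A + B) < y \<Longrightarrow>
       weight_measure w {x. 0 < x \<and> ennreal y < T F x} \<le> ennreal (2 * t)"
proof -
  obtain C0 where C0: "0 < C0" "\<And>f \<mu>. f \<in> borel_measurable lebesgue \<Longrightarrow> (\<And>t. 0 \<le> f t) \<Longrightarrow> 0 < \<mu> \<Longrightarrow>
     weight_measure w {t. 0 < t \<and> ennreal \<mu> < T f t} \<le> ennreal (C0 * \<mu> powr (- r0)) * weight_measure (\<lambda>t. f t powr r0 * w t) {0<..}"
    using weak(1) unfolding weak_type_def by blast
  obtain C1 where C1: "0 < C1" "\<And>f \<mu>. f \<in> borel_measurable lebesgue \<Longrightarrow> (\<And>t. 0 \<le> f t) \<Longrightarrow> 0 < \<mu> \<Longrightarrow>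
     weight_measure w {t. 0 < t \<and> ennreal \<mu> < T f t} \<le> ennreal (C1 * \<mu> powr (- r1)) * weight_measure (\<lambda>t. f t powr r1 * w t) {0<..}"
    using weak(2) unfolding weak_type_def by blast
  \<comment> \<open>The roots make the constants homogeneous: a level \<mu> > C X satisfies c X^r
    \<le> \<mu>^r for either weak type constant c.\<close>
  define C where "C = max (C0 powr (1 / r0)) (C1 powr (1 / r1))"
  have C: "0 < C" "C0 powr (1 / r0) \<le> C" "C1 powr (1 / r1) \<le> C" using C0 by (auto simp: C_def less_max_iff_disj)
  have level: "c * \<mu> powr (- r) * (t * X powr r) \<le> t"
    if c: "0 < c" "c powr (1 / r) \<le> C" and X: "0 \<le> X" "C * X < \<mu>" and "1 \<le> r" "0 < t" for c \<mu> r t X :: real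
  proof -
    have "c powr (1 / r) * X \<le> C * X" using c X by (intro mult_right_mono) auto
    then have le: "c powr (1 / r) * X \<le> \<mu>" and \<mu>: "0 < \<mu>" using X C by (auto intro: le_less_trans[of 0 "C * X"])
    have "(c powr (1 / r) * X) powr r \<le> \<mu> powr r" using le c X that by (intro powr_mono2) auto
    then have "c * X powr r \<le> \<mu> powr r" using c X that by (simp add: powr_mult powr_powr)
    then have "c * X powr r * \<mu> powr (- r) * t \<le> \<mu> powr r * \<mu> powr (- r) * t" using that by (intro mult_right_mono) auto
    also have "\<dots> = t" using \<mu> by (simp add: powr_add[symmetric])
    finally show ?thesis by (simp add: mult_ac)
  qed
  show thesis
  proof (rule that[OF C(1)])
    fix F g :: "real \<Rightarrow> real" and t A B y :: real
    assume F: "F \<in> borel_measurable lebesgue" "\<And>t. 0 \<le> F t"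
      and g: "\<And>s. 0 < s \<Longrightarrow> 0 \<le> g s" "\<And>s. 0 < s \<Longrightarrow> weight_measure w {x. 0 < x \<and> g s < F x} \<le> ennreal s"
      and t: "0 < t" and A: "(\<lambda>k. 2 powr (- real k / r0) * g (t / 2 ^ Suc k)) sums A"
      and B: "(\<lambda>k. 2 powr (real (Suc k) / r1) * g (2 ^ k * t)) sums B" and y: "C * (A + B) < y"
    note split = rearrangement_split[OF w F g t r A B]
    have A0: "0 \<le> A" using A t g(1) by (intro sums_le[OF _ sums_zero A]) auto
    have B0: "0 \<le> B" using B t g(1) by (intro sums_le[OF _ sums_zero B]) auto
    define F0 where "F0 x = (if g t < F x then F x else 0)" for x
    define F1 where "F1 x = (if g t < F x then 0 else F x)" for x
    have Gset: "{x \<in> space lebesgue. g t < F x} \<in> sets lebesgue" using F(1) by measurable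
    have F0: "F0 \<in> borel_measurable lebesgue" "\<And>x. 0 \<le> F0 x"
      unfolding F0_def using F Gset by (auto intro!: measurable_If)
    have F1: "F1 \<in> borel_measurable lebesgue" "\<And>x. 0 \<le> F1 x"
      unfolding F1_def using F Gset by (auto intro!: measurable_If)
    \<comment> \<open>The slack of the strict inequality is shared equally, so that both levels are
      positive and strictly above their thresholds even if A or B is 0.\<close>
    define \<epsilon> where "\<epsilon> = (y - C * (A + B)) / 2"
    have \<epsilon>: "0 < \<epsilon>" using y by (simp add: \<epsilon>_def)
    define \<mu> \<nu> where "\<mu> = C * A + \<epsilon>" and "\<nu> = C * B + \<epsilon>"
    have \<mu>: "C * A < \<mu>" "C * B < \<nu>" "\<mu> + \<nu> = y" using \<epsilon> by (auto simp: \<mu>_def \<nu>_def \<epsilon>_def field_simps)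
    have pos: "0 < \<mu>" "0 < \<nu>" using \<epsilon> C A0 B0 by (auto simp: \<mu>_def \<nu>_def intro!: add_nonneg_pos)
    let ?E = "\<lambda>f \<mu>. {x. 0 < x \<and> ennreal \<mu> < T f x}"
    have Em: "?E f \<mu> \<in> sets lebesgue" if "f \<in> borel_measurable lebesgue" "\<And>t. 0 \<le> f t" for f \<mu>
    proof -
      have "T f -` {ennreal \<mu><..} \<inter> space lebesgue \<in> sets lebesgue" using Tm[OF that] by (rule measurable_sets) simp
      then have "{0<..} \<inter> (T f -` {ennreal \<mu><..} \<inter> space lebesgue) \<in> sets lebesgue" by (rule sets.Int[rotated]) simp
      moreover have "?E f \<mu> = {0<..} \<inter> (T f -` {ennreal \<mu><..} \<inter> space lebesgue)" by auto
      ultimately show ?thesis by simp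
    qed
    have sub: "?E F y \<subseteq> ?E F0 \<mu> \<union> ?E F1 \<nu>"
    proof clarify
      fix x assume x: "0 < x" "ennreal y < T F x" "\<not> ennreal \<nu> < T F1 x"
      have "F = (\<lambda>t. F0 t + F1 t)" by (auto simp: F0_def F1_def)
      then have "T F x \<le> T F0 x + T F1 x" using Tadd[OF F0 F1 x(1)] by simp
      moreover have "ennreal y = ennreal \<mu> + ennreal \<nu>" using pos \<mu>(3) by (simp add: ennreal_plus[symmetric] del: ennreal_plus)
      ultimately have "ennreal \<mu> + ennreal \<nu> < T F0 x + T F1 x" using x(2) by (metis less_le_trans)
      then show "ennreal \<mu> < T F0 x" using x(3) by (meson add_mono leD not_less)
    qed
    have "weight_measure w (?E F0 \<mu>) \<le> ennreal (C0 * \<mu> powr (- r0)) * ennreal (t * A powr r0)"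
      using C0(2)[OF F0 pos(1)] by (rule order_trans) (use split(1) in \<open>auto simp: F0_def intro!: mult_left_mono\<close>)
    also have "\<dots> = ennreal (C0 * \<mu> powr (- r0) * (t * A powr r0))" using C0 by (intro ennreal_mult'[symmetric]) auto
    also have "\<dots> \<le> ennreal t" by (intro ennreal_leI level C0 C A0 \<mu> r t)
    finally have 1: "weight_measure w (?E F0 \<mu>) \<le> ennreal t" .
    have "weight_measure w (?E F1 \<nu>) \<le> ennreal (C1 * \<nu> powr (- r1)) * ennreal (t * B powr r1)"
      using C1(2)[OF F1 pos(2)] by (rule order_trans) (use split(2) in \<open>auto simp: F1_def intro!: mult_left_mono\<close>)
    also have "\<dots> = ennreal (C1 * \<nu> powr (- r1) * (t * B powr r1))" using C1 by (intro ennreal_mult'[symmetric]) auto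
    also have "\<dots> \<le> ennreal t" by (intro ennreal_leI level C1 C B0 \<mu> r t)
    finally have 2: "weight_measure w (?E F1 \<nu>) \<le> ennreal t" .
    have "weight_measure w (?E F y) \<le> weight_measure w (?E F0 \<mu> \<union> ?E F1 \<nu>)" by (rule weight_measure_subset[OF sub])
    also have "\<dots> = weight_measure w (?E F0 \<mu> \<union> (?E F1 \<nu> - ?E F0 \<mu>))" by (rule arg_cong[where f = "weight_measure w"]) blast
    also have "\<dots> = weight_measure w (?E F0 \<mu>) + weight_measure w (?E F1 \<nu> - ?E F0 \<mu>)"
      by (rule weight_measure_Un) (use w Em[OF F0] Em[OF F1] in auto)
    also have "\<dots> \<le> ennreal t + ennreal t"
      by (rule add_mono[OF 1 order_trans[OF weight_measure_subset 2]]) auto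
    also have "\<dots> = ennreal (2 * t)" using t by (simp add: ennreal_plus[symmetric] del: ennreal_plus)
    finally show "weight_measure w (?E F y) \<le> ennreal (2 * t)" .
  qed
qed

section \<open>Rearrangements\<close>

lemma rearrangement_antimono: "s \<le> t \<Longrightarrow> rearrangement w f t \<le> rearrangement w f s"
  unfolding rearrangement_def by (rule Inf_superset_mono) (clarify, metis ennreal_leI order_trans)

lemma rearrangement_measurable: "rearrangement w f \<in> borel_measurable lebesgue"
  by (rule monotone_ennreal_measurable_lebesgue) (auto intro: rearrangement_antimono)

lemma rearrangement_leI:
  assumes "0 \<le> y" "\<And>r. y < r \<Longrightarrow> distribution_fun w f r \<le> ennreal t"
  shows "rearrangement w f t \<le> ennreal y"
proof (rule ennreal_le_epsilon)
  fix e :: real assume e: "0 < e"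
  have "rearrangement w f t \<le> ennreal (y + e)"
    unfolding rearrangement_def by (rule Inf_lower, rule CollectI, rule exI[of _ "y + e"]) (use e assms in simp)
  then show "rearrangement w f t \<le> ennreal y + ennreal e" using e assms(1) by simp
qed

text \<open>A finite infimum is itself admissible: the set where \<open>norm (f x)\<close> exceeds y
  is the increasing union of the sets for y + 1/n, each of mass at most t.\<close>

lemma distribution_fun_rearrangement:
  assumes w: "weight w" and f: "f \<in> measurable_funs" and y: "rearrangement w f t = ennreal y" "0 \<le> y"
  shows "distribution_fun w f y \<le> ennreal t"
proof -
  define E where "E n = {x. 0 < x \<and> y + 1 / real (Suc n) < norm (f x)}" for n
  have Ele: "weight_measure w (E n) \<le> ennreal t" for n
  proof -
    have "Inf {ennreal r |r. 0 < r \<and> distribution_fun w f r \<le> ennreal t} < ennreal (y + 1 / real (Suc n))"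
      using y unfolding rearrangement_def by (simp add: ennreal_less_iff)
    then obtain r where r: "0 < r" "distribution_fun w f r \<le> ennreal t" "ennreal r < ennreal (y + 1 / real (Suc n))"
      by (auto simp: Inf_less_iff)
    then have "r < y + 1 / real (Suc n)" by (simp add: ennreal_less_iff)
    then have "weight_measure w (E n) \<le> distribution_fun w f r"
      unfolding distribution_fun_def E_def by (intro weight_measure_subset) auto
    with r show ?thesis by simp
  qed
  have inc: "incseq E"
  proof (rule incseq_SucI)
    fix n
    have "1 / real (Suc (Suc n)) \<le> 1 / real (Suc n)" by (simp add: frac_le)
    then show "E n \<le> E (Suc n)" by (auto simp: E_def)
  qed
  have Em: "E n \<in> sets lebesgue" for n
  proof -
    have "(\<lambda>x. norm (f x)) \<in> borel_measurable half_line" using f by measurable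
    then have "(\<lambda>x. norm (f x)) -` {y + 1 / real (Suc n)<..} \<inter> space half_line \<in> sets half_line" by (rule measurable_sets) simp
    then have "(\<lambda>x. norm (f x)) -` {y + 1 / real (Suc n)<..} \<inter> {0..} \<in> sets lebesgue"
      by (simp add: sets_restrict_space_iff space_restrict_space)
    then have "{0<..} \<inter> ((\<lambda>x. norm (f x)) -` {y + 1 / real (Suc n)<..} \<inter> {0..}) \<in> sets lebesgue" by (rule sets.Int[rotated]) simp
    moreover have "E n = {0<..} \<inter> ((\<lambda>x. norm (f x)) -` {y + 1 / real (Suc n)<..} \<inter> {0..})" by (auto simp: E_def)
    ultimately show ?thesis by simp
  qed
  let ?W = "extend_weight w"
  have WE: "weight_measure ?W (E n) = weight_measure w (E n)" for n
    by (rule weight_measure_extend) (auto simp: E_def)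
  have "{x. 0 < x \<and> y < norm (f x)} = (\<Union>n. E n)"
  proof (intro equalityI subsetI)
    fix x assume x: "x \<in> {x. 0 < x \<and> y < norm (f x)}"
    then obtain n where "inverse (real (Suc n)) < norm (f x) - y" using reals_Archimedean[of "norm (f x) - y"] by auto
    then show "x \<in> (\<Union>n. E n)" using x by (auto simp: E_def inverse_eq_divide intro!: exI[of _ n])
  next
    fix x assume "x \<in> (\<Union>n. E n)"
    then obtain n where "0 < x" "y + 1 / real (Suc n) < norm (f x)" by (auto simp: E_def)
    moreover have "0 < 1 / real (Suc n)" by simp
    ultimately have "0 < x" "y < norm (f x)" by linarith+
    then show "x \<in> {x. 0 < x \<and> y < norm (f x)}" by simp
  qed
  then have "distribution_fun w f y = weight_measure ?W (\<Union>n. E n)"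
    unfolding distribution_fun_def by (subst weight_measure_extend) (auto simp: E_def)
  also have "\<dots> = (SUP n. weight_measure ?W (E n))"
  proof -
    have "(SUP n. emeasure (density lebesgue (\<lambda>t. ennreal (?W t))) (E n)) = emeasure (density lebesgue (\<lambda>t. ennreal (?W t))) (\<Union>n. E n)"
      by (rule SUP_emeasure_incseq) (use Em inc in auto)
    then show ?thesis using Em extend_weight_measurable[OF w] by (simp add: weight_measure_eq_emeasure)
  qed
  also have "\<dots> \<le> ennreal t" by (rule SUP_least) (simp add: WE Ele)
  finally show ?thesis .
qed

section \<open>Dilations and Boyd indices\<close>

lemma (in banach_function_norm) norm_cong_AE:
  assumes "f \<in> borel_measurable M" "g \<in> borel_measurable M" "AE x in M. f x = g x"
  shows "\<rho> f = \<rho> g"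
  using assms by (intro antisym norm_mono) auto

text \<open>The Fatou property upgrades the triangle inequality to countable sums, as the sums of
  dilations require.\<close>

lemma (in banach_function_norm) norm_suminf_le:
  assumes f: "\<And>k::nat. f k \<in> borel_measurable M"
  shows "\<rho> (\<lambda>x. \<Sum>k. f k x) \<le> (\<Sum>k. \<rho> (f k))"
proof -
  define S where "S n x = (\<Sum>k<n. f k x)" for n x
  have S: "S n \<in> borel_measurable M" for n unfolding S_def using f by measurable
  have le: "\<rho> (S n) \<le> (\<Sum>k<n. \<rho> (f k))" for n
  proof (induction n)
    case 0
    have "\<rho> (S 0) = 0" by (subst norm_eq_0_iff[OF S]) (simp add: S_def)
    then show ?case by simp
  next
    case (Suc n)
    have "S (Suc n) = (\<lambda>x. S n x + f n x)" by (simp add: S_def fun_eq_iff)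
    then have "\<rho> (S (Suc n)) = \<rho> (\<lambda>x. S n x + f n x)" by (rule arg_cong)
    also have "\<dots> \<le> \<rho> (S n) + \<rho> (f n)" by (rule norm_triangle[OF S f])
    also have "\<dots> \<le> (\<Sum>k<n. \<rho> (f k)) + \<rho> (f n)" by (rule add_right_mono[OF Suc])
    finally show ?case by simp
  qed
  have "\<rho> (\<lambda>x. \<Sum>k. f k x) = (SUP n. \<rho> (S n))"
  proof (rule norm_Fatou[OF S])
    show "(\<lambda>x. \<Sum>k. f k x) \<in> borel_measurable M" using f by (rule borel_measurable_suminf_order)
    show "AE x in M. incseq (\<lambda>n. S n x) \<and> (\<Sum>k. f k x) = (SUP n. S n x)"
      by (intro AE_I2 conjI incseq_SucI) (auto simp: S_def suminf_eq_SUP)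
  qed
  also have "\<dots> \<le> (\<Sum>k. \<rho> (f k))"
    by (rule SUP_least, rule order_trans[OF le]) (auto intro: sum_le_suminf)
  finally show ?thesis .
qed

lemma AE_half_line_pos: "AE t in half_line. 0 < t"
proof -
  have "AE t in lebesgue. t \<notin> {0::real}"
    by (rule AE_lebesgue_notin_finite) simp
  then have "AE t in lebesgue. t \<in> {0::real..} \<longrightarrow> 0 < t" by (rule eventually_mono) auto
  then show ?thesis by (subst AE_restrict_space_iff) auto
qed

lemma half_line_measurable: "f \<in> borel_measurable lebesgue \<Longrightarrow> f \<in> borel_measurable half_line"
  by (rule measurable_restrict_space1)

lemma half_line_norm_finite_integral:
  assumes \<rho>: "banach_function_norm half_line \<rho>" and f: "f \<in> borel_measurable half_line" "\<rho> f < \<infinity>" and a: "0 \<le> a"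
  shows "(\<integral>\<^sup>+x\<in>{0..a}. f x \<partial>half_line) < \<infinity>"
proof -
  have s: "{0..a} \<in> sets half_line" by (subst sets_restrict_space_iff) auto
  have "emeasure half_line {0..a} < \<infinity>" using a by (subst emeasure_restrict_space) auto
  then obtain C :: real where "(\<integral>\<^sup>+x\<in>{0..a}. f x \<partial>half_line) \<le> ennreal C * \<rho> f"
    using banach_function_norm.norm_local_integral[OF \<rho> s] f(1) by blast
  also have "\<dots> < \<infinity>" using f(2) by (simp add: ennreal_mult_less_top)
  finally show ?thesis .
qed

lemma half_line_infinite_integral:
  assumes a: "0 < a" and f: "\<And>x. 0 < x \<Longrightarrow> x \<le> a \<Longrightarrow> f x = \<infinity>"
  shows "(\<integral>\<^sup>+x\<in>{0..a}. f x \<partial>half_line) = \<infinity>"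
proof -
  have s: "{0..a} \<in> sets half_line" by (subst sets_restrict_space_iff) auto
  have "\<infinity> * emeasure half_line {0..a} = (\<integral>\<^sup>+x. \<infinity> * indicator {0..a} x \<partial>half_line)"
    by (rule nn_integral_cmult_indicator[OF s, symmetric])
  also have "\<dots> \<le> (\<integral>\<^sup>+x\<in>{0..a}. f x \<partial>half_line)"
    using AE_half_line_pos
    by (intro nn_integral_mono_AE, elim AE_mp) (auto intro!: AE_I2 simp: indicator_def f)
  also have "emeasure half_line {0..a} = ennreal a" using a by (subst emeasure_restrict_space) auto
  finally show ?thesis using a by (simp add: ennreal_top_mult top_unique)
qed

definition decreasing_fun :: "(real \<Rightarrow> ennreal) \<Rightarrow> bool" where
  "decreasing_fun G \<longleftrightarrow> (\<forall>s t. s \<le> t \<longrightarrow> G t \<le> G s)"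

lemma decreasing_fun_measurable: "decreasing_fun G \<Longrightarrow> G \<in> borel_measurable half_line"
  unfolding decreasing_fun_def by (intro half_line_measurable monotone_ennreal_measurable_lebesgue) blast

lemma decreasing_fun_scale: "decreasing_fun G \<Longrightarrow> 0 \<le> c \<Longrightarrow> decreasing_fun (\<lambda>t. G (c * t))"
  unfolding decreasing_fun_def by (simp add: mult_left_mono)

text \<open>An infinite value at t would spread over (0, t], but functions of finite norm are
  integrable on bounded sets.\<close>

lemma decreasing_fun_finite:
  assumes \<rho>: "banach_function_norm half_line \<rho>" and G: "decreasing_fun G" "\<rho> G < \<infinity>" and t: "0 < t"
  shows "G t < \<infinity>"
proof (rule ccontr)
  assume "\<not> G t < \<infinity>"
  then have Gt: "G t = \<infinity>" by (simp add: not_less top_unique)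
  have "G x = \<infinity>" if "x \<le> t" for x
  proof -
    have "G t \<le> G x" using G(1) that by (simp add: decreasing_fun_def)
    then show ?thesis using Gt by (simp add: top_unique)
  qed
  then have "(\<integral>\<^sup>+x\<in>{0..t}. G x \<partial>half_line) = \<infinity>" by (intro half_line_infinite_integral t)
  then show False
    using half_line_norm_finite_integral[OF \<rho> decreasing_fun_measurable[OF G(1)] G(2), of t] t by simp
qed

text \<open>The supremum in \<open>dilation_norm\<close> runs over complex functions, whereas G
  takes values in [0, \<infinity>]. A decreasing G of finite norm is finite on (0, \<infinity>), so
  its normalised multiples can be read as members of the unit ball.\<close>

lemma dilation_norm_bound:
  assumes \<rho>: "banach_function_norm half_line \<rho>" and G: "decreasing_fun G" "\<rho> G < \<infinity>"
    and \<tau>: "0 < \<tau>" and H: "dilation_norm \<rho> \<tau> \<le> ennreal H" "0 \<le> H"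
  shows "\<rho> (\<lambda>t. G (t / \<tau>)) \<le> ennreal H * \<rho> G"
proof -
  interpret banach_function_norm half_line \<rho> by fact
  have Gm: "G \<in> borel_measurable half_line" by (rule decreasing_fun_measurable[OF G(1)])
  have "decreasing_fun (\<lambda>t. G (1 / \<tau> * t))" by (rule decreasing_fun_scale[OF G(1)]) (use \<tau> in simp)
  then have Gm': "(\<lambda>t. G (t / \<tau>)) \<in> borel_measurable half_line" using decreasing_fun_measurable by force
  have fin: "G t < \<infinity>" if "0 < t" for t by (rule decreasing_fun_finite[OF \<rho> G that])
  let ?N = "\<rho> G" and ?D = "\<rho> (\<lambda>t. G (t / \<tau>))"
  have key: "ennreal c * ?D \<le> ennreal H" if c: "0 \<le> c" "ennreal c * ?N \<le> 1" for c
  proof -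
    define \<psi> where "\<psi> t = complex_of_real (c * enn2real (G t))" for t
    have nG: "ennreal (norm (\<psi> t)) = ennreal c * G t" if "0 < t" for t
      using fin[OF that] c by (simp add: \<psi>_def norm_mult ennreal_mult')
    have \<psi>m: "\<psi> \<in> measurable_funs"
    proof -
      have "(\<lambda>t. enn2real (G t)) \<in> borel_measurable half_line" using Gm by measurable
      then show ?thesis unfolding \<psi>_def by measurable
    qed
    have "space_norm \<rho> \<psi> = \<rho> (\<lambda>t. ennreal c * G t)"
      unfolding space_norm_def
    proof (rule norm_cong_AE)
      show "(\<lambda>t. ennreal (norm (\<psi> t))) \<in> borel_measurable half_line" using \<psi>m by measurable
      show "(\<lambda>t. ennreal c * G t) \<in> borel_measurable half_line" using Gm by measurable
      show "AE t in half_line. ennreal (norm (\<psi> t)) = ennreal c * G t"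
        using AE_half_line_pos by (rule AE_mp) (auto intro!: AE_I2 nG)
    qed
    also have "\<dots> = ennreal c * ?N" by (rule norm_scale[OF Gm c(1)])
    finally have "space_norm \<rho> \<psi> \<le> 1" using c by simp
    then have "space_norm \<rho> (dilation \<tau> \<psi>) \<le> dilation_norm \<rho> \<tau>"
      unfolding dilation_norm_def by (intro SUP_upper) (use \<psi>m in auto)
    also note H(1)
    finally have le: "space_norm \<rho> (dilation \<tau> \<psi>) \<le> ennreal H" .
    have "ennreal c * ?D = \<rho> (\<lambda>t. ennreal c * G (t / \<tau>))" by (rule norm_scale[OF Gm' c(1), symmetric])
    also have "\<dots> = space_norm \<rho> (dilation \<tau> \<psi>)"
      unfolding space_norm_def dilation_def
    proof (rule norm_cong_AE)
      show "(\<lambda>t. ennreal c * G (t / \<tau>)) \<in> borel_measurable half_line" using Gm' by measurable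
      have "(\<lambda>t. enn2real (G (t / \<tau>))) \<in> borel_measurable half_line" using Gm' by measurable
      then have "(\<lambda>t. \<psi> (t / \<tau>)) \<in> borel_measurable half_line" unfolding \<psi>_def by measurable
      then show "(\<lambda>t. ennreal (norm (\<psi> (t / \<tau>)))) \<in> borel_measurable half_line" by measurable
      show "AE t in half_line. ennreal c * G (t / \<tau>) = ennreal (norm (\<psi> (t / \<tau>)))"
        using AE_half_line_pos by (rule AE_mp) (use \<tau> in \<open>auto intro!: AE_I2 nG[symmetric]\<close>)
    qed
    finally show ?thesis using le by simp
  qed
  define n where "n = enn2real ?N"
  have n: "?N = ennreal n" "0 \<le> n" using G(2) by (auto simp: n_def)
  show ?thesis
  proof (cases "n = 0")
    case False
    then have n0: "0 < n" using n by simp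
    have "ennreal (1 / n) * ?D \<le> ennreal H" by (rule key) (use n0 in \<open>auto simp: n(1) ennreal_mult'[symmetric]\<close>)
    then have "ennreal n * (ennreal (1 / n) * ?D) \<le> ennreal n * ennreal H" by (rule mult_left_mono) simp
    moreover have "ennreal n * (ennreal (1 / n) * ?D) = ?D"
      using n0 by (simp add: mult.assoc[symmetric] ennreal_mult'[symmetric])
    ultimately show ?thesis by (simp add: n(1) mult.commute)
  next
    \<comment> \<open>For norm 0 every multiple of G lies in the unit ball, so all multiples of the
      norm of the dilate stay below H, and that norm vanishes.\<close>
    case True
    have k: "ennreal c * ?D \<le> ennreal H" if "0 \<le> c" for c by (rule key) (use that True n in auto)
    have "?D = 0"
    proof (rule ccontr)
      assume D: "?D \<noteq> 0"
      have "?D \<le> ennreal H" using k[of 1] by simp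
      then have "?D < \<infinity>" by (rule le_less_trans) simp
      then obtain d where d: "?D = ennreal d" "0 < d" using D
        by (cases ?D) (auto simp: order.order_iff_strict)
      have "ennreal ((H + 1) / d) * ?D \<le> ennreal H" by (rule k) (use d H in auto)
      then have "ennreal (H + 1) \<le> ennreal H" using d H by (simp add: ennreal_mult'[symmetric])
      then show False using H by (simp add: ennreal_le_iff)
    qed
    then show ?thesis by simp
  qed
qed

section \<open>Boyd indices and dilations by powers of two\<close>

lemma boyd_index_p_bound:
  assumes "has_boyd_index_p \<rho> p" "0 < r" "r < p"
  obtains \<tau>0 where "1 < \<tau>0" "\<And>\<tau>. \<tau>0 \<le> \<tau> \<Longrightarrow> dilation_norm \<rho> \<tau> \<le> ennreal (\<tau> powr (1 / r))"
proof -
  let ?x = "\<lambda>\<tau>. enn2real (dilation_norm \<rho> \<tau>)"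
  have "eventually (\<lambda>\<tau>. r < ln \<tau> / ln (?x \<tau>)) at_top"
    using assms(1,3) unfolding has_boyd_index_p_def by (rule order_tendstoD(1))
  then obtain \<tau>1 where \<tau>1: "\<And>\<tau>. \<tau>1 \<le> \<tau> \<Longrightarrow> r < ln \<tau> / ln (?x \<tau>)" by (auto simp: eventually_at_top_linorder)
  show thesis
  proof (rule that[of "max \<tau>1 2"])
    fix \<tau> assume "max \<tau>1 2 \<le> \<tau>"
    then have \<tau>: "1 < \<tau>" and lt: "r < ln \<tau> / ln (?x \<tau>)" using \<tau>1[of \<tau>] by auto
    have l\<tau>: "0 < ln \<tau>" using \<tau> by simp
    have lx: "0 < ln (?x \<tau>)"
    proof (rule ccontr)
      assume "\<not> ?thesis"
      then have "ln \<tau> / ln (?x \<tau>) \<le> 0" using l\<tau> by (intro divide_nonneg_nonpos) auto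
      with lt assms(2) show False by simp
    qed
    \<comment> \<open>By the default values \<open>ln 0 = 0\<close> and 0 for
      \<open>enn2real\<close> at infinity, a positive logarithm excludes both a vanishing and an
      infinite dilation norm.\<close>
    then have x: "?x \<tau> \<noteq> 0" by auto
    then have xpos: "0 < ?x \<tau>" by (simp add: order.not_eq_order_implies_strict)
    have fin: "dilation_norm \<rho> \<tau> < \<infinity>" using x by (cases "dilation_norm \<rho> \<tau>") auto
    have "r * ln (?x \<tau>) < ln \<tau>" using lt lx by (simp add: pos_less_divide_eq)
    then have "ln (?x \<tau>) \<le> ln (\<tau> powr (1 / r))" using assms(2) \<tau> by (simp add: ln_powr field_simps)
    then have "?x \<tau> \<le> \<tau> powr (1 / r)" using xpos \<tau> by (subst (asm) ln_le_cancel_iff) auto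
    then have "ennreal (?x \<tau>) \<le> ennreal (\<tau> powr (1 / r))" by (rule ennreal_leI)
    then show "dilation_norm \<rho> \<tau> \<le> ennreal (\<tau> powr (1 / r))"
      using fin by (simp only: ennreal_enn2real infinity_ennreal_def)
  qed simp
qed

lemma boyd_index_q_bound:
  assumes "has_boyd_index_q \<rho> q" "0 < q" "q < s"
  obtains \<tau>0 where "0 < \<tau>0" "\<And>\<tau>. 0 < \<tau> \<Longrightarrow> \<tau> \<le> \<tau>0 \<Longrightarrow> dilation_norm \<rho> \<tau> \<le> ennreal (\<tau> powr (1 / s))"
proof -
  let ?x = "\<lambda>\<tau>. enn2real (dilation_norm \<rho> \<tau>)"
  have "eventually (\<lambda>\<tau>. 0 < ln \<tau> / ln (?x \<tau>)) (at_right 0)" "eventually (\<lambda>\<tau>. ln \<tau> / ln (?x \<tau>) < s) (at_right 0)"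
    using assms unfolding has_boyd_index_q_def by (auto intro: order_tendstoD)
  then have "eventually (\<lambda>\<tau>. 0 < ln \<tau> / ln (?x \<tau>) \<and> ln \<tau> / ln (?x \<tau>) < s) (at_right 0)" by (rule eventually_conj)
  then obtain \<tau>1 where \<tau>1: "0 < \<tau>1" "\<And>\<tau>. 0 < \<tau> \<Longrightarrow> \<tau> < \<tau>1 \<Longrightarrow> 0 < ln \<tau> / ln (?x \<tau>) \<and> ln \<tau> / ln (?x \<tau>) < s"
    unfolding eventually_at_right_field by auto
  show thesis
  proof (rule that[of "min (\<tau>1 / 2) (1 / 2)"])
    fix \<tau> assume \<tau>0: "0 < \<tau>" "\<tau> \<le> min (\<tau>1 / 2) (1 / 2)"
    then have \<tau>: "0 < \<tau>" "\<tau> < 1" and lt: "0 < ln \<tau> / ln (?x \<tau>)" "ln \<tau> / ln (?x \<tau>) < s" using \<tau>1 by auto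
    have l\<tau>: "ln \<tau> < 0" using \<tau> by simp
    \<comment> \<open>The quotient is positive near 0 because q > 0; this fixes the sign of the
      logarithm by which the inequality is multiplied.\<close>
    have lx: "ln (?x \<tau>) < 0" using lt(1) l\<tau> by (auto simp: zero_less_divide_iff)
    then have x: "?x \<tau> \<noteq> 0" by auto
    then have xpos: "0 < ?x \<tau>" by (simp add: order.not_eq_order_implies_strict)
    have fin: "dilation_norm \<rho> \<tau> < \<infinity>" using x by (cases "dilation_norm \<rho> \<tau>") auto
    have "s * ln (?x \<tau>) < ln \<tau>" using lt(2) lx by (simp add: neg_divide_less_eq)
    then have "ln (?x \<tau>) \<le> ln (\<tau> powr (1 / s))" using assms(2,3) \<tau> by (simp add: ln_powr field_simps)
    then have "?x \<tau> \<le> \<tau> powr (1 / s)" using xpos \<tau> by (subst (asm) ln_le_cancel_iff) auto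
    then have "ennreal (?x \<tau>) \<le> ennreal (\<tau> powr (1 / s))" by (rule ennreal_leI)
    then show "dilation_norm \<rho> \<tau> \<le> ennreal (\<tau> powr (1 / s))"
      using fin by (simp only: ennreal_enn2real infinity_ennreal_def)
  qed (use \<tau>1 in auto)
qed

text \<open>
  The Boyd index bounds \<open>h\<close> only for large dilations. Smaller ones need no separate estimate, as \<open>G\<close> is
  decreasing and a further fixed dilation makes it larger.
\<close>

lemma dilation_bound_up:
  assumes \<rho>: "banach_function_norm half_line \<rho>" and p: "has_boyd_index_p \<rho> p" "0 < r" "r < p"
  obtains K :: real where "0 < K"
    "\<And>G j. decreasing_fun G \<Longrightarrow> \<rho> G < \<infinity> \<Longrightarrow> \<rho> (\<lambda>t. G (t / 2 ^ j)) \<le> ennreal (K * 2 powr (real j / r)) * \<rho> G"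
proof -
  interpret banach_function_norm half_line \<rho> by fact
  obtain \<tau>0 where \<tau>0: "1 < \<tau>0" "\<And>\<tau>. \<tau>0 \<le> \<tau> \<Longrightarrow> dilation_norm \<rho> \<tau> \<le> ennreal (\<tau> powr (1 / r))"
    using boyd_index_p_bound[OF p] by blast
  obtain J where J: "\<tau>0 < 2 ^ J" using real_arch_pow[of 2 \<tau>0] by auto
  show thesis
  proof (rule that[of "2 powr (real J / r)"])
    fix G :: "real \<Rightarrow> ennreal" and j :: nat assume G: "decreasing_fun G" "\<rho> G < \<infinity>"
    have Gm: "(\<lambda>t. G (t / 2 ^ i)) \<in> borel_measurable half_line" for i
      using decreasing_fun_measurable[OF decreasing_fun_scale[OF G(1), of "1 / 2 ^ i"]] by simp
    have "(2::real) ^ J \<le> 2 ^ (j + J)" by (intro power_increasing) auto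
    then have \<tau>: "\<tau>0 \<le> 2 ^ (j + J)" by (rule order_trans[OF less_imp_le[OF J]])
    have "\<rho> (\<lambda>t. G (t / 2 ^ j)) \<le> \<rho> (\<lambda>t. G (t / 2 ^ (j + J)))"
    proof (rule norm_mono[OF Gm Gm])
      show "AE t in half_line. G (t / 2 ^ j) \<le> G (t / 2 ^ (j + J))"
        using AE_half_line_pos
      proof (rule AE_mp, intro AE_I2 impI)
        fix t :: real assume t: "0 < t"
        have "t / 2 ^ (j + J) \<le> t / 2 ^ j" using t by (intro divide_left_mono) (auto intro: power_increasing)
        then show "G (t / 2 ^ j) \<le> G (t / 2 ^ (j + J))" using G(1) by (simp add: decreasing_fun_def)
      qed
    qed
    also have "\<dots> \<le> ennreal ((2 ^ (j + J)) powr (1 / r)) * \<rho> G"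
      by (rule dilation_norm_bound[OF \<rho> G _ \<tau>0(2)[OF \<tau>]]) auto
    also have "(2 ^ (j + J)) powr (1 / r) = 2 powr (real J / r) * 2 powr (real j / r)"
    proof -
      have "(2 ^ (j + J) :: real) = 2 powr real (j + J)" by (rule powr_realpow[symmetric]) simp
      then show ?thesis by (simp only: powr_powr powr_add[symmetric]) (simp add: add_divide_distrib add.commute)
    qed
    finally show "\<rho> (\<lambda>t. G (t / 2 ^ j)) \<le> ennreal (2 powr (real J / r) * 2 powr (real j / r)) * \<rho> G" .
  qed simp
qed

text \<open>The function G (2^j t) is the dilate of the larger function G (t / 2^J) by the factor
  2^(-(j+J)), which is small enough for the index q. The norm of G (t / 2^J) is controlled by
  \<open>dilation_bound_up\<close>; this is where the index p enters.\<close>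

lemma dilation_bound_down:
  assumes \<rho>: "banach_function_norm half_line \<rho>" and p: "has_boyd_index_p \<rho> p" "0 < r" "r < p"
    and q: "has_boyd_index_q \<rho> q" "0 < q" "q < s"
  obtains K :: real where "0 < K"
    "\<And>G j. decreasing_fun G \<Longrightarrow> \<rho> G < \<infinity> \<Longrightarrow> \<rho> (\<lambda>t. G (2 ^ j * t)) \<le> ennreal (K * 2 powr (- real j / s)) * \<rho> G"
proof -
  obtain \<tau>0 where \<tau>0: "0 < \<tau>0" "\<And>\<tau>. 0 < \<tau> \<Longrightarrow> \<tau> \<le> \<tau>0 \<Longrightarrow> dilation_norm \<rho> \<tau> \<le> ennreal (\<tau> powr (1 / s))"
    using boyd_index_q_bound[OF q] by blast
  obtain L where L: "0 < L"
    "\<And>G j. decreasing_fun G \<Longrightarrow> \<rho> G < \<infinity> \<Longrightarrow> \<rho> (\<lambda>t. G (t / 2 ^ j)) \<le> ennreal (L * 2 powr (real j / r)) * \<rho> G"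
    using dilation_bound_up[OF \<rho> p] by blast
  obtain J where J: "1 / \<tau>0 < 2 ^ J" using real_arch_pow[of 2 "1 / \<tau>0"] by auto
  define K where "K = 2 powr (- real J / s) * (L * 2 powr (real J / r))"
  show thesis
  proof (rule that[of K])
    show "0 < K" using L by (simp add: K_def)
    fix G :: "real \<Rightarrow> ennreal" and j :: nat assume G: "decreasing_fun G" "\<rho> G < \<infinity>"
    let ?G = "\<lambda>t. G (t / 2 ^ J)" and ?\<tau> = "1 / 2 ^ (j + J) :: real"
    have G': "decreasing_fun ?G" using decreasing_fun_scale[OF G(1), of "1 / 2 ^ J"] by simp
    have le: "\<rho> ?G \<le> ennreal (L * 2 powr (real J / r)) * \<rho> G" by (rule L(2)[OF G])
    also have "\<dots> < \<infinity>" using G(2) by (simp add: ennreal_mult_less_top)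
    finally have fin: "\<rho> ?G < \<infinity>" .
    have "(2::real) ^ J \<le> 2 ^ (j + J)" by (intro power_increasing) auto
    then have "1 / \<tau>0 \<le> 2 ^ (j + J)" by (rule order_trans[OF less_imp_le[OF J]])
    then have \<tau>: "?\<tau> \<le> \<tau>0" using \<tau>0(1) by (simp add: field_simps)
    have "\<rho> (\<lambda>t. G (2 ^ j * t)) = \<rho> (\<lambda>t. ?G (t / ?\<tau>))" by (simp add: power_add field_simps)
    also have "\<dots> \<le> ennreal (?\<tau> powr (1 / s)) * \<rho> ?G"
      by (rule dilation_norm_bound[OF \<rho> G' fin _ \<tau>0(2)[OF _ \<tau>]]) auto
    also have "\<dots> \<le> ennreal (?\<tau> powr (1 / s)) * (ennreal (L * 2 powr (real J / r)) * \<rho> G)"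
      by (rule mult_left_mono[OF le]) simp
    also have "\<dots> = ennreal (?\<tau> powr (1 / s) * (L * 2 powr (real J / r))) * \<rho> G"
      by (simp add: ennreal_mult' mult.assoc)
    also have "?\<tau> powr (1 / s) * (L * 2 powr (real J / r)) = K * 2 powr (- real j / s)"
    proof -
      have "?\<tau> = 2 powr (- real (j + J))" by (simp only: powr_minus_divide powr_realpow)
      then have "?\<tau> powr (1 / s) = 2 powr (- real J / s) * 2 powr (- real j / s)"
        by (simp only: powr_powr powr_add[symmetric]) (simp add: diff_divide_distrib algebra_simps)
      then show ?thesis by (simp only: K_def mult_ac)
    qed
    finally show "\<rho> (\<lambda>t. G (2 ^ j * t)) \<le> ennreal (K * 2 powr (- real j / s)) * \<rho> G" .
  qed
qed

text \<open>A discrete form of the Calderon operator for the weak types \<open>(r\<^sub>0, r\<^sub>0)\<close> and \<open>(r\<^sub>1, r\<^sub>1)\<close>.\<close>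

definition calderon_sum :: "real \<Rightarrow> real \<Rightarrow> (real \<Rightarrow> ennreal) \<Rightarrow> real \<Rightarrow> ennreal" where
  "calderon_sum r0 r1 G t = (\<Sum>k. ennreal (2 powr (- real k / r0)) * G (t / 2 ^ Suc k)) +
     (\<Sum>k. ennreal (2 powr (real (Suc k) / r1)) * G (2 ^ k * t))"

lemma calderon_sum_measurable:
  assumes "decreasing_fun G"
  shows "calderon_sum r0 r1 G \<in> borel_measurable half_line"
proof -
  have 1: "(\<lambda>t. G (t / 2 ^ i)) \<in> borel_measurable half_line" for i
    using decreasing_fun_measurable[OF decreasing_fun_scale[OF assms, of "1 / 2 ^ i"]] by simp
  have 2: "(\<lambda>t. G (2 ^ i * t)) \<in> borel_measurable half_line" for i
    using decreasing_fun_measurable[OF decreasing_fun_scale[OF assms, of "2 ^ i"]] by simp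
  show ?thesis unfolding calderon_sum_def
    by (intro borel_measurable_add borel_measurable_suminf_order borel_measurable_times_ennreal 1 2 borel_measurable_const)
qed

text \<open>Exponents r0 < r < p and q < s < r1 leave room on both sides: the k-th terms have norms
  of order 2^(k (1/r - 1/r0)) and 2^(k (1/r1 - 1/s)) relative to that of G, both geometric with
  ratio below 1.\<close>

lemma calderon_sum_bound:
  assumes \<rho>: "banach_function_norm half_line \<rho>" and p: "has_boyd_index_p \<rho> p" "0 < r0" "r0 < p"
    and q: "has_boyd_index_q \<rho> q" "0 < q" "q < r1"
  obtains M :: real where "0 \<le> M" "\<And>G. decreasing_fun G \<Longrightarrow> \<rho> G < \<infinity> \<Longrightarrow> \<rho> (calderon_sum r0 r1 G) \<le> ennreal M * \<rho> G"
proof -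
  interpret banach_function_norm half_line \<rho> by fact
  obtain r where r: "r0 < r" "r < p" using dense[OF p(3)] by blast
  obtain s where s: "q < s" "s < r1" using dense[OF q(3)] by blast
  obtain K where K: "0 < K" "\<And>G j. decreasing_fun G \<Longrightarrow> \<rho> G < \<infinity> \<Longrightarrow> \<rho> (\<lambda>t. G (t / 2 ^ j)) \<le> ennreal (K * 2 powr (real j / r)) * \<rho> G"
    using dilation_bound_up[OF \<rho> p(1) _ r(2)] p(2) r(1) by (metis less_trans)
  obtain L where L: "0 < L" "\<And>G j. decreasing_fun G \<Longrightarrow> \<rho> G < \<infinity> \<Longrightarrow> \<rho> (\<lambda>t. G (2 ^ j * t)) \<le> ennreal (L * 2 powr (- real j / s)) * \<rho> G"
    using dilation_bound_down[OF \<rho> p(1) _ r(2) q(1,2) s(1)] p(2) r(1) by (metis less_trans)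
  define \<alpha> where "\<alpha> = 2 powr (1 / r - 1 / r0)"
  define \<beta> where "\<beta> = 2 powr (1 / r1 - 1 / s)"
  have \<alpha>: "0 \<le> \<alpha>" "\<alpha> < 1" unfolding \<alpha>_def using r p by (auto simp: powr_less_one frac_less2)
  have \<beta>: "0 \<le> \<beta>" "\<beta> < 1" unfolding \<beta>_def using s q by (auto simp: powr_less_one frac_less2)
  define a where "a = K * 2 powr (1 / r)"
  define b where "b = L * 2 powr (1 / r1)"
  have ab: "0 \<le> a" "0 \<le> b" using K L by (auto simp: a_def b_def)
  have t1: "2 powr (- real k / r0) * (K * 2 powr (real (Suc k) / r)) = a * \<alpha> ^ k" for k
  proof -
    have "\<alpha> ^ k = 2 powr (real k * (1 / r - 1 / r0))" unfolding \<alpha>_def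
      by (subst powr_realpow[symmetric]) (auto simp: powr_powr mult.commute)
    then have "a * \<alpha> ^ k = K * 2 powr (1 / r + real k * (1 / r - 1 / r0))" by (simp only: a_def powr_add mult_ac)
    also have "1 / r + real k * (1 / r - 1 / r0) = - real k / r0 + real (Suc k) / r" by (simp add: field_simps add_divide_distrib)
    finally show ?thesis by (simp only: powr_add mult_ac)
  qed
  have t2: "2 powr (real (Suc k) / r1) * (L * 2 powr (- real k / s)) = b * \<beta> ^ k" for k
  proof -
    have "\<beta> ^ k = 2 powr (real k * (1 / r1 - 1 / s))" unfolding \<beta>_def
      by (subst powr_realpow[symmetric]) (auto simp: powr_powr mult.commute)
    then have "b * \<beta> ^ k = L * 2 powr (1 / r1 + real k * (1 / r1 - 1 / s))" by (simp only: b_def powr_add mult_ac)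
    also have "1 / r1 + real k * (1 / r1 - 1 / s) = real (Suc k) / r1 + - real k / s" by (simp add: field_simps add_divide_distrib)
    finally show ?thesis by (simp only: powr_add mult_ac)
  qed
  define M where "M = a * (1 / (1 - \<alpha>)) + b * (1 / (1 - \<beta>))"
  have M: "0 \<le> M" using ab \<alpha> \<beta> by (simp add: M_def)
  show thesis
  proof (rule that[OF M])
    fix G assume G: "decreasing_fun G" "\<rho> G < \<infinity>"
    have m1: "(\<lambda>t. G (t / 2 ^ i)) \<in> borel_measurable half_line" for i
      using decreasing_fun_measurable[OF decreasing_fun_scale[OF G(1), of "1 / 2 ^ i"]] by simp
    have m2: "(\<lambda>t. G (2 ^ i * t)) \<in> borel_measurable half_line" for i
      using decreasing_fun_measurable[OF decreasing_fun_scale[OF G(1), of "2 ^ i"]] by simp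
    let ?f = "\<lambda>k t. ennreal (2 powr (- real k / r0)) * G (t / 2 ^ Suc k)"
    let ?g = "\<lambda>k t. ennreal (2 powr (real (Suc k) / r1)) * G (2 ^ k * t)"
    have fm: "?f k \<in> borel_measurable half_line" for k by (intro borel_measurable_times_ennreal m1 borel_measurable_const)
    have gm: "?g k \<in> borel_measurable half_line" for k by (intro borel_measurable_times_ennreal m2 borel_measurable_const)
    have "\<rho> (\<lambda>t. \<Sum>k. ?f k t) \<le> (\<Sum>k. \<rho> (?f k))" by (rule norm_suminf_le[OF fm])
    also have "\<dots> \<le> (\<Sum>k. ennreal (a * \<alpha> ^ k) * \<rho> G)"
    proof (rule suminf_le)
      fix k
      have "\<rho> (?f k) = ennreal (2 powr (- real k / r0)) * \<rho> (\<lambda>t. G (t / 2 ^ Suc k))" by (rule norm_scale[OF m1]) simp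
      also have "\<dots> \<le> ennreal (2 powr (- real k / r0)) * (ennreal (K * 2 powr (real (Suc k) / r)) * \<rho> G)"
        by (rule mult_left_mono[OF K(2)[OF G]]) simp
      also have "\<dots> = ennreal (a * \<alpha> ^ k) * \<rho> G" unfolding t1[symmetric] by (simp only: ennreal_mult' powr_ge_zero mult.assoc)
      finally show "\<rho> (?f k) \<le> ennreal (a * \<alpha> ^ k) * \<rho> G" .
    qed auto
    also have "\<dots> = (\<Sum>k. ennreal (a * \<alpha> ^ k)) * \<rho> G" by (rule ennreal_suminf_multc)
    also have "(\<Sum>k. ennreal (a * \<alpha> ^ k)) = ennreal (a * (1 / (1 - \<alpha>)))"
      using \<alpha> ab by (intro suminf_ennreal_eq sums_mult geometric_sums) auto
    finally have 1: "\<rho> (\<lambda>t. \<Sum>k. ?f k t) \<le> ennreal (a * (1 / (1 - \<alpha>))) * \<rho> G" .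
    have "\<rho> (\<lambda>t. \<Sum>k. ?g k t) \<le> (\<Sum>k. \<rho> (?g k))" by (rule norm_suminf_le[OF gm])
    also have "\<dots> \<le> (\<Sum>k. ennreal (b * \<beta> ^ k) * \<rho> G)"
    proof (rule suminf_le)
      fix k
      have "\<rho> (?g k) = ennreal (2 powr (real (Suc k) / r1)) * \<rho> (\<lambda>t. G (2 ^ k * t))" by (rule norm_scale[OF m2]) simp
      also have "\<dots> \<le> ennreal (2 powr (real (Suc k) / r1)) * (ennreal (L * 2 powr (- real k / s)) * \<rho> G)"
        by (rule mult_left_mono[OF L(2)[OF G]]) simp
      also have "\<dots> = ennreal (b * \<beta> ^ k) * \<rho> G" unfolding t2[symmetric] by (simp only: ennreal_mult' powr_ge_zero mult.assoc)
      finally show "\<rho> (?g k) \<le> ennreal (b * \<beta> ^ k) * \<rho> G" .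
    qed auto
    also have "\<dots> = (\<Sum>k. ennreal (b * \<beta> ^ k)) * \<rho> G" by (rule ennreal_suminf_multc)
    also have "(\<Sum>k. ennreal (b * \<beta> ^ k)) = ennreal (b * (1 / (1 - \<beta>)))"
      using \<beta> ab by (intro suminf_ennreal_eq sums_mult geometric_sums) auto
    finally have 2: "\<rho> (\<lambda>t. \<Sum>k. ?g k t) \<le> ennreal (b * (1 / (1 - \<beta>))) * \<rho> G" .
    have "\<rho> (calderon_sum r0 r1 G) \<le> \<rho> (\<lambda>t. \<Sum>k. ?f k t) + \<rho> (\<lambda>t. \<Sum>k. ?g k t)"
      unfolding calderon_sum_def[abs_def] by (rule norm_triangle) (intro borel_measurable_suminf_order fm gm)+
    also have "\<dots> \<le> ennreal (a * (1 / (1 - \<alpha>))) * \<rho> G + ennreal (b * (1 / (1 - \<beta>))) * \<rho> G" by (rule add_mono[OF 1 2])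
    also have "\<dots> = ennreal M * \<rho> G" using ab \<alpha> \<beta> by (simp add: M_def ennreal_plus distrib_right)
    finally show "\<rho> (calderon_sum r0 r1 G) \<le> ennreal M * \<rho> G" .
  qed
qed

section \<open>Boundedness of the Hardy operators\<close>

text \<open>Setting the value 0 outside (0, \<infinity>) makes this measurable on the whole line,
  although f is constrained on the half-line only. The value lost at 0 concerns a null set.\<close>

definition modulus :: "(real \<Rightarrow> complex) \<Rightarrow> real \<Rightarrow> real" where
  "modulus f t = (if 0 < t then norm (f t) else 0)"

lemma modulus_nonneg: "0 \<le> modulus f t"
  by (simp add: modulus_def)

lemma measurable_funs_zero_extension:
  assumes "f \<in> measurable_funs"
  shows "(\<lambda>t. if t \<in> {0..} then f t else 0) \<in> borel_measurable lebesgue"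
  using assms by (subst measurable_If_restrict_space_iff) (auto simp: atLeast_def)

lemma modulus_measurable:
  assumes "f \<in> measurable_funs"
  shows "modulus f \<in> borel_measurable lebesgue"
proof -
  have m: "(\<lambda>t. if t \<in> {0..} then f t else 0) \<in> borel_measurable lebesgue"
    by (rule measurable_funs_zero_extension[OF assms])
  have "(\<lambda>t. indicat_real {0<..} t * norm (if t \<in> {0..} then f t else 0)) \<in> borel_measurable lebesgue"
    by (intro borel_measurable_times borel_measurable_indicator measurable_compose[OF m borel_measurable_norm]) auto
  moreover have "modulus f = (\<lambda>t. indicat_real {0<..} t * norm (if t \<in> {0..} then f t else 0))"
    by (auto simp: modulus_def indicator_def fun_eq_iff)
  ultimately show ?thesis by simp
qed

lemma decreasing_rearrangement: "decreasing_fun (rearrangement w f)"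
  unfolding decreasing_fun_def by (auto intro: rearrangement_antimono)

lemma weighted_spaceD:
  assumes \<rho>: "banach_function_norm half_line \<rho>" and w: "weight w" and f: "f \<in> weighted_space \<rho> w"
  defines "g \<equiv> \<lambda>s. enn2real (rearrangement w f s)"
  shows "f \<in> measurable_funs" "\<rho> (rearrangement w f) < \<infinity>"
    "\<And>s. 0 < s \<Longrightarrow> rearrangement w f s = ennreal (g s)"
    "\<And>s. 0 < s \<Longrightarrow> weight_measure (extend_weight w) {x. 0 < x \<and> g s < modulus f x} \<le> ennreal s"
proof -
  show f': "f \<in> measurable_funs" "\<rho> (rearrangement w f) < \<infinity>"
    using f by (auto simp: weighted_space_def weighted_norm_def)
  show eq: "rearrangement w f s = ennreal (g s)" if "0 < s" for s
    using decreasing_fun_finite[OF \<rho> decreasing_rearrangement f'(2) that] by (simp add: g_def)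
  show "weight_measure (extend_weight w) {x. 0 < x \<and> g s < modulus f x} \<le> ennreal s" if "0 < s" for s
  proof -
    have "weight_measure (extend_weight w) {x. 0 < x \<and> g s < modulus f x} = distribution_fun w f (g s)"
      unfolding distribution_fun_def by (subst weight_measure_extend) (auto intro!: weight_measure_cong simp: modulus_def)
    also have "\<dots> \<le> ennreal s"
      by (rule distribution_fun_rearrangement[OF w f'(1) eq[OF that]]) (simp add: g_def)
    finally show ?thesis .
  qed
qed

text \<open>The link between the extended series used for norms and the real series used in the
  interpolation.\<close>

lemma calderon_sum_sums:
  assumes fin: "calderon_sum r0 r1 G t < \<infinity>" and G: "\<And>s. 0 < s \<Longrightarrow> G s = ennreal (g s)" "\<And>s. 0 \<le> g s" and t: "0 < t"
  obtains A B where "(\<lambda>k. 2 powr (- real k / r0) * g (t / 2 ^ Suc k)) sums A"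
    "(\<lambda>k. 2 powr (real (Suc k) / r1) * g (2 ^ k * t)) sums B" "0 \<le> A" "0 \<le> B"
    "calderon_sum r0 r1 G t = ennreal (A + B)"
proof -
  let ?a = "\<lambda>k. 2 powr (- real k / r0) * g (t / 2 ^ Suc k)" and ?b = "\<lambda>k. 2 powr (real (Suc k) / r1) * g (2 ^ k * t)"
  have a0: "0 \<le> ?a k" and b0: "0 \<le> ?b k" for k using G(2) by auto
  have a: "ennreal (2 powr (- real k / r0)) * G (t / 2 ^ Suc k) = ennreal (?a k)" for k
    using t by (subst G(1)) (auto simp: ennreal_mult')
  have b: "ennreal (2 powr (real (Suc k) / r1)) * G (2 ^ k * t) = ennreal (?b k)" for k
    using t by (subst G(1)) (auto simp: ennreal_mult')
  have S: "calderon_sum r0 r1 G t = (\<Sum>k. ennreal (?a k)) + (\<Sum>k. ennreal (?b k))"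
    unfolding calderon_sum_def by (simp only: a b)
  have fin2: "(\<Sum>k. ennreal (?a k)) \<noteq> top" "(\<Sum>k. ennreal (?b k)) \<noteq> top" using fin unfolding S by auto
  have sa: "summable ?a" by (rule summable_suminf_not_top[OF a0 fin2(1)])
  have sb: "summable ?b" by (rule summable_suminf_not_top[OF b0 fin2(2)])
  have AB: "0 \<le> suminf ?a" "0 \<le> suminf ?b" using suminf_nonneg[OF sa a0] suminf_nonneg[OF sb b0] by auto
  show thesis
  proof (rule that[OF summable_sums[OF sa] summable_sums[OF sb] AB])
    show "calderon_sum r0 r1 G t = ennreal (suminf ?a + suminf ?b)"
      unfolding S suminf_ennreal2[OF a0 sa] suminf_ennreal2[OF b0 sb] using AB by (rule ennreal_plus[symmetric])
  qed
qed

text \<open>The Calderon sum has finite norm, hence is finite at some t in (0, 1], and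
  \<open>rearrangement_split\<close> at this one t places the two parts in weighted Lebesgue spaces
  with exponents r0 and r1. This decides whether the integrals defining \<open>hardy_P f\<close> and
  \<open>hardy_Q f\<close> exist.\<close>

lemma weighted_space_split:
  assumes \<rho>: "banach_function_norm half_line \<rho>" and p: "has_boyd_index_p \<rho> p" "1 \<le> r0" "r0 < p"
    and q: "has_boyd_index_q \<rho> q" "0 < q" "q < r1" "1 \<le> r1" and w: "weight w" and f: "f \<in> weighted_space \<rho> w"
  obtains f0 f1 where "f0 \<in> borel_measurable lebesgue" "\<And>x. 0 \<le> f0 x" "f1 \<in> borel_measurable lebesgue" "\<And>x. 0 \<le> f1 x"
    "\<And>x. modulus f x = f0 x + f1 x"
    "weight_measure (\<lambda>x. f0 x powr r0 * extend_weight w x) {0<..} < \<infinity>"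
    "weight_measure (\<lambda>x. f1 x powr r1 * extend_weight w x) {0<..} < \<infinity>"
proof -
  let ?G = "rearrangement w f"
  define g where "g s = enn2real (rearrangement w f s)" for s
  note D = weighted_spaceD[OF \<rho> w f, folded g_def]
  have g0: "0 \<le> g s" for s by (simp add: g_def)
  have r0: "0 < r0" using p(2) by simp
  obtain M where "0 \<le> M" and M: "\<And>G. decreasing_fun G \<Longrightarrow> \<rho> G < \<infinity> \<Longrightarrow> \<rho> (calderon_sum r0 r1 G) \<le> ennreal M * \<rho> G"
    by (rule calderon_sum_bound[OF \<rho> p(1) r0 p(3) q(1,2,3)]) (assumption | blast)+
  have "\<rho> (calderon_sum r0 r1 ?G) \<le> ennreal M * \<rho> ?G" by (rule M[OF decreasing_rearrangement D(2)])
  also have "\<dots> < \<infinity>" using D(2) by (simp add: ennreal_mult_less_top)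
  finally have "\<rho> (calderon_sum r0 r1 ?G) < \<infinity>" .
  then have "(\<integral>\<^sup>+x\<in>{0..1}. calderon_sum r0 r1 ?G x \<partial>half_line) < \<infinity>"
    by (intro half_line_norm_finite_integral[OF \<rho>] calderon_sum_measurable decreasing_rearrangement) auto
  then have "\<exists>t. 0 < t \<and> t \<le> 1 \<and> calderon_sum r0 r1 ?G t \<noteq> \<infinity>"
    using half_line_infinite_integral[of 1 "calderon_sum r0 r1 ?G"] by force
  then obtain t where t: "0 < t" "calderon_sum r0 r1 ?G t < \<infinity>" by (auto simp: less_top)
  obtain A B where AB: "(\<lambda>k. 2 powr (- real k / r0) * g (t / 2 ^ Suc k)) sums A"
    "(\<lambda>k. 2 powr (real (Suc k) / r1) * g (2 ^ k * t)) sums B"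
    "0 \<le> A" "0 \<le> B" "calderon_sum r0 r1 ?G t = ennreal (A + B)"
    by (rule calderon_sum_sums[OF t(2) D(3) g0 t(1)])
  have Fm: "modulus f \<in> borel_measurable lebesgue" by (rule modulus_measurable[OF D(1)])
  note split = rearrangement_split[OF extend_weight_measurable[OF w] extend_weight_pos[OF w] Fm modulus_nonneg g0 D(4) t(1) p(2) q(4) AB(1,2)]
  define f0 where "f0 x = (if g t < modulus f x then modulus f x else 0)" for x
  define f1 where "f1 x = (if g t < modulus f x then 0 else modulus f x)" for x
  have Gset: "{x \<in> space lebesgue. g t < modulus f x} \<in> sets lebesgue" using Fm by measurable
  show thesis
  proof (rule that[of f0 f1])
    show "f0 \<in> borel_measurable lebesgue" "f1 \<in> borel_measurable lebesgue"
      unfolding f0_def f1_def using Fm Gset by (auto intro!: measurable_If)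
    show "weight_measure (\<lambda>x. f0 x powr r0 * extend_weight w x) {0<..} < \<infinity>"
      unfolding f0_def using split(1) by (auto intro: le_less_trans)
    show "weight_measure (\<lambda>x. f1 x powr r1 * extend_weight w x) {0<..} < \<infinity>"
      unfolding f1_def using split(2) by (auto intro: le_less_trans)
  qed (auto simp: f0_def f1_def modulus_nonneg)
qed

text \<open>Stated for a sublinear T on nonnegative functions that dominates H pointwise, so that
  both Hardy operators share one argument.\<close>

lemma weighted_interpolation:
  assumes \<rho>: "banach_function_norm half_line \<rho>" and p: "has_boyd_index_p \<rho> p" "1 \<le> r0" "r0 < p"
    and q: "has_boyd_index_q \<rho> q" "0 < q" "q < r1" "1 \<le> r1" and w: "weight w"
    and weak: "weak_type r0 (extend_weight w) T" "weak_type r1 (extend_weight w) T"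
    and Tm: "\<And>f. f \<in> borel_measurable lebesgue \<Longrightarrow> (\<And>t. 0 \<le> f t) \<Longrightarrow> T f \<in> borel_measurable lebesgue"
    and Tadd: "\<And>f g x. f \<in> borel_measurable lebesgue \<Longrightarrow> (\<And>t. 0 \<le> f t) \<Longrightarrow> g \<in> borel_measurable lebesgue \<Longrightarrow> (\<And>t. 0 \<le> g t) \<Longrightarrow>
       0 < x \<Longrightarrow> T (\<lambda>t. f t + g t) x \<le> T f x + T g x"
    and Hm: "\<And>f. f \<in> weighted_space \<rho> w \<Longrightarrow> H f \<in> measurable_funs"
    and Hle: "\<And>f t. f \<in> weighted_space \<rho> w \<Longrightarrow> 0 < t \<Longrightarrow> ennreal (norm (H f t)) \<le> T (modulus f) t"
  shows "bounded_on_weighted_space \<rho> w H"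
proof -
  interpret banach_function_norm half_line \<rho> by fact
  let ?W = "extend_weight w"
  have r0: "0 < r0" using p by simp
  obtain C where C: "0 < C" and interp:
    "\<And>F g t A B y. F \<in> borel_measurable lebesgue \<Longrightarrow> (\<And>t. 0 \<le> F t) \<Longrightarrow> (\<And>s. 0 < s \<Longrightarrow> 0 \<le> g s) \<Longrightarrow>
       (\<And>s. 0 < s \<Longrightarrow> weight_measure ?W {x. 0 < x \<and> g s < F x} \<le> ennreal s) \<Longrightarrow> 0 < t \<Longrightarrow>
       (\<lambda>k. 2 powr (- real k / r0) * g (t / 2 ^ Suc k)) sums A \<Longrightarrow>
       (\<lambda>k. 2 powr (real (Suc k) / r1) * g (2 ^ k * t)) sums B \<Longrightarrow> C * (A + B) < y \<Longrightarrow>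
       weight_measure ?W {x. 0 < x \<and> ennreal y < T F x} \<le> ennreal (2 * t)"
    by (rule weak_type_interpolation[OF extend_weight_measurable[OF w] extend_weight_pos[OF w] weak p(2) q(4) Tm Tadd])
      (assumption | blast)+
  obtain M where M: "0 \<le> M" "\<And>G. decreasing_fun G \<Longrightarrow> \<rho> G < \<infinity> \<Longrightarrow> \<rho> (calderon_sum r0 r1 G) \<le> ennreal M * \<rho> G"
    by (rule calderon_sum_bound[OF \<rho> p(1) r0 p(3) q(1,2,3)]) (assumption | blast)+
  obtain K where K: "0 < K" "\<And>G j. decreasing_fun G \<Longrightarrow> \<rho> G < \<infinity> \<Longrightarrow> \<rho> (\<lambda>t. G (t / 2 ^ j)) \<le> ennreal (K * 2 powr (real j / r0)) * \<rho> G"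
    by (rule dilation_bound_up[OF \<rho> p(1) r0 p(3)]) (assumption | blast)+
  define L where "L = C * (M * (K * 2 powr (1 / r0)))"
  have main: "weighted_norm \<rho> w (H f) \<le> ennreal L * weighted_norm \<rho> w f" if f: "f \<in> weighted_space \<rho> w" for f
  proof -
    let ?G = "rearrangement w f"
    define g where "g s = enn2real (rearrangement w f s)" for s
    note D = weighted_spaceD[OF \<rho> w f, folded g_def]
    have g0: "0 \<le> g s" for s by (simp add: g_def)
    have Gdec: "decreasing_fun ?G" by (rule decreasing_rearrangement)
    have Fm: "modulus f \<in> borel_measurable lebesgue" by (rule modulus_measurable[OF D(1)])
    have pt: "rearrangement w (H f) (2 * t) \<le> ennreal C * calderon_sum r0 r1 ?G t" if t: "0 < t" for t
    proof (cases "calderon_sum r0 r1 ?G t < \<infinity>")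
      case True
      obtain A B where AB: "(\<lambda>k. 2 powr (- real k / r0) * g (t / 2 ^ Suc k)) sums A"
        "(\<lambda>k. 2 powr (real (Suc k) / r1) * g (2 ^ k * t)) sums B" "0 \<le> A" "0 \<le> B"
        "calderon_sum r0 r1 ?G t = ennreal (A + B)"
        by (rule calderon_sum_sums[OF True D(3) g0 t])
      have "rearrangement w (H f) (2 * t) \<le> ennreal (C * (A + B))"
      proof (rule rearrangement_leI)
        show "0 \<le> C * (A + B)" using C AB by simp
        fix y assume y: "C * (A + B) < y"
        then have y0: "0 < y" using \<open>0 \<le> C * (A + B)\<close> by simp
        have "distribution_fun w (H f) y = weight_measure ?W {t. 0 < t \<and> y < norm (H f t)}"
          unfolding distribution_fun_def by (subst weight_measure_extend) auto
        also have "\<dots> \<le> weight_measure ?W {x. 0 < x \<and> ennreal y < T (modulus f) x}"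
        proof (rule weight_measure_subset, clarify)
          fix x assume "0 < x" "y < norm (H f x)"
          then have "ennreal y < ennreal (norm (H f x))" using y0 by (simp add: ennreal_less_iff)
          then show "ennreal y < T (modulus f) x" using Hle[OF f \<open>0 < x\<close>] by (rule less_le_trans)
        qed
        also have "\<dots> \<le> ennreal (2 * t)"
          by (rule interp[OF Fm modulus_nonneg g0 D(4) t AB(1,2) y])
        finally show "distribution_fun w (H f) y \<le> ennreal (2 * t)" .
      qed
      also have "\<dots> = ennreal C * calderon_sum r0 r1 ?G t" unfolding AB(5) using C by (intro ennreal_mult') simp
      finally show ?thesis .
    next
      case False
      then have "calderon_sum r0 r1 ?G t = \<infinity>" by (simp add: not_less top_unique)
      then show ?thesis using C by (simp add: ennreal_mult_top)
    qed
    \<comment> \<open>The pointwise bound has the argument 2 t on the left, since two level sets of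
      mass t were united. Stretching G by the factor 2 corrects this at the cost of one dilation
      norm.\<close>
    let ?G2 = "\<lambda>t. ?G (t / 2 ^ 1)"
    have G2: "decreasing_fun ?G2" using decreasing_fun_scale[OF Gdec, of "1 / 2"] by simp
    have \<rho>G2: "\<rho> ?G2 \<le> ennreal (K * 2 powr (1 / r0)) * \<rho> ?G" using K(2)[OF Gdec D(2), of 1] by simp
    also have "\<dots> < \<infinity>" using D(2) by (simp add: ennreal_mult_less_top)
    finally have \<rho>G2fin: "\<rho> ?G2 < \<infinity>" .
    have Sm: "calderon_sum r0 r1 ?G2 \<in> borel_measurable half_line" by (rule calderon_sum_measurable[OF G2])
    have pt2: "rearrangement w (H f) t \<le> ennreal C * calderon_sum r0 r1 ?G2 t" if "0 < t" for t
    proof -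
      have "calderon_sum r0 r1 ?G2 t = calderon_sum r0 r1 ?G (t / 2)"
        by (simp add: calderon_sum_def mult.commute)
      then show ?thesis using pt[of "t / 2"] that by simp
    qed
    have "weighted_norm \<rho> w (H f) \<le> \<rho> (\<lambda>t. ennreal C * calderon_sum r0 r1 ?G2 t)"
      unfolding weighted_norm_def
    proof (rule norm_mono)
      show "(\<lambda>t. ennreal C * calderon_sum r0 r1 ?G2 t) \<in> borel_measurable half_line" using Sm by measurable
      show "rearrangement w (H f) \<in> borel_measurable half_line" by (rule half_line_measurable[OF rearrangement_measurable])
      show "AE t in half_line. rearrangement w (H f) t \<le> ennreal C * calderon_sum r0 r1 ?G2 t"
        using AE_half_line_pos by (rule eventually_mono) (rule pt2)
    qed
    also have "\<dots> = ennreal C * \<rho> (calderon_sum r0 r1 ?G2)" by (rule norm_scale[OF Sm]) (use C in simp)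
    also have "\<dots> \<le> ennreal C * (ennreal M * (ennreal (K * 2 powr (1 / r0)) * \<rho> ?G))"
      by (intro mult_left_mono order_trans[OF M(2)[OF G2 \<rho>G2fin]] \<rho>G2) auto
    also have "\<dots> = ennreal L * \<rho> ?G" using C M(1) by (simp add: L_def ennreal_mult' mult.assoc)
    finally show ?thesis by (simp add: weighted_norm_def)
  qed
  show ?thesis unfolding bounded_on_weighted_space_def
  proof (intro exI[of _ L] ballI conjI)
    fix f assume f: "f \<in> weighted_space \<rho> w"
    show le: "weighted_norm \<rho> w (H f) \<le> ennreal L * weighted_norm \<rho> w f" by (rule main[OF f])
    also have "\<dots> < \<infinity>" using f by (simp add: weighted_space_def ennreal_mult_less_top)
    finally show "H f \<in> weighted_space \<rho> w" using Hm[OF f] by (simp add: weighted_space_def)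
  qed
qed

section \<open>The Hardy operators on the weighted space\<close>

lemma set_integrable_modulus:
  assumes f: "f \<in> measurable_funs" and S: "S \<in> sets lebesgue" "S \<subseteq> {0..}" and h: "h \<in> borel_measurable lebesgue" "\<And>t. 0 \<le> h t"
    and fin: "weight_measure (\<lambda>t. h t * modulus f t) S < \<infinity>"
  shows "set_integrable lebesgue S (\<lambda>t. h t *\<^sub>R f t)"
proof -
  have "(\<lambda>t. indicat_real S t *\<^sub>R (h t *\<^sub>R (if t \<in> {0..} then f t else 0))) \<in> borel_measurable lebesgue"
    using measurable_funs_zero_extension[OF f] S h
    by (intro borel_measurable_scaleR borel_measurable_indicator) auto
  also have "(\<lambda>t. indicat_real S t *\<^sub>R (h t *\<^sub>R (if t \<in> {0..} then f t else 0))) = (\<lambda>t. indicat_real S t *\<^sub>R (h t *\<^sub>R f t))"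
    using S(2) by (auto simp: indicator_def fun_eq_iff)
  finally have m: "(\<lambda>t. indicat_real S t *\<^sub>R (h t *\<^sub>R f t)) \<in> borel_measurable lebesgue" .
  have "AE t in lebesgue. t \<notin> {0::real}"
    by (rule AE_lebesgue_notin_finite) simp
  then have "AE t in lebesgue. ennreal (norm (indicat_real S t *\<^sub>R (h t *\<^sub>R f t))) = ennreal (h t * modulus f t) * indicator S t"
    by (rule eventually_mono) (use S(2) h(2) in \<open>auto simp: indicator_def modulus_def subset_eq\<close>)
  then have "(\<integral>\<^sup>+t. ennreal (norm (indicat_real S t *\<^sub>R (h t *\<^sub>R f t))) \<partial>lebesgue) = weight_measure (\<lambda>t. h t * modulus f t) S"
    unfolding weight_measure_def by (rule nn_integral_cong_AE)
  then show ?thesis using m fin by (simp add: set_integrable_def integrable_iff_bounded)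
qed

lemma hardy_P_measurable:
  assumes "f \<in> L1_loc"
  shows "hardy_P f \<in> measurable_funs"
proof -
  let ?I = "\<lambda>t. set_lebesgue_integral lebesgue {0..t} f"
  have int: "set_integrable lebesgue {0..b} f" for b
    using assms by (auto simp: L1_loc_def locally_integrable_on_def)
  have cont: "continuous_on {0..b} ?I" for b
  proof -
    have "continuous_on {0..b} (\<lambda>t. integral {0..t} f)"
      by (rule indefinite_integral_continuous_1[OF set_lebesgue_integral_eq_integral(1)[OF int]])
    moreover have "?I t = integral {0..t} f" for t by (rule set_lebesgue_integral_eq_integral(2)[OF int])
    ultimately show ?thesis by simp
  qed
  have "?I \<in> borel_measurable half_line"
  \<comment> \<open>Continuity is at hand on compact intervals only, so t is cut off at n; for fixed
    t the sequence is eventually constant.\<close>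
  proof (rule borel_measurable_LIMSEQ_metric[where f = "\<lambda>n t. ?I (min t (real n))"])
    fix n :: nat
    have "continuous_on {0..} (\<lambda>t. ?I (min t (real n)))"
      by (rule continuous_on_compose2[OF cont[of "real n"]]) (auto intro!: continuous_intros)
    then show "(\<lambda>t. ?I (min t (real n))) \<in> borel_measurable half_line"
      by (rule continuous_imp_measurable_on_sets_lebesgue) simp
  next
    fix t :: real
    obtain m where m: "t < real m" using reals_Archimedean2 by blast
    have "eventually (\<lambda>n. ?I (min t (real n)) = ?I t) sequentially"
      by (rule eventually_sequentiallyI[of m]) (use m in auto)
    then show "(\<lambda>n. ?I (min t (real n))) \<longlonglongrightarrow> ?I t" by (rule tendsto_eventually)
  qed
  moreover have "(\<lambda>t. 1 / t) \<in> borel_measurable half_line"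
    by (rule half_line_measurable, rule measurable_completion) measurable
  ultimately show ?thesis unfolding hardy_P_def[abs_def] by (intro borel_measurable_scaleR)
qed

lemma hardy_Q_measurable:
  assumes "f \<in> hardy_Q_domain"
  shows "hardy_Q f \<in> measurable_funs"
proof -
  let ?h = "\<lambda>s. (1 / s) *\<^sub>R f s"
  let ?I = "\<lambda>t. set_lebesgue_integral lebesgue {t<..} ?h"
  have int: "set_integrable lebesgue S ?h" if "S \<in> sets lebesgue" "S \<subseteq> {a..}" "0 < a" for S a
  proof (rule set_integrable_subset)
    show "set_integrable lebesgue {a / 2<..} ?h" using assms that(3) by (simp add: hardy_Q_domain_def)
  qed (use that in auto)
  have cont: "continuous_on {a..b} ?I" if a: "0 < a" for a b
  proof -
    have c: "continuous_on {a..b} (\<lambda>t. set_lebesgue_integral lebesgue {a..} ?h - integral {a..t} ?h)"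
      by (intro continuous_on_diff continuous_on_const indefinite_integral_continuous_1
        set_lebesgue_integral_eq_integral(1)[OF int[OF _ _ a]]) auto
    have e: "?I t = set_lebesgue_integral lebesgue {a..} ?h - integral {a..t} ?h" if t: "t \<in> {a..b}" for t
    proof -
      have "{a..} = {a..t} \<union> {t<..}" using t by auto
      then have "set_lebesgue_integral lebesgue {a..} ?h = set_lebesgue_integral lebesgue {a..t} ?h + ?I t"
        using t by (simp only:) (intro set_integral_Un int[OF _ _ a], auto)
      also have "set_lebesgue_integral lebesgue {a..t} ?h = integral {a..t} ?h"
        by (rule set_lebesgue_integral_eq_integral(2)[OF int[OF _ _ a]]) auto
      finally show ?thesis by simp
    qed
    show ?thesis by (rule continuous_on_eq[OF c e[symmetric]])
  qed
  \<comment> \<open>The clamp also keeps away from 0, where the integrand may fail to be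
    integrable.\<close>
  let ?c = "\<lambda>n t. max (1 / real (Suc n)) (min t (real (Suc n)))"
  have m1: "(\<lambda>t. indicat_real {0<..} t *\<^sub>R ?I t) \<in> borel_measurable half_line"
  proof (rule borel_measurable_LIMSEQ_metric[where f = "\<lambda>n t. indicat_real {0<..} t *\<^sub>R ?I (?c n t)"])
    fix n :: nat
    have "1 \<le> real (Suc n)" by simp
    then have "1 / real (Suc n) \<le> 1" by simp
    then have le: "1 / real (Suc n) \<le> real (Suc n)" using \<open>1 \<le> real (Suc n)\<close> by (rule order_trans)
    have "continuous_on {0..} (\<lambda>t. ?I (?c n t))"
      by (rule continuous_on_compose2[OF cont[of "1 / real (Suc n)" "real (Suc n)"]])
        (use le in \<open>auto intro!: continuous_intros\<close>)
    then have "(\<lambda>t. ?I (?c n t)) \<in> borel_measurable half_line"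
      by (rule continuous_imp_measurable_on_sets_lebesgue) simp
    moreover have "indicat_real {0<..} \<in> borel_measurable half_line"
      by (intro half_line_measurable borel_measurable_indicator) simp
    ultimately show "(\<lambda>t. indicat_real {0<..} t *\<^sub>R ?I (?c n t)) \<in> borel_measurable half_line"
      by (intro borel_measurable_scaleR)
  next
    fix t :: real
    show "(\<lambda>n. indicat_real {0<..} t *\<^sub>R ?I (?c n t)) \<longlonglongrightarrow> indicat_real {0<..} t *\<^sub>R ?I t"
    proof (cases "0 < t")
      case True
      obtain m where m: "t < real m" "1 / t < real m"
        using reals_Archimedean2[of "max t (1 / t)"] by auto
      have "eventually (\<lambda>n. indicat_real {0<..} t *\<^sub>R ?I (?c n t) = indicat_real {0<..} t *\<^sub>R ?I t) sequentially"
      proof (rule eventually_sequentiallyI[of m])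
        fix n assume "m \<le> n"
        then have "t < real (Suc n)" "1 / t < real (Suc n)" using m by auto
        then have "1 / real (Suc n) < t" using True by (simp add: field_simps)
        then have "?c n t = t" using \<open>t < real (Suc n)\<close> by simp
        then show "indicat_real {0<..} t *\<^sub>R ?I (?c n t) = indicat_real {0<..} t *\<^sub>R ?I t" by (simp only:)
      qed
      then show ?thesis by (rule tendsto_eventually)
    qed simp
  qed
  \<comment> \<open>Whatever \<open>hardy_Q f\<close> is at 0, it is confined to one point and added
    separately.\<close>
  have "indicat_real {0} \<in> borel_measurable half_line"
    by (intro half_line_measurable borel_measurable_indicator) simp
  then have "(\<lambda>t. indicat_real {0<..} t *\<^sub>R ?I t + indicat_real {0} t *\<^sub>R ?I 0) \<in> borel_measurable half_line"
    by (intro borel_measurable_add[OF m1] borel_measurable_scaleR borel_measurable_const)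
  moreover have e: "indicat_real {0<..} t *\<^sub>R ?I t + indicat_real {0} t *\<^sub>R ?I 0 = hardy_Q f t" if "t \<in> space half_line" for t
    using that by (auto simp: hardy_Q_def space_restrict_space indicator_def)
  ultimately show ?thesis by (simp only: measurable_cong[OF e])
qed

lemma norm_hardy_P_le:
  assumes f: "f \<in> L1_loc" and t: "0 < t"
  shows "ennreal (norm (hardy_P f t)) \<le> average_op (modulus f) t"
proof -
  have "integrable lebesgue (\<lambda>s. indicat_real {0..t} s *\<^sub>R f s)"
    using f by (auto simp: L1_loc_def locally_integrable_on_def set_integrable_def)
  then have "ennreal (norm (set_lebesgue_integral lebesgue {0..t} f)) \<le>
      (\<integral>\<^sup>+s. ennreal (norm (indicat_real {0..t} s *\<^sub>R f s)) \<partial>lebesgue)"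
    unfolding set_lebesgue_integral_def by (rule integral_norm_bound_ennreal)
  also have "\<dots> = weight_measure (modulus f) {0<..<t}"
    unfolding weight_measure_def
  proof (rule nn_integral_cong_AE)
    have "AE s in lebesgue. s \<notin> {0, t}"
      by (rule AE_lebesgue_notin_finite) simp
    then show "AE s in lebesgue. ennreal (norm (indicat_real {0..t} s *\<^sub>R f s)) = ennreal (modulus f s) * indicator {0<..<t} s"
      by (rule eventually_mono) (auto simp: indicator_def modulus_def)
  qed
  finally have "ennreal (1 / t) * ennreal (norm (set_lebesgue_integral lebesgue {0..t} f)) \<le> average_op (modulus f) t"
    unfolding average_op_def by (rule mult_left_mono) simp
  then show ?thesis using t by (simp add: hardy_P_def ennreal_mult'[symmetric])
qed

lemma norm_hardy_Q_le:
  assumes f: "f \<in> hardy_Q_domain" and t: "0 < t"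
  shows "ennreal (norm (hardy_Q f t)) \<le> tail_op (modulus f) t"
proof -
  have "integrable lebesgue (\<lambda>s. indicat_real {t<..} s *\<^sub>R (1 / s) *\<^sub>R f s)"
    using f t by (simp add: hardy_Q_domain_def set_integrable_def)
  then have "ennreal (norm (hardy_Q f t)) \<le>
      (\<integral>\<^sup>+s. ennreal (norm (indicat_real {t<..} s *\<^sub>R (1 / s) *\<^sub>R f s)) \<partial>lebesgue)"
    unfolding hardy_Q_def set_lebesgue_integral_def by (rule integral_norm_bound_ennreal)
  also have "\<dots> = tail_op (modulus f) t"
    unfolding tail_op_def weight_measure_def
    by (rule nn_integral_cong) (use t in \<open>auto simp: indicator_def modulus_def divide_inverse mult.commute\<close>)
  finally show ?thesis .
qed

lemma weighted_space_subset_L1_loc: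
  assumes \<rho>: "banach_function_norm half_line \<rho>" and p: "has_boyd_index_p \<rho> p" "1 < r0" "r0 < p"
    and q: "has_boyd_index_q \<rho> q" "0 < q" "q < r1" "1 < r1" and w: "weight w"
    and Ap: "Ap_minus_on r0 K0 {0..} (extend_weight w)" "Ap_minus_on r1 K1 {0..} (extend_weight w)"
  shows "weighted_space \<rho> w \<subseteq> L1_loc"
proof
  fix f assume f: "f \<in> weighted_space \<rho> w"
  have fm: "f \<in> measurable_funs" by (rule weighted_spaceD(1)[OF \<rho> w f])
  obtain f0 f1 where s: "f0 \<in> borel_measurable lebesgue" "\<And>x. 0 \<le> f0 x" "f1 \<in> borel_measurable lebesgue" "\<And>x. 0 \<le> f1 x"
    "\<And>x. modulus f x = f0 x + f1 x"
    "weight_measure (\<lambda>x. f0 x powr r0 * extend_weight w x) {0<..} < \<infinity>"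
    "weight_measure (\<lambda>x. f1 x powr r1 * extend_weight w x) {0<..} < \<infinity>"
    by (rule weighted_space_split[OF \<rho> p(1) less_imp_le[OF p(2)] p(3) q(1,2,3) less_imp_le[OF q(4)] w f]) (assumption | blast)+
  note W = extend_weight_measurable[OF w] extend_weight_pos[OF w]
  have int: "set_integrable lebesgue {0..b} f" for b
  proof -
    have "weight_measure (\<lambda>t. 1 * modulus f t) {0..b} \<le> weight_measure (\<lambda>t. f0 t + f1 t) {0<..<b + 1}"
    proof -
      have "weight_measure (\<lambda>t. 1 * modulus f t) {0..b} = weight_measure (modulus f) {0<..b}"
        unfolding weight_measure_def by (rule nn_integral_cong) (auto simp: indicator_def modulus_def)
      also have "\<dots> \<le> weight_measure (\<lambda>t. f0 t + f1 t) {0<..<b + 1}"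
        by (rule weight_measure_mono) (auto simp: s(5))
      finally show ?thesis .
    qed
    also have "\<dots> = weight_measure f0 {0<..<b + 1} + weight_measure f1 {0<..<b + 1}"
      by (rule weight_measure_add) (use s in auto)
    also have "\<dots> < \<infinity>"
      using Ap_minus_integrable[OF W p(2) Ap(1) s(1,2,6)] Ap_minus_integrable[OF W q(4) Ap(2) s(3,4,7)] by simp
    finally have "set_integrable lebesgue {0..b} (\<lambda>t. 1 *\<^sub>R f t)"
      by (intro set_integrable_modulus[OF fm]) auto
    then show ?thesis by simp
  qed
  have "locally_integrable_on {0..} f" unfolding locally_integrable_on_def
  proof (intro allI impI, elim conjE)
    fix S :: "real set" assume S: "compact S" "S \<subseteq> {0..}"
    obtain b where "\<And>t. t \<in> S \<Longrightarrow> norm t \<le> b"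
      using compact_imp_bounded[OF S(1)] unfolding bounded_iff by blast
    then have "S \<subseteq> {0..b}" using S(2) by force
    then show "set_integrable lebesgue S f"
      by (rule set_integrable_subset[OF int, rotated]) (use S(1) in \<open>simp add: borel_compact\<close>)
  qed
  with fm show "f \<in> L1_loc" by (simp add: L1_loc_def)
qed

lemma weighted_space_subset_hardy_Q_domain:
  assumes \<rho>: "banach_function_norm half_line \<rho>" and p: "has_boyd_index_p \<rho> p" "1 < r0" "r0 < p"
    and q: "has_boyd_index_q \<rho> q" "0 < q" "q < r1" "1 < r1" and w: "weight w" and K: "0 < K0" "0 < K1"
    and Ap: "Ap_plus r0 K0 (extend_weight w)" "Ap_plus r1 K1 (extend_weight w)"
  shows "weighted_space \<rho> w \<subseteq> hardy_Q_domain"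
proof
  fix f assume f: "f \<in> weighted_space \<rho> w"
  have fm: "f \<in> measurable_funs" by (rule weighted_spaceD(1)[OF \<rho> w f])
  obtain f0 f1 where s: "f0 \<in> borel_measurable lebesgue" "\<And>x. 0 \<le> f0 x" "f1 \<in> borel_measurable lebesgue" "\<And>x. 0 \<le> f1 x"
    "\<And>x. modulus f x = f0 x + f1 x"
    "weight_measure (\<lambda>x. f0 x powr r0 * extend_weight w x) {0<..} < \<infinity>"
    "weight_measure (\<lambda>x. f1 x powr r1 * extend_weight w x) {0<..} < \<infinity>"
    by (rule weighted_space_split[OF \<rho> p(1) less_imp_le[OF p(2)] p(3) q(1,2,3) less_imp_le[OF q(4)] w f]) (assumption | blast)+
  note W = extend_weight_measurable[OF w] extend_weight_pos[OF w]
  \<comment> \<open>Applied to each part with its own exponent; finite tails of the modulus are the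
    absolute convergence of the integral defining \<open>hardy_Q f\<close>.\<close>
  have fin: "tail_op g t < \<infinity>" if r: "1 < r" "0 < K" "Ap_plus r K (extend_weight w)"
    and g: "g \<in> borel_measurable lebesgue" "\<And>x. 0 \<le> g x" "weight_measure (\<lambda>x. g x powr r * extend_weight w x) {0<..} < \<infinity>"
    and t: "0 < t" for r K g t
  proof -
    obtain C where "0 < C" and H: "\<And>f \<phi> t. f \<in> borel_measurable lebesgue \<Longrightarrow> (\<And>t. 0 \<le> f t) \<Longrightarrow> 0 < t \<Longrightarrow> 0 \<le> \<phi> \<Longrightarrow>
      weight_measure (\<lambda>t. f t powr r * extend_weight w t) {0<..} \<le> ennreal \<phi> \<Longrightarrow>
      \<exists>V>0. \<exists>i\<ge>0. weight_measure (extend_weight w) {0<..<t} = ennreal V \<and> tail_op f t = ennreal i \<and> V * i powr r \<le> C * \<phi>"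
      by (rule Ap_plus_tail_Holder[OF W r]) (assumption | blast)+
    show ?thesis
      using H[of g t "enn2real (weight_measure (\<lambda>x. g x powr r * extend_weight w x) {0<..})"] g t by auto
  qed
  have "set_integrable lebesgue {\<tau><..} (\<lambda>s. (1 / s) *\<^sub>R f s)" if \<tau>: "0 < \<tau>" for \<tau>
  proof -
    let ?h = "\<lambda>s. 1 / \<bar>s\<bar> :: real"
    have "weight_measure (\<lambda>s. ?h s * modulus f s) {\<tau><..} = tail_op (\<lambda>s. f0 s + f1 s) \<tau>"
      unfolding tail_op_def by (rule weight_measure_cong) (use \<tau> in \<open>auto simp: s(5)\<close>)
    also have "\<dots> = tail_op f0 \<tau> + tail_op f1 \<tau>" by (rule tail_op_add[OF s(1,2,3,4) \<tau>])
    also have "\<dots> < \<infinity>"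
      using fin[OF p(2) K(1) Ap(1) s(1,2,6) \<tau>] fin[OF q(4) K(2) Ap(2) s(3,4,7) \<tau>] by simp
    finally have "set_integrable lebesgue {\<tau><..} (\<lambda>s. ?h s *\<^sub>R f s)"
    proof (intro set_integrable_modulus[OF fm])
      show "?h \<in> borel_measurable lebesgue" by (rule measurable_completion) measurable
    qed (use \<tau> in auto)
    also have "set_integrable lebesgue {\<tau><..} (\<lambda>s. ?h s *\<^sub>R f s) = set_integrable lebesgue {\<tau><..} (\<lambda>s. (1 / s) *\<^sub>R f s)"
      by (rule set_integrable_cong) (use \<tau> in auto)
    finally show ?thesis .
  qed
  with fm show "f \<in> hardy_Q_domain" by (simp add: hardy_Q_domain_def)
qed

section \<open>The inclusions of the weight classes\<close>

lemma A_minus_subset_M_lower: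
  assumes \<rho>: "banach_function_norm half_line \<rho>" and p: "has_boyd_index_p \<rho> p" "1 < p"
    and q: "has_boyd_index_q \<rho> q" "1 < q"
  shows "A_minus p \<subseteq> M_lower \<rho>"
proof
  fix w assume wA: "w \<in> A_minus p"
  then have w: "weight w" by (simp add: A_minus_def)
  let ?W = "extend_weight w"
  note W = extend_weight_measurable[OF w] extend_weight_pos[OF w]
  obtain K where K: "0 < K" "Ap_minus_on p K {0..} ?W"
    by (rule A_minus_imp_Ap_minus_on[OF wA p(2)])
  obtain r0 K0 where r0: "1 < r0" "r0 < p" "0 < K0" and imp:
    "\<And>I w. w \<in> borel_measurable lebesgue \<Longrightarrow> (\<And>t. 0 < w t) \<Longrightarrow>
      (\<And>x z. x \<in> I \<Longrightarrow> z \<in> I \<Longrightarrow> {x..z} \<subseteq> I) \<Longrightarrow> Ap_minus_on p K I w \<Longrightarrow> Ap_minus_on r0 K0 I w"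
    by (rule Ap_minus_self_improvement[OF p(2) K(1)]) (assumption | blast)+
  have Ap0: "Ap_minus_on r0 K0 {0..} ?W" by (rule imp[OF W _ K(2)]) auto
  \<comment> \<open>Above q so that the second half of the Calderon sum converges, above p because
    the classes grow with the exponent.\<close>
  define r1 where "r1 = max p q + 1"
  have r1: "p < r1" "q < r1" "1 < r1" using p q by (auto simp: r1_def)
  obtain K1 where K1: "0 < K1" "Ap_minus_on r1 K1 {0..} ?W"
    by (rule Ap_minus_on_mono[OF W p(2) r1(1) K])
  have q0: "0 < q" using q by simp
  have sub: "weighted_space \<rho> w \<subseteq> L1_loc"
    by (rule weighted_space_subset_L1_loc[OF \<rho> p(1) r0(1,2) q(1) q0 r1(2,3) w Ap0 K1(2)])
  have "bounded_on_weighted_space \<rho> w hardy_P"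
  proof (rule weighted_interpolation[OF \<rho> p(1) less_imp_le[OF r0(1)] r0(2) q(1) q0 r1(2) less_imp_le[OF r1(3)] w])
    show "weak_type r0 ?W average_op" by (rule Ap_minus_weak_type[OF W r0(1,3) Ap0])
    show "weak_type r1 ?W average_op" by (rule Ap_minus_weak_type[OF W r1(3) K1])
  qed (use sub in \<open>auto intro: average_op_measurable average_op_add[THEN eq_refl] hardy_P_measurable norm_hardy_P_le\<close>)
  with w sub show "w \<in> M_lower \<rho>" by (simp add: M_lower_def)
qed

lemma A_plus_subset_M_upper:
  assumes \<rho>: "banach_function_norm half_line \<rho>" and p: "has_boyd_index_p \<rho> p" "1 < p"
    and q: "has_boyd_index_q \<rho> q" "1 < q"
  shows "A_plus p \<subseteq> M_upper \<rho>"
proof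
  fix w assume wA: "w \<in> A_plus p"
  let ?W = "extend_weight w"
  obtain K where K: "0 < K" "Ap_plus p K ?W" and w: "weight w"
    by (rule A_plus_imp_Ap_plus[OF wA p(2)])
  note W = extend_weight_measurable[OF w] extend_weight_pos[OF w]
  obtain r0 K0 where r0: "1 < r0" "r0 < p" "0 < K0" and Ap0: "Ap_plus r0 K0 ?W"
    by (rule Ap_plus_self_improvement[OF W p(2) K])
  define r1 where "r1 = max p q + 1"
  have r1: "p < r1" "q < r1" "1 < r1" using p q by (auto simp: r1_def)
  obtain K1 where K1: "0 < K1" "Ap_plus r1 K1 ?W"
    by (rule Ap_plus_mono[OF W p(2) r1(1) K])
  have q0: "0 < q" using q by simp
  have sub: "weighted_space \<rho> w \<subseteq> hardy_Q_domain"
    by (rule weighted_space_subset_hardy_Q_domain[OF \<rho> p(1) r0(1,2) q(1) q0 r1(2,3) w r0(3) K1(1) Ap0 K1(2)])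
  have "bounded_on_weighted_space \<rho> w hardy_Q"
  proof (rule weighted_interpolation[OF \<rho> p(1) less_imp_le[OF r0(1)] r0(2) q(1) q0 r1(2) less_imp_le[OF r1(3)] w])
    show "weak_type r0 ?W tail_op" by (rule Ap_plus_weak_type[OF W r0(1,3) Ap0])
    show "weak_type r1 ?W tail_op" by (rule Ap_plus_weak_type[OF W r1(3) K1])
  qed (use sub in \<open>auto intro: tail_op_measurable tail_op_add[THEN eq_refl] hardy_Q_measurable norm_hardy_Q_le\<close>)
  with w sub show "w \<in> M_upper \<rho>" by (simp add: M_upper_def)
qed

theorem corollary4p3:
  fixes \<rho> :: "(real \<Rightarrow> ennreal) \<Rightarrow> ennreal" and p q :: real
  assumes "ri_banach_function_norm half_line \<rho>"
    and "has_boyd_index_p \<rho> p" and "1 < p"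
    and "has_boyd_index_q \<rho> q" and "1 < q"
  shows "A_minus p \<subseteq> M_lower \<rho> \<and> A_plus p \<subseteq> M_upper \<rho> \<and> A_minus p \<inter> A_plus p \<subseteq> C_class \<rho>"
proof -
  have \<rho>: "banach_function_norm half_line \<rho>" using assms(1) by (rule ri_banach_function_norm.axioms)
  have "A_minus p \<subseteq> M_lower \<rho>" "A_plus p \<subseteq> M_upper \<rho>"
    using A_minus_subset_M_lower[OF \<rho> assms(2-5)] A_plus_subset_M_upper[OF \<rho> assms(2-5)] by auto
  then show ?thesis by (auto simp: C_class_def)
qed

end
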